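(* Let $H^{\sharp}$ be a Halin snark such that in each Halin fragment $F_i=D_i\circ B_i$ used in its construction both the decollineator $D_i$ and the bipartite $(2,2;1)$-pole $B_i$ are constructed from a cyclically $4$-edge-connected cubic graph of girth at least $5$; that is, $D_i=(G_i)_{uv}$ for some edge $uv$ of a cyclically $4$-edge-connected cubic graph $G_i$ of girth at least $5$, and $B_i=(G_i')_{u'w'v'}$ for some path $u'w'v'$ of length 2 in a bipartite cyclically $4$-edge-connected cubic graph $G_i'$ of girth at least $5$. Then $H^{\sharp}$ is cyclically $4$-edge-connected and has girth at least $5$.
   Context: Graphs are finite. A cubic graph is cyclically $4$-edge-connected if no set of fewer than four edges has the property that its removal leaves at least two components containing cycles. Multipoles. A multipole consists of vertices and edges; each edge has two ends, each of which may or may not be incident with a vertex; a free end is called a semiedge. All vertices of multipoles considered have degree 3. The junction of two semiedges identifies these free ends, merging their edges into one edge. A $(2,2)$-pole has exactly four semiedges, divided into an input connector and an output connector of size 2 each; a $(2,2;1)$-pole has in addition one residual semiedge. For an edge $uv$ of a cubic graph $G$, $G_{uv}$ is the $(2,2)$-pole obtained by removing the path $uv$ (its vertices and its edge) and keeping as semiedges the remaining edge ends formerly incident with $u$ (input connector) and $v$ (output connector). For a path $uwv$ of length 2, $G_{uwv}$ is the $(2,2;1)$-pole obtained analogously by removing the path $uwv$, with input connector coming from $u$, output connector from $v$, and residual semiedge from $w$; it is called bipartite if $G$ is bipartite. The join $M_1\circ M_2$ is formed by performing junctions of the two semiedges of the output connector of $M_1$ with the two semiedges of the input connector of $M_2$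 (in either of the two possible ways); its input is that of $M_1$, its output that of $M_2$, and residual semiedges are kept. Decollineators. Let $p_1,\dots,p_4$ be a basis of $\mathbb{F}_2^4$. The tetrahedron $T$ has as points the vectors $p_i$ and $p_i+p_j$ $(i<j)$ and as lines the triples $\{p_i,p_i+p_j,p_j\}$. A $T$-flow on a multipole assigns to each edge a point of $T$ so that at each vertex the three values form a line of $T$. A decollineator is a $(2,2)$-pole that has no $T$-flow for which both the pair of values on the input connector and the pair of values on the output connector consist of two distinct points lying on a common line of $T$ (this does not depend on the choice of $T$). Halin snarks. A Halin fragment is a $(2,2;1)$-pole $F=D\circ B$ where $D$ is a decollineator and $B$ is a bipartite $(2,2;1)$-pole. A cubic Halin graph $H=C\cup S$ consists of a plane tree $S$ all of whose non-leaf vertices have degree 3 (with at least one such vertex) together with a circuit $C=(v_0v_1\cdots v_{k-1})$ passing through all leaves of $S$ so that $H$ is embedded in the plane, with $C$ bounding the outer face. Given Halin fragments $F_0,\dots,F_{k-1}$, a Halin snark $H^{\sharp}$ is obtained by performing, for each $i$ modulo $k$, junctions of the output connector of $F_i$ with the input connector of $F_{i+1}$ (in either of the two possible ways), adding the tree $S-\{v_0,\dots,v_{k-1}\}$, and attaching the residual semiedge of each $F_i$ to the vertex $v_i'$ that is the neighbour of $v_i$ in $S$. *)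

theory Defs
  imports
    "HOL-Analysis.Analysis"
    "HOL-Library.Z2"
    "HOL-Library.Numeral_Type"
    "HOL-Library.Extended_Nat"
begin

section \<open>Multipoles and graphs\<close>

text \<open>
  A multipole is given by its vertices and its edge ends. The map \<open>mate\<close> sends an end to
  the other end of the same edge, and \<open>inc\<close> sends an end to the vertex it is incident with
  (\<open>None\<close> for a free end). Parallel edges, loops and edges with two free ends are allowed. Outside
  \<open>ends\<close> the maps \<open>mate\<close> and \<open>inc\<close> are irrelevant. A graph is a multipole
  without free ends.
\<close>

record ('v, 'd) multipole =
  verts :: "'v set"
  ends :: "'d set"
  mate :: "'d \<Rightarrow> 'd"
  inc :: "'d \<Rightarrow> 'v option"

definition multipole :: "('v, 'd, 'z) multipole_scheme \<Rightarrow> bool" where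
  "multipole M \<longleftrightarrow>
     finite (verts M) \<and> finite (ends M) \<and>
     (\<forall>d\<in>ends M. mate M d \<in> ends M \<and> mate M d \<noteq> d \<and> mate M (mate M d) = d) \<and>
     (\<forall>d\<in>ends M. \<forall>x. inc M d = Some x \<longrightarrow> x \<in> verts M)"

definition semiedges :: "('v, 'd, 'z) multipole_scheme \<Rightarrow> 'd set" where
  "semiedges M = {d \<in> ends M. inc M d = None}"

definition ends_at :: "('v, 'd, 'z) multipole_scheme \<Rightarrow> 'v \<Rightarrow> 'd set" where
  "ends_at M x = {d \<in> ends M. inc M d = Some x}"

definition valency :: "('v, 'd, 'z) multipole_scheme \<Rightarrow> 'v \<Rightarrow> nat" where
  "valency M x = card (ends_at M x)"

definition edge_with_end :: "('v, 'd, 'z) multipole_scheme \<Rightarrow> 'd \<Rightarrow> 'd set" where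
  "edge_with_end M d = {d, mate M d}"

definition edges :: "('v, 'd, 'z) multipole_scheme \<Rightarrow> 'd set set" where
  "edges M = edge_with_end M ` ends M"

definition cubic :: "('v, 'd, 'z) multipole_scheme \<Rightarrow> bool" where
  "cubic M \<longleftrightarrow> (\<forall>x\<in>verts M. valency M x = 3)"

definition graph :: "('v, 'd, 'z) multipole_scheme \<Rightarrow> bool" where
  "graph M \<longleftrightarrow> multipole M \<and> semiedges M = {}"

definition cubic_graph :: "('v, 'd, 'z) multipole_scheme \<Rightarrow> bool" where
  "cubic_graph M \<longleftrightarrow> graph M \<and> cubic M"

definition adjacent :: "('v, 'd, 'z) multipole_scheme \<Rightarrow> 'v \<Rightarrow> 'v \<Rightarrow> bool" where
  "adjacent M x y \<longleftrightarrow> (\<exists>d\<in>ends M. inc M d = Some x \<and> inc M (mate M d) = Some y)"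

definition bipartite :: "('v, 'd, 'z) multipole_scheme \<Rightarrow> bool" where
  "bipartite M \<longleftrightarrow> (\<exists>X\<subseteq>verts M. \<forall>x y. adjacent M x y \<longrightarrow> (x \<in> X) \<noteq> (y \<in> X))"

definition component_of :: "('v, 'd, 'z) multipole_scheme \<Rightarrow> 'v \<Rightarrow> 'v set" where
  "component_of M x = {y \<in> verts M. (adjacent M)\<^sup>*\<^sup>* x y}"

definition graph_components :: "('v, 'd, 'z) multipole_scheme \<Rightarrow> 'v set set" where
  "graph_components M = component_of M ` verts M"

text \<open>
  A circuit is listed by the ends at which it leaves its successive vertices. The last condition
  says that no edge is used twice; it matters only for circuits of length 2.
\<close>

definition circuit :: "('v, 'd, 'z) multipole_scheme \<Rightarrow> 'd list \<Rightarrow> bool" where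
  "circuit M ds \<longleftrightarrow>
     ds \<noteq> [] \<and> set ds \<subseteq> ends M \<and>
     None \<notin> inc M ` set ds \<and> distinct (map (inc M) ds) \<and>
     (\<forall>i<length ds. inc M (mate M (ds ! i)) = inc M (ds ! (Suc i mod length ds))) \<and>
     (\<forall>d\<in>set ds. mate M d \<notin> set ds)"

definition contains_circuit :: "('v, 'd, 'z) multipole_scheme \<Rightarrow> 'v set \<Rightarrow> bool" where
  "contains_circuit M K \<longleftrightarrow> (\<exists>ds. circuit M ds \<and> inc M ` set ds \<subseteq> Some ` K)"

text \<open>The girth of an acyclic graph is \<open>\<infinity>\<close>.\<close>

definition girth :: "('v, 'd, 'z) multipole_scheme \<Rightarrow> enat" where
  "girth M = (INF ds\<in>{ds. circuit M ds}. enat (length ds))"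

definition delete_edges ::
  "('v, 'd, 'z) multipole_scheme \<Rightarrow> 'd set set \<Rightarrow> ('v, 'd, 'z) multipole_scheme" where
  "delete_edges M E = M\<lparr>ends := ends M - \<Union>E\<rparr>"

definition cyclically_4_edge_connected :: "('v, 'd, 'z) multipole_scheme \<Rightarrow> bool" where
  "cyclically_4_edge_connected M \<longleftrightarrow>
     cubic_graph M \<and>
     \<not> (\<exists>E\<subseteq>edges M. card E < 4 \<and>
          (\<exists>K\<in>graph_components (delete_edges M E). \<exists>L\<in>graph_components (delete_edges M E).
             K \<noteq> L \<and> contains_circuit (delete_edges M E) K \<and>
             contains_circuit (delete_edges M E) L))"


section \<open>Junctions\<close>

text \<open>
  The junction of two free ends \<open>s\<close> and \<open>t\<close> belonging to different edges: the
  opposite ends of the two edges become the two ends of one edge.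
\<close>

definition junction ::
  "'d \<times> 'd \<Rightarrow> ('v, 'd, 'z) multipole_scheme \<Rightarrow> ('v, 'd, 'z) multipole_scheme" where
  "junction = (\<lambda>(s, t) M.
     M\<lparr>ends := ends M - {s, t},
       mate := (mate M)(mate M s := mate M t, mate M t := mate M s)\<rparr>)"

definition junctions ::
  "('d \<times> 'd) list \<Rightarrow> ('v, 'd, 'z) multipole_scheme \<Rightarrow> ('v, 'd, 'z) multipole_scheme" where
  "junctions ps M = fold junction ps M"

text \<open>
  A way of joining two connectors (sets of free ends) end by end; for connectors of size 2
  there are two ways, up to the order in which the junctions are performed.
\<close>

definition pairing :: "'d set \<Rightarrow> 'e set \<Rightarrow> ('d \<times> 'e) list \<Rightarrow> bool" where
  "pairing P Q ps \<longleftrightarrow>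
     distinct (map fst ps) \<and> set (map fst ps) = P \<and>
     distinct (map snd ps) \<and> set (map snd ps) = Q"

definition disjoint_sum ::
  "('v, 'd, 'y) multipole_scheme \<Rightarrow> ('w, 'e, 'z) multipole_scheme \<Rightarrow>
   ('v + 'w, 'd + 'e) multipole" where
  "disjoint_sum M N =
     \<lparr>verts = verts M <+> verts N,
      ends = ends M <+> ends N,
      mate = map_sum (mate M) (mate N),
      inc = case_sum (map_option Inl \<circ> inc M) (map_option Inr \<circ> inc N)\<rparr>"

definition disjoint_family_sum ::
  "nat \<Rightarrow> (nat \<Rightarrow> ('v, 'd, 'z) multipole_scheme) \<Rightarrow> (nat \<times> 'v, nat \<times> 'd) multipole" where
  "disjoint_family_sum k F =
     \<lparr>verts = (SIGMA i:{..<k}. verts (F i)),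
      ends = (SIGMA i:{..<k}. ends (F i)),
      mate = (\<lambda>(i, d). (i, mate (F i) d)),
      inc = (\<lambda>(i, d). map_option (Pair i) (inc (F i) d))\<rparr>"


section \<open>Poles with input and output connectors\<close>

record ('v, 'd) pole = "('v, 'd) multipole" +
  inp :: "'d set"
  out :: "'d set"
  res :: "'d set"

text \<open>\<open>pole_22 0\<close> describes (2,2)-poles and \<open>pole_22 1\<close> describes (2,2;1)-poles.\<close>

definition pole_22 :: "nat \<Rightarrow> ('v, 'd) pole \<Rightarrow> bool" where
  "pole_22 r M \<longleftrightarrow>
     multipole M \<and> cubic M \<and>
     semiedges M = inp M \<union> out M \<union> res M \<and>
     inp M \<inter> out M = {} \<and> inp M \<inter> res M = {} \<and> out M \<inter> res M = {} \<and>
     card (inp M) = 2 \<and> card (out M) = 2 \<and> card (res M) = r"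

text \<open>
  The path \<open>uv\<close> is given by the end \<open>a\<close> at \<open>u\<close> of its edge, so that
  \<open>mate G a\<close> is the end at \<open>v\<close>. The remaining ends at \<open>u\<close> and
  \<open>v\<close> become free.
\<close>

definition is_path1 :: "('v, 'd, 'z) multipole_scheme \<Rightarrow> 'd \<Rightarrow> bool" where
  "is_path1 G a \<longleftrightarrow> a \<in> ends G \<and> inc G a \<noteq> inc G (mate G a)"

definition remove_path1 :: "('v, 'd) multipole \<Rightarrow> 'd \<Rightarrow> ('v, 'd) pole" where
  "remove_path1 G a =
     (let u = the (inc G a); v = the (inc G (mate G a)) in
      \<lparr>verts = verts G - {u, v},
       ends = ends G - {a, mate G a},
       mate = mate G,
       inc = (\<lambda>d. if inc G d \<in> {Some u, Some v} then None else inc G d),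
       inp = ends_at G u - {a},
       out = ends_at G v - {mate G a},
       res = {}\<rparr>)"

text \<open>
  The path \<open>uwv\<close> is given by the end \<open>a\<close> at \<open>u\<close> of the edge
  \<open>uw\<close> and the end \<open>b\<close> at \<open>w\<close> of the edge \<open>wv\<close>.
\<close>

definition is_path2 :: "('v, 'd, 'z) multipole_scheme \<Rightarrow> 'd \<Rightarrow> 'd \<Rightarrow> bool" where
  "is_path2 G a b \<longleftrightarrow>
     a \<in> ends G \<and> b \<in> ends G \<and> inc G (mate G a) = inc G b \<and>
     distinct [inc G a, inc G b, inc G (mate G b)]"

definition remove_path2 :: "('v, 'd) multipole \<Rightarrow> 'd \<Rightarrow> 'd \<Rightarrow> ('v, 'd) pole" where
  "remove_path2 G a b =
     (let u = the (inc G a); w = the (inc G b); v = the (inc G (mate G b)) in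
      \<lparr>verts = verts G - {u, w, v},
       ends = ends G - {a, mate G a, b, mate G b},
       mate = mate G,
       inc = (\<lambda>d. if inc G d \<in> {Some u, Some w, Some v} then None else inc G d),
       inp = ends_at G u - {a},
       out = ends_at G v - {mate G b},
       res = ends_at G w - {mate G a, b}\<rparr>)"

definition bipartite_pole :: "('v, 'd) pole \<Rightarrow> bool" where
  "bipartite_pole B \<longleftrightarrow>
     (\<exists>G a b. cubic_graph G \<and> bipartite G \<and> is_path2 G a b \<and> B = remove_path2 G a b)"

definition join ::
  "('v, 'd) pole \<Rightarrow> ('w, 'e) pole \<Rightarrow> ('d \<times> 'e) list \<Rightarrow> ('v + 'w, 'd + 'e) pole" where
  "join M N ps =
     (let K = junctions (map (map_prod Inl Inr) ps) (disjoint_sum M N) in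
      \<lparr>verts = verts K, ends = ends K, mate = mate K, inc = inc K,
       inp = Inl ` inp M, out = Inr ` out N, res = res M <+> res N\<rparr>)"


section \<open>Decollineators\<close>

definition F2_basis :: "(4 \<Rightarrow> bit ^ 4) \<Rightarrow> bool" where
  "F2_basis p \<longleftrightarrow> inj p \<and> vec.independent (range p) \<and> vec.span (range p) = UNIV"

definition tetra_points :: "(4 \<Rightarrow> bit ^ 4) \<Rightarrow> (bit ^ 4) set" where
  "tetra_points p = range p \<union> {p i + p j | i j. i \<noteq> j}"

definition tetra_lines :: "(4 \<Rightarrow> bit ^ 4) \<Rightarrow> (bit ^ 4) set set" where
  "tetra_lines p = {{p i, p i + p j, p j} | i j. i \<noteq> j}"

text \<open>
  The three points of a line are distinct, so at a trivalent vertex the image below is a line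
  exactly if the three values, counted with multiplicity, form that line.
\<close>

definition T_flow ::
  "(4 \<Rightarrow> bit ^ 4) \<Rightarrow> ('v, 'd, 'z) multipole_scheme \<Rightarrow> ('d set \<Rightarrow> bit ^ 4) \<Rightarrow> bool" where
  "T_flow p M f \<longleftrightarrow>
     f ` edges M \<subseteq> tetra_points p \<and>
     (\<forall>x\<in>verts M. (\<lambda>d. f (edge_with_end M d)) ` ends_at M x \<in> tetra_lines p)"

definition collinear_values ::
  "(4 \<Rightarrow> bit ^ 4) \<Rightarrow> ('v, 'd, 'z) multipole_scheme \<Rightarrow> ('d set \<Rightarrow> bit ^ 4) \<Rightarrow> 'd set \<Rightarrow> bool" where
  "collinear_values p M f P \<longleftrightarrow>
     (\<exists>s t. P = {s, t} \<and> f (edge_with_end M s) \<noteq> f (edge_with_end M t) \<and>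
        (\<exists>l\<in>tetra_lines p. {f (edge_with_end M s), f (edge_with_end M t)} \<subseteq> l))"

definition decollineator :: "('v, 'd) pole \<Rightarrow> bool" where
  "decollineator D \<longleftrightarrow>
     pole_22 0 D \<and>
     (\<forall>p. F2_basis p \<longrightarrow>
        \<not> (\<exists>f. T_flow p D f \<and> collinear_values p D f (inp D) \<and> collinear_values p D f (out D)))"


section \<open>Cubic Halin graphs\<close>

definition tree :: "('v, 'd, 'z) multipole_scheme \<Rightarrow> bool" where
  "tree S \<longleftrightarrow>
     graph S \<and> verts S \<noteq> {} \<and>
     (\<forall>x\<in>verts S. \<forall>y\<in>verts S. (adjacent S)\<^sup>*\<^sup>* x y) \<and>
     \<not> (\<exists>ds. circuit S ds)"

definition leaves :: "('v, 'd, 'z) multipole_scheme \<Rightarrow> 'v set" where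
  "leaves S = {x \<in> verts S. valency S x = 1}"

text \<open>
  A drawing in the plane: vertices are points, and the edge with ends \<open>d\<close> and
  \<open>mate M d\<close> is the curve \<open>\<gamma> d\<close>, traversed from the first end to the second.
\<close>

definition plane_embedding ::
  "('v, 'd, 'z) multipole_scheme \<Rightarrow> ('v \<Rightarrow> complex) \<Rightarrow> ('d \<Rightarrow> real \<Rightarrow> complex) \<Rightarrow> bool" where
  "plane_embedding M pos \<gamma> \<longleftrightarrow>
     inj_on pos (verts M) \<and>
     (\<forall>d\<in>ends M. simple_path (\<gamma> d) \<and> \<gamma> (mate M d) = reversepath (\<gamma> d) \<and>
        Some (pathstart (\<gamma> d)) = map_option pos (inc M d)) \<and>
     (\<forall>d\<in>ends M. \<forall>x\<in>verts M.
        pos x \<in> path_image (\<gamma> d) \<longrightarrow> Some x \<in> inc M ` edge_with_end M d) \<and>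
     (\<forall>d\<in>ends M. \<forall>e\<in>ends M. edge_with_end M d \<noteq> edge_with_end M e \<longrightarrow>
        path_image (\<gamma> d) \<inter> path_image (\<gamma> e) \<subseteq> pos ` verts M)"

definition drawing ::
  "('v, 'd, 'z) multipole_scheme \<Rightarrow> ('v \<Rightarrow> complex) \<Rightarrow> ('d \<Rightarrow> real \<Rightarrow> complex) \<Rightarrow> complex set" where
  "drawing M pos \<gamma> = pos ` verts M \<union> (\<Union>d\<in>ends M. path_image (\<gamma> d))"

text \<open>
  The graph \<open>C \<union> S\<close>, where \<open>C\<close> is the circuit through
  \<open>v 0, \<dots>, v (k - 1)\<close>. The ends of its edge from \<open>v i\<close> to the next vertex are
  \<open>Inr (i, False)\<close> and \<open>Inr (i, True)\<close>.
\<close>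

definition halin_graph ::
  "('v, 'd, 'z) multipole_scheme \<Rightarrow> nat \<Rightarrow> (nat \<Rightarrow> 'v) \<Rightarrow> ('v, 'd + nat \<times> bool) multipole" where
  "halin_graph S k v =
     \<lparr>verts = verts S,
      ends = ends S <+> ({..<k} \<times> UNIV),
      mate = map_sum (mate S) (\<lambda>(i, b). (i, \<not> b)),
      inc = case_sum (inc S) (\<lambda>(i, b). Some (v (if b then Suc i mod k else i)))\<rparr>"

text \<open>
  The condition \<open>3 \<le> k\<close> belongs to \<open>C\<close> being a circuit of a simple graph; it is
  automatic, since a tree with a vertex of degree 3 has at least three leaves.
\<close>

definition cubic_halin ::
  "('v, 'd, 'z) multipole_scheme \<Rightarrow> nat \<Rightarrow> (nat \<Rightarrow> 'v) \<Rightarrow> bool" where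
  "cubic_halin S k v \<longleftrightarrow>
     tree S \<and>
     (\<forall>x\<in>verts S - leaves S. valency S x = 3) \<and> verts S - leaves S \<noteq> {} \<and>
     3 \<le> k \<and> bij_betw v {..<k} (leaves S) \<and>
     (\<exists>pos \<gamma>. plane_embedding (halin_graph S k v) pos \<gamma> \<and>
        frontier (outside (drawing (halin_graph S k v) pos \<gamma>)) =
          (\<Union>i<k. path_image (\<gamma> (Inr (i, False)))))"


section \<open>Halin snarks\<close>

definition delete_vertices ::
  "('v, 'd, 'z) multipole_scheme \<Rightarrow> 'v set \<Rightarrow> ('v, 'd, 'z) multipole_scheme" where
  "delete_vertices M U =
     M\<lparr>verts := verts M - U, ends := {d \<in> ends M. inc M ` edge_with_end M d \<inter> Some ` U = {}}\<rparr>"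

definition tree_neighbour :: "('v, 'd, 'z) multipole_scheme \<Rightarrow> 'v \<Rightarrow> 'v" where
  "tree_neighbour S x = (THE y. adjacent S x y)"

text \<open>
  The multipole consisting of the fragments \<open>F 0, \<dots>, F (k - 1)\<close> and the tree without its
  leaves, in which the residual semiedge of \<open>F i\<close> has been attached to the neighbour of
  \<open>v i\<close>.
\<close>

definition attach_fragments ::
  "('s, 't) multipole \<Rightarrow> nat \<Rightarrow> (nat \<Rightarrow> 's) \<Rightarrow> (nat \<Rightarrow> ('v, 'd) pole) \<Rightarrow>
   (nat \<times> 'v + 's, nat \<times> 'd + 't) multipole" where
  "attach_fragments S k v F =
     (let M = disjoint_sum (disjoint_family_sum k F) (delete_vertices S (v ` {..<k})) in
      M\<lparr>inc := (\<lambda>d. case d of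
           Inl (i, s) \<Rightarrow> if s \<in> res (F i) then Some (Inr (tree_neighbour S (v i))) else inc M d
         | Inr t \<Rightarrow> inc M d)\<rparr>)"

definition connect_fragments ::
  "('s, 't) multipole \<Rightarrow> nat \<Rightarrow> (nat \<Rightarrow> 's) \<Rightarrow> (nat \<Rightarrow> ('v, 'd) pole) \<Rightarrow>
   (nat \<Rightarrow> ('d \<times> 'd) list) \<Rightarrow> (nat \<times> 'v + 's, nat \<times> 'd + 't) multipole" where
  "connect_fragments S k v F qs =
     junctions
       (concat (map (\<lambda>i. map (\<lambda>(s, t). (Inl (i, s), Inl (Suc i mod k, t))) (qs i)) [0..<k]))
       (attach_fragments S k v F)"

text \<open>
  \<open>H\<close> is a Halin snark obtained from the Halin graph given by \<open>S\<close>,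
  \<open>k\<close>, \<open>v\<close> and from the Halin fragments \<open>D i \<circ> B i\<close>. The lists
  \<open>ps i\<close> and \<open>qs i\<close> record the choices made in the joins within and between the
  fragments.
\<close>

definition halin_snark ::
  "('s, 't) multipole \<Rightarrow> nat \<Rightarrow> (nat \<Rightarrow> 's) \<Rightarrow>
   (nat \<Rightarrow> ('a, 'd) pole) \<Rightarrow> (nat \<Rightarrow> ('b, 'e) pole) \<Rightarrow>
   (nat \<times> ('a + 'b) + 's, nat \<times> ('d + 'e) + 't) multipole \<Rightarrow> bool" where
  "halin_snark S k v D B H \<longleftrightarrow>
     cubic_halin S k v \<and>
     (\<forall>i<k. decollineator (D i) \<and> bipartite_pole (B i)) \<and>
     (\<exists>ps qs. let F = (\<lambda>i. join (D i) (B i) (ps i)) in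
        (\<forall>i<k. pairing (out (D i)) (inp (B i)) (ps i) \<and>
               pairing (out (F i)) (inp (F (Suc i mod k))) (qs i)) \<and>
        H = connect_fragments S k v F qs)"

end

theory Submission
  imports Defs
begin

text \<open>
  Write \<open>e(X, Y)\<close> for the number of ends at \<open>X\<close> whose mates are at \<open>Y\<close>. A cubic graph with vertex set
  \<open>V\<close> is cyclically 4-edge-connected of girth at least 5 if and only if \<open>e(X, V - X) \<ge> 4\<close> whenever
  \<open>X\<close> and \<open>V - X\<close> have at least two vertices and \<open>e(X, X) \<le> 2 |X| - 2\<close> whenever
  \<open>1 \<le> |X| \<le> 4\<close>, because a set \<open>X\<close> with \<open>e(X, X) \<ge> 2 |X| - 1\<close> contains a circuit.

  Applied to the graphs from which the poles arise, these inequalities show that a vertex of a pole is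
  incident with at most one edge leaving the pole, and that a nonempty proper subset of its vertices is
  left by at least two edges inside the pole. In \<open>H\<close> the \<open>2 k\<close> poles form a ring in which neighbours are
  joined by two edges. Going around the ring in both directions, one sees that a cut \<open>X\<close> of at most three
  edges leaves all poles but one entirely on the same side; so up to complement \<open>X\<close> consists of
  vertices of one pole and of the tree, and counting gives \<open>e(X, V - X) \<ge> 4\<close>. A circuit with at most
  four vertices cannot stay in one pole or in the tree, and it leaves every pole that it meets at two
  different vertices. Hence it meets exactly two poles, in two adjacent vertices each, and these
  form a triangle with a removed vertex in the graph from which the pole arises.
\<close>


section \<open>Links and circuits\<close>

text \<open>\<open>robust\<close> speaks of vertex sets only, so no edge deletion and no component
  of \<open>H\<close> is examined before the final translation back. What has to be known about
  \<open>H\<close> is how many links run between vertex sets, and inside a pole these numbers are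
  those of the pole. The bound 2 |X| - 2 is that of a forest, an inner edge being counted twice; the
  tree obeys it for all sizes, the graphs of origin for up to four vertices. The number two governs
  the ring. A removed path R has exactly |R| - 1 inner edges, so |R| + 2 \<le> 5 edges join it to
  the rest W. If W falls into two sides with at least two vertices each, then 4 + 4 \<le> 2 e + 5
  for the number e of edges between them, hence e \<ge> 2. Neighbouring poles are joined by two
  edges as well. A cut of at most three edges can thus pay only once, be it for splitting a pole or
  for a change of side between neighbours. The residual edge of a pole is single, which is why the
  tree escapes this argument and is handled by the forest bound.\<close>

text \<open>Edges inside \<open>A \<inter> B\<close> have both their ends in \<open>links M A B\<close> and are counted twice in \<open>nlinks M A B\<close>.\<close>

definition links :: "('v, 'd, 'z) multipole_scheme \<Rightarrow> 'v set \<Rightarrow> 'v set \<Rightarrow> 'd set" where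
  "links M A B = {d \<in> ends M. inc M d \<in> Some ` A \<and> inc M (mate M d) \<in> Some ` B}"

definition nlinks :: "('v, 'd, 'z) multipole_scheme \<Rightarrow> 'v set \<Rightarrow> 'v set \<Rightarrow> nat" where
  "nlinks M A B = card (links M A B)"

lemma multipoleD:
  assumes "multipole M"
  shows "finite (verts M)" "finite (ends M)"
    "d \<in> ends M \<Longrightarrow> mate M d \<in> ends M" "d \<in> ends M \<Longrightarrow> mate M d \<noteq> d"
    "d \<in> ends M \<Longrightarrow> mate M (mate M d) = d"
    "d \<in> ends M \<Longrightarrow> inc M d = Some x \<Longrightarrow> x \<in> verts M"
  using assms by (auto simp: multipole_def)

lemma inj_on_mate: "multipole M \<Longrightarrow> inj_on (mate M) (ends M)"
  by (rule inj_on_inverseI[where g = "mate M"]) (rule multipoleD(5))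

lemma graph_inc:
  assumes "graph M" "d \<in> ends M"
  obtains x where "inc M d = Some x" "x \<in> verts M"
  using assms by (cases "inc M d") (auto simp: graph_def semiedges_def multipole_def)

lemma finite_links: "multipole M \<Longrightarrow> finite (links M A B)"
  by (simp add: links_def multipole_def)

lemma nlinks_mono:
  assumes "multipole M" "A \<subseteq> A'" "B \<subseteq> B'"
  shows "nlinks M A B \<le> nlinks M A' B'"
  unfolding nlinks_def
  by (rule card_mono[OF finite_links[OF assms(1)]]) (use assms in \<open>auto simp: links_def\<close>)

lemma nlinks_empty [simp]: "nlinks M {} B = 0" "nlinks M A {} = 0"
  by (auto simp: nlinks_def links_def)

lemma nlinks_Un_left:
  assumes "multipole M" "A \<inter> A' = {}"
  shows "nlinks M (A \<union> A') B = nlinks M A B + nlinks M A' B"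
proof -
  have "links M (A \<union> A') B = links M A B \<union> links M A' B" by (auto simp: links_def)
  moreover have "links M A B \<inter> links M A' B = {}" using assms(2) by (auto simp: links_def)
  ultimately show ?thesis
    unfolding nlinks_def using finite_links[OF assms(1)] by (simp add: card_Un_disjoint)
qed

lemma nlinks_Un_right:
  assumes "multipole M" "B \<inter> B' = {}"
  shows "nlinks M A (B \<union> B') = nlinks M A B + nlinks M A B'"
proof -
  have "links M A (B \<union> B') = links M A B \<union> links M A B'" by (auto simp: links_def)
  moreover have "links M A B \<inter> links M A B' = {}" using assms(2) by (auto simp: links_def)
  ultimately show ?thesis
    unfolding nlinks_def using finite_links[OF assms(1)] by (simp add: card_Un_disjoint)
qed

lemma nlinks_sym:
  assumes "multipole M"
  shows "nlinks M A B = nlinks M B A"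
proof -
  have "bij_betw (mate M) (links M A B) (links M B A)"
    by (rule bij_betw_byWitness[where f' = "mate M"]) (auto simp: links_def multipoleD[OF assms])
  thus ?thesis unfolding nlinks_def by (rule bij_betw_same_card)
qed

lemma nlinks_Un_diag:
  assumes "multipole M" "A \<inter> B = {}"
  shows "nlinks M (A \<union> B) (A \<union> B) = nlinks M A A + 2 * nlinks M A B + nlinks M B B"
  using nlinks_sym[OF assms(1), of B A]
  by (simp add: nlinks_Un_left[OF assms] nlinks_Un_right[OF assms])

lemma nlinks_verts:
  assumes "cubic_graph M" "X \<subseteq> verts M"
  shows "nlinks M X (verts M) = 3 * card X"
proof -
  have g: "graph M" and m: "multipole M" and c: "cubic M"
    using assms(1) by (auto simp: cubic_graph_def graph_def)
  have fX: "finite X" using assms(2) multipoleD(1)[OF m] finite_subset by blast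
  have "links M X (verts M) = (\<Union>x\<in>X. ends_at M x)"
  proof (intro equalityI subsetI)
    fix d assume "d \<in> (\<Union>x\<in>X. ends_at M x)"
    then obtain x where x: "x \<in> X" "d \<in> ends M" "inc M d = Some x" by (auto simp: ends_at_def)
    obtain y where "inc M (mate M d) = Some y" "y \<in> verts M"
      using graph_inc[OF g multipoleD(3)[OF m x(2)]] by blast
    thus "d \<in> links M X (verts M)" using x by (auto simp: links_def)
  qed (auto simp: links_def ends_at_def)
  moreover have "card (\<Union>x\<in>X. ends_at M x) = (\<Sum>x\<in>X. card (ends_at M x))"
    by (rule card_UN_disjoint[OF fX]) (auto simp: ends_at_def multipoleD(2)[OF m])
  moreover have "(\<Sum>x\<in>X. card (ends_at M x)) = (\<Sum>x\<in>X. 3)"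
    by (rule sum.cong) (use c assms(2) in \<open>auto simp: cubic_def valency_def\<close>)
  ultimately show ?thesis by (simp add: nlinks_def)
qed

text \<open>The exchange rate used throughout: in a cubic graph an upper bound on inner links is the
  same as a lower bound on the cut.\<close>

lemma nlinks_cut:
  assumes "cubic_graph M" "X \<subseteq> verts M"
  shows "nlinks M X X + nlinks M X (verts M - X) = 3 * card X"
proof -
  have m: "multipole M" using assms(1) by (auto simp: cubic_graph_def graph_def)
  have "nlinks M X (X \<union> (verts M - X)) = nlinks M X X + nlinks M X (verts M - X)"
    by (rule nlinks_Un_right[OF m]) auto
  moreover have "X \<union> (verts M - X) = verts M" using assms(2) by auto
  ultimately show ?thesis using nlinks_verts[OF assms] by simp
qed

text \<open>Both ends of a loop are counted, so a single vertex cannot have exactly one inner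
  link.\<close>

lemma nlinks_loop:
  assumes "multipole M" "nlinks M {x} {x} \<ge> 1"
  shows "nlinks M {x} {x} \<ge> 2"
proof -
  obtain d where d: "d \<in> links M {x} {x}"
    using assms(2) unfolding nlinks_def by (metis One_nat_def Suc_le_eq card_gt_0_iff ex_in_conv)
  hence "{d, mate M d} \<subseteq> links M {x} {x}" "mate M d \<noteq> d"
    by (auto simp: links_def multipoleD[OF assms(1)])
  hence "card {d, mate M d} \<le> nlinks M {x} {x}"
    unfolding nlinks_def by (intro card_mono finite_links assms(1))
  with \<open>mate M d \<noteq> d\<close> show ?thesis by auto
qed

section \<open>Sets of minimum degree two, dense sets and circuits\<close>

text \<open>A walk that never turns back: on reaching a vertex of \<open>Y\<close> there is a second
  end to leave by. By finiteness some vertex recurs, and the stretch up to the first recurrence is a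
  circuit.\<close>

lemma thick_imp_circuit:
  assumes M: "multipole M" and Y: "finite Y" "Y \<noteq> {}"
    and thick: "\<And>x. x \<in> Y \<Longrightarrow> nlinks M {x} Y \<ge> 2"
  obtains ds where "circuit M ds" "inc M ` set ds \<subseteq> Some ` Y"
proof -
  let ?L = "links M Y Y"
  have nxt: "\<exists>e. e \<in> ?L \<and> inc M e = inc M (mate M d) \<and> e \<noteq> mate M d" if d: "d \<in> ?L" for d
  proof -
    obtain y where y: "y \<in> Y" "inc M (mate M d) = Some y" using d by (auto simp: links_def)
    have "card (links M {y} Y) \<ge> 2" using thick[OF y(1)] by (simp add: nlinks_def)
    hence "\<not> links M {y} Y \<subseteq> {mate M d}"
      using card_mono[of "{mate M d}" "links M {y} Y"] by auto
    then obtain e where "e \<in> links M {y} Y" "e \<noteq> mate M d" by auto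
    thus ?thesis using y by (intro exI[of _ e]) (auto simp: links_def)
  qed
  obtain y0 where y0: "y0 \<in> Y" using Y by auto
  have "links M {y0} Y \<noteq> {}" using thick[OF y0] by (auto simp: nlinks_def)
  then obtain d0 where d0: "d0 \<in> ?L" using y0 by (auto simp: links_def)
  obtain g where g: "\<And>d. d \<in> ?L \<Longrightarrow> g d \<in> ?L \<and> inc M (g d) = inc M (mate M d) \<and> g d \<noteq> mate M d"
    using nxt by metis
  define f where "f n = (g ^^ n) d0" for n
  have f: "f n \<in> ?L" for n
    by (induction n) (use d0 g in \<open>auto simp: f_def\<close>)
  have fS: "inc M (f (Suc n)) = inc M (mate M (f n)) \<and> f (Suc n) \<noteq> mate M (f n)" for n
    using g[OF f[of n]] by (simp add: f_def)
  let ?x = "\<lambda>n. inc M (f n)"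
  have fin: "?x ` UNIV \<subseteq> Some ` Y" using f by (auto simp: links_def)
  have ends: "f n \<in> ends M" for n using f[of n] by (simp add: links_def)
  have "\<not> inj ?x" using finite_subset[OF fin] Y(1) finite_imageD infinite_UNIV_nat by blast
  hence ex: "\<exists>j. \<exists>i<j. ?x i = ?x j"
    unfolding inj_def by (metis linorder_neqE_nat)
  \<comment> \<open>The earliest repetition: minimality makes the vertices at positions
    \<open>i\<close> to \<open>j - 1\<close> pairwise distinct, and the vertex at \<open>j\<close>
    closes the circuit at \<open>i\<close>.\<close>
  define j where "j = (LEAST j. \<exists>i<j. ?x i = ?x j)"
  have "\<exists>i<j. ?x i = ?x j" unfolding j_def by (rule LeastI_ex[OF ex])
  then obtain i where i: "i < j" "?x i = ?x j" by auto
  have least: "?x s \<noteq> ?x t" if "s < t" "t < j" for s t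
    using not_less_Least[of t "\<lambda>j. \<exists>i<j. ?x i = ?x j"] that unfolding j_def by blast
  have inj: "s = t" if "?x s = ?x t" "s < j" "t < j" for s t
    using least[of s t] least[of t s] that by (metis linorder_neqE_nat)
  define ds where "ds = map f [i..<j]"
  have len: "length ds = j - i" by (simp add: ds_def)
  have set: "set ds = f ` {i..<j}" by (simp add: ds_def)
  have step: "inc M (mate M (f t)) = ?x (Suc t)" for t using fS[of t] by simp
  have "circuit M ds"
    unfolding circuit_def
  proof (intro conjI allI impI ballI)
    show "ds \<noteq> []" using i by (simp add: ds_def)
    show "set ds \<subseteq> ends M" using ends by (auto simp: set)
    show "None \<notin> inc M ` set ds" using fin by (auto simp: set)
    show "distinct (map (inc M) ds)"
      unfolding ds_def map_map by (auto simp: distinct_map inj_on_def intro: inj)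
  next
    fix t assume t: "t < length ds"
    show "inc M (mate M (ds ! t)) = inc M (ds ! (Suc t mod length ds))"
    proof (cases "Suc t = length ds")
      case True
      hence "Suc (i + t) = j" using len i by simp
      thus ?thesis using True t i len step[of "i + t"] by (auto simp: ds_def)
    next
      case False
      thus ?thesis using t len step[of "i + t"] by (auto simp: ds_def)
    qed
  next
    fix d assume "d \<in> set ds"
    then obtain s where s: "d = f s" "i \<le> s" "s < j" by (auto simp: set)
    show "mate M d \<notin> set ds"
    proof
      assume "mate M d \<in> set ds"
      then obtain t where t: "mate M (f s) = f t" "i \<le> t" "t < j" using s by (auto simp: set)
      have st: "mate M (f t) = f s" using t(1) multipoleD(5)[OF M ends[of s]] by metis
      \<comment> \<open>If the edge left at \<open>s\<close> were used backwards at
        \<open>t\<close>, both successors would repeat a vertex of the stretch. Distinctness then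
        allows only \<open>Suc s = j\<close> and \<open>Suc t = j\<close>, hence
        \<open>s = t\<close>, and an end would be its own mate.\<close>
      have 1: "?x (Suc s) = ?x t" "?x (Suc t) = ?x s" using step[of s] step[of t] t st by auto
      have ts: "t \<noteq> Suc s" "s \<noteq> Suc t" "s \<noteq> t"
        using fS[of s] fS[of t] t st multipoleD(4)[OF M ends[of s]] by auto
      have "Suc s = j" using inj[of "Suc s" t] 1 ts t s by force
      moreover have "Suc t = j" using inj[of "Suc t" s] 1 ts t s by force
      ultimately show False using ts by simp
    qed
  qed
  moreover have "inc M ` set ds \<subseteq> Some ` Y" using fin by (auto simp: set)
  ultimately show ?thesis using that by blast
qed

text \<open>A minimal nonempty dense subset is thick: deleting a vertex with at most one inner link
  lowers the count by at most two, while \<open>2 * card Z\<close> drops by two, so a smaller dense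
  set would remain.\<close>

lemma dense_imp_thick:
  assumes M: "multipole M" and Y: "finite Y" "Y \<noteq> {}" "nlinks M Y Y + 1 \<ge> 2 * card Y"
  obtains Z where "Z \<subseteq> Y" "Z \<noteq> {}" "\<forall>x\<in>Z. nlinks M {x} Z \<ge> 2"
proof -
  define P where "P = {Z. Z \<subseteq> Y \<and> Z \<noteq> {} \<and> nlinks M Z Z + 1 \<ge> 2 * card Z}"
  have "finite P" unfolding P_def by (rule finite_subset[of _ "Pow Y"]) (use Y(1) in auto)
  moreover have "Y \<in> P" using Y by (simp add: P_def)
  ultimately obtain Z where ZP: "Z \<in> P" and min: "\<forall>W\<in>P. W \<subseteq> Z \<longrightarrow> Z = W"
    using finite_has_minimal2[of P Y] by blast
  hence Z: "Z \<subseteq> Y" "Z \<noteq> {}" "nlinks M Z Z + 1 \<ge> 2 * card Z" by (auto simp: P_def)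
  have fZ: "finite Z" using Z Y(1) finite_subset by blast
  have "nlinks M {x} Z \<ge> 2" if x: "x \<in> Z" for x
  proof (rule ccontr)
    assume less: "\<not> nlinks M {x} Z \<ge> 2"
    have eq: "{x} \<union> (Z - {x}) = Z" using x by auto
    have loop: "nlinks M {x} {x} = 0"
      using nlinks_loop[OF M, of x] nlinks_mono[OF M, of "{x}" "{x}" "{x}" Z] x less by force
    have "nlinks M Z Z = nlinks M {x} {x} + 2 * nlinks M {x} (Z - {x}) + nlinks M (Z - {x}) (Z - {x})"
      using nlinks_Un_diag[OF M, of "{x}" "Z - {x}"] eq by simp
    moreover have "nlinks M {x} (Z - {x}) \<le> 1"
      using nlinks_mono[OF M, of "{x}" "{x}" "Z - {x}" Z] less by force
    moreover have cZ: "card Z = Suc (card (Z - {x}))" using card.remove[OF fZ x] by simp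
    ultimately have 1: "nlinks M (Z - {x}) (Z - {x}) + 1 \<ge> 2 * card (Z - {x})"
      using Z loop by linarith
    \<comment> \<open>This depends on the slack in the density being 1: a lone vertex without loop
      has no inner link, and 0 + 1 < 2.\<close>
    have "Z - {x} \<noteq> {}"
    proof
      assume "Z - {x} = {}"
      hence "Z = {x}" using x by auto
      thus False using Z loop by simp
    qed
    hence "Z - {x} \<in> P" using 1 Z(1) by (auto simp: P_def)
    hence "Z = Z - {x}" using min by blast
    thus False using x by blast
  qed
  thus ?thesis using that[of Z] Z(1,2) by blast
qed

lemma dense_imp_circuit:
  assumes M: "multipole M" and Y: "finite Y" "Y \<noteq> {}" "nlinks M Y Y + 1 \<ge> 2 * card Y"
  obtains ds where "circuit M ds" "inc M ` set ds \<subseteq> Some ` Y"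
proof -
  obtain Z where Z: "Z \<subseteq> Y" "Z \<noteq> {}" and thick: "\<forall>x\<in>Z. nlinks M {x} Z \<ge> 2"
    using dense_imp_thick[OF assms] .
  obtain ds where "circuit M ds" "inc M ` set ds \<subseteq> Some ` Z"
    using thick_imp_circuit[OF M finite_subset[OF Z(1) Y(1)] Z(2)] thick by blast
  thus ?thesis using that[of ds] Z(1) by blast
qed

text \<open>\<open>ds\<close> lists one end of each edge of the circuit; the mates supply the other
  ends, and they are new because no edge is used twice. So \<open>2 * length ds\<close> ends are
  inner links of the vertex set.\<close>

lemma circuit_imp_dense:
  assumes M: "multipole M" and c: "circuit M ds"
  obtains Y where "inc M ` set ds = Some ` Y" "card Y = length ds" "finite Y" "Y \<noteq> {}"
    "nlinks M Y Y \<ge> 2 * card Y"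
proof -
  define Y where "Y = (the \<circ> inc M) ` set ds"
  have nN: "None \<notin> inc M ` set ds" and ne: "ds \<noteq> []" and di: "distinct (map (inc M) ds)"
    and sub: "set ds \<subseteq> ends M"
    and nxt: "\<And>i. i < length ds \<Longrightarrow> inc M (mate M (ds ! i)) = inc M (ds ! (Suc i mod length ds))"
    and nm: "\<And>d. d \<in> set ds \<Longrightarrow> mate M d \<notin> set ds"
    using c unfolding circuit_def by auto
  have im: "inc M ` set ds = Some ` Y"
    unfolding Y_def image_comp using nN by (intro image_cong) (auto simp: image_iff)
  have "card (inc M ` set ds) = length ds"
    using distinct_card[OF di] by simp
  hence card: "card Y = length ds" by (simp add: im card_image)
  have mY: "inc M (mate M d) \<in> Some ` Y" if d: "d \<in> set ds" for d
  proof -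
    obtain i where i: "i < length ds" "d = ds ! i" using d by (auto simp: in_set_conv_nth)
    have "Suc i mod length ds < length ds" using ne by (cases ds) auto
    hence "inc M (ds ! (Suc i mod length ds)) \<in> inc M ` set ds" by simp
    thus ?thesis using nxt[OF i(1)] i(2) im by simp
  qed
  have "set ds \<union> mate M ` set ds \<subseteq> links M Y Y"
  proof (intro subsetI)
    fix e assume e: "e \<in> set ds \<union> mate M ` set ds"
    then obtain d where d: "d \<in> set ds" "e = d \<or> e = mate M d" by auto
    have "inc M d \<in> Some ` Y" using d(1) im by blast
    thus "e \<in> links M Y Y" using d mY[OF d(1)] sub multipoleD(3,5)[OF M, of d]
      by (auto simp: links_def)
  qed
  hence "card (set ds \<union> mate M ` set ds) \<le> nlinks M Y Y"
    unfolding nlinks_def by (intro card_mono finite_links M)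
  moreover have "card (set ds \<union> mate M ` set ds) = card (set ds) + card (mate M ` set ds)"
    by (rule card_Un_disjoint) (use nm in auto)
  moreover have "card (mate M ` set ds) = card (set ds)"
    by (rule card_image[OF inj_on_subset[OF inj_on_mate[OF M] sub]])
  moreover have "card (set ds) = length ds"
    using di by (simp add: distinct_card distinct_map)
  ultimately have "nlinks M Y Y \<ge> 2 * card Y" using card by simp
  thus ?thesis using that[OF im card] ne Y_def by auto
qed


section \<open>Cuts and circuits in cubic graphs\<close>

text \<open>Additions replace differences since subtraction of naturals truncates. In the second
  clause one vertex excludes loops, two exclude parallel edges and three exclude triangles; the
  first and last of these reappear in \<open>W_split_single\<close> and
  \<open>no_triangle\<close>.\<close>

definition robust :: "('v, 'd, 'z) multipole_scheme \<Rightarrow> bool" where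
  "robust M \<longleftrightarrow>
     (\<forall>X\<subseteq>verts M. 2 \<le> card X \<and> 2 \<le> card (verts M - X) \<longrightarrow> 4 \<le> nlinks M X (verts M - X)) \<and>
     (\<forall>X\<subseteq>verts M. X \<noteq> {} \<and> card X \<le> 4 \<longrightarrow> nlinks M X X + 2 \<le> 2 * card X)"

lemma robust_cut:
  "robust M \<Longrightarrow> X \<subseteq> verts M \<Longrightarrow> 2 \<le> card X \<Longrightarrow> 2 \<le> card (verts M - X) \<Longrightarrow>
     4 \<le> nlinks M X (verts M - X)"
  by (simp add: robust_def)

lemma robust_small:
  "robust M \<Longrightarrow> X \<subseteq> verts M \<Longrightarrow> X \<noteq> {} \<Longrightarrow> card X \<le> 4 \<Longrightarrow> nlinks M X X + 2 \<le> 2 * card X"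
  by (simp add: robust_def)

lemma girth_ge_iff: "girth M \<ge> enat n \<longleftrightarrow> (\<forall>ds. circuit M ds \<longrightarrow> n \<le> length ds)"
  by (auto simp: girth_def le_INF_iff)

text \<open>Successive vertices of a circuit are adjacent, so the whole circuit is reachable from
  its first vertex. That \<open>x\<close> lies on the circuit lets the component later be located on
  one side of a cut.\<close>

lemma contains_circuit_component:
  assumes c: "circuit M ds" and sub: "inc M ` set ds \<subseteq> Some ` verts M"
  obtains x where "x \<in> verts M" "Some x \<in> inc M ` set ds" "contains_circuit M (component_of M x)"
proof -
  have ne: "ds \<noteq> []" and E: "set ds \<subseteq> ends M"
    and nxt: "\<And>i. i < length ds \<Longrightarrow> inc M (mate M (ds ! i)) = inc M (ds ! (Suc i mod length ds))"
    using c unfolding circuit_def by auto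
  have v: "\<exists>y\<in>verts M. inc M (ds ! i) = Some y" if "i < length ds" for i
  proof -
    have "inc M (ds ! i) \<in> inc M ` set ds" using that by simp
    thus ?thesis using sub by auto
  qed
  obtain x where x: "x \<in> verts M" "inc M (ds ! 0) = Some x" using v[of 0] ne by auto
  have reach: "\<exists>y\<in>component_of M x. inc M (ds ! i) = Some y" if "i < length ds" for i
    using that
  proof (induction i)
    case 0
    thus ?case using x by (auto simp: component_of_def)
  next
    case (Suc i)
    then obtain y where y: "y \<in> component_of M x" "inc M (ds ! i) = Some y" by auto
    obtain z where z: "z \<in> verts M" "inc M (ds ! Suc i) = Some z" using v[OF Suc.prems] by auto
    have "inc M (mate M (ds ! i)) = Some z" using nxt[of i] Suc.prems z(2) by simp
    moreover have "ds ! i \<in> ends M" using E Suc.prems by auto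
    ultimately have "adjacent M y z" using y(2) by (auto simp: adjacent_def)
    hence "(adjacent M)\<^sup>*\<^sup>* x z" using y(1) by (auto simp: component_of_def)
    thus ?case using z by (auto simp: component_of_def)
  qed
  have "inc M ` set ds \<subseteq> Some ` component_of M x"
  proof
    fix t assume "t \<in> inc M ` set ds"
    then obtain i where "i < length ds" "t = inc M (ds ! i)" by (auto simp: in_set_conv_nth)
    thus "t \<in> Some ` component_of M x" using reach[of i] by auto
  qed
  hence "contains_circuit M (component_of M x)" using c by (auto simp: contains_circuit_def)
  moreover have "Some x \<in> inc M ` set ds" using x(2) ne by (metis image_eqI length_greater_0_conv nth_mem)
  ultimately show ?thesis using that x(1) by blast
qed

lemma delete_edges_simps [simp]:
  "verts (delete_edges M E) = verts M" "ends (delete_edges M E) = ends M - \<Union>E"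
  "mate (delete_edges M E) = mate M" "inc (delete_edges M E) = inc M"
  by (simp_all add: delete_edges_def)

lemma circuit_inner_delete:
  assumes c: "circuit M ds" and sub: "inc M ` set ds \<subseteq> Some ` X"
    and E: "\<Union>E \<inter> links M X X = {}"
  shows "circuit (delete_edges M E) ds"
proof -
  have "set ds \<subseteq> links M X X"
  proof
    fix d assume d: "d \<in> set ds"
    then obtain i where i: "i < length ds" "d = ds ! i" by (auto simp: in_set_conv_nth)
    have "Suc i mod length ds < length ds" using i by (cases ds) auto
    hence "inc M (ds ! (Suc i mod length ds)) \<in> inc M ` set ds" by simp
    moreover have "inc M (mate M d) = inc M (ds ! (Suc i mod length ds))" "d \<in> ends M"
      using c i d unfolding circuit_def by auto
    ultimately show "d \<in> links M X X" using sub d by (auto simp: links_def)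
  qed
  hence "set ds \<inter> \<Union>E = {}" using E by blast
  thus ?thesis using c unfolding circuit_def by auto
qed

lemma component_subset:
  assumes "x \<in> X" "\<And>y z. y \<in> X \<Longrightarrow> adjacent M y z \<Longrightarrow> z \<in> X"
  shows "component_of M x \<subseteq> X"
proof
  fix y assume "y \<in> component_of M x"
  hence "(adjacent M)\<^sup>*\<^sup>* x y" by (simp add: component_of_def)
  thus "y \<in> X" by (induction) (use assms in auto)
qed

text \<open>Were \<open>X\<close> to violate the first clause, \<open>X\<close> and its complement
  would both be dense and carry circuits, and deleting the at most three edges between them would
  leave these circuits in different components. A set violating the second clause carries a circuit
  of length at most 4.\<close>

lemma robust_if:
  assumes c4: "cyclically_4_edge_connected M" and g: "girth M \<ge> 5"
  shows "robust M"
proof -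
  have cg: "cubic_graph M" using c4 by (simp add: cyclically_4_edge_connected_def)
  hence G: "graph M" and M: "multipole M" by (auto simp: cubic_graph_def graph_def)
  have fV: "finite (verts M)" using multipoleD(1)[OF M] .
  have g5: "5 \<le> length ds" if "circuit M ds" for ds
    using g girth_ge_iff[of 5 M] that by (simp add: numeral_eq_enat)
  have small: "nlinks M X X + 2 \<le> 2 * card X" if X: "X \<subseteq> verts M" "X \<noteq> {}" "card X \<le> 4" for X
  proof (rule ccontr)
    assume "\<not> ?thesis"
    hence d: "nlinks M X X + 1 \<ge> 2 * card X" by simp
    have fX: "finite X" using X fV finite_subset by blast
    from dense_imp_circuit[OF M fX X(2) d] obtain ds
      where ds: "circuit M ds" "inc M ` set ds \<subseteq> Some ` X" .
    have "length ds = card (set (map (inc M) ds))"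
      using ds(1) by (metis circuit_def distinct_card length_map)
    also have "\<dots> \<le> card (Some ` X)" by (rule card_mono) (use ds fX in auto)
    also have "\<dots> \<le> card X" by (simp add: card_image_le fX)
    finally show False using g5[OF ds(1)] X by simp
  qed
  have "4 \<le> nlinks M X (verts M - X)"
    if X: "X \<subseteq> verts M" "2 \<le> card X" "2 \<le> card (verts M - X)" for X
  proof (rule ccontr)
    let ?X' = "verts M - X"
    assume less: "\<not> ?thesis"
    \<comment> \<open>At most three links leave \<open>Z\<close>, so at least 3 |Z| - 3 stay inside,
      which is at least 2 |Z| - 1 because |Z| is at least 2.\<close>
    have dense: "nlinks M Z Z + 1 \<ge> 2 * card Z"
      if "Z \<subseteq> verts M" "2 \<le> card Z" "nlinks M Z (verts M - Z) \<le> 3" for Z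
    proof (cases "card Z \<le> 2")
      case True
      moreover have "Z \<noteq> {}" using that(2) by auto
      ultimately have "nlinks M Z Z + 2 \<le> 2 * card Z" using small[OF that(1)] by simp
      thus ?thesis using nlinks_cut[OF cg that(1)] that True by simp
    next
      case False
      thus ?thesis using nlinks_cut[OF cg that(1)] that by simp
    qed
    have XX: "verts M - ?X' = X" using X by auto
    have d1: "nlinks M X X + 1 \<ge> 2 * card X" using dense[of X] X less by simp
    have d2: "nlinks M ?X' ?X' + 1 \<ge> 2 * card ?X'"
      using dense[of ?X'] X less nlinks_sym[OF M, of X ?X'] XX by simp
    have fX: "finite X" "finite ?X'" using X fV finite_subset by blast+
    have ne: "X \<noteq> {}" "?X' \<noteq> {}" using X by auto
    define E where "E = edge_with_end M ` links M X ?X'"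
    have "E \<subseteq> edges M" by (auto simp: E_def edges_def links_def)
    moreover have "card E \<le> nlinks M X ?X'"
      unfolding E_def nlinks_def by (rule card_image_le) (rule finite_links[OF M])
    ultimately have E: "E \<subseteq> edges M" "card E < 4" using less by auto
    let ?M = "delete_edges M E"
    \<comment> \<open>Deleting an edge removes both its ends, so the links across the cut disappear
      in both directions; hence neither side can be left by an adjacency in
      \<open>?M\<close>.\<close>
    have uE: "\<Union>E = links M X ?X' \<union> links M ?X' X"
    proof (intro equalityI subsetI)
      fix d assume d: "d \<in> links M X ?X' \<union> links M ?X' X"
      have "d \<in> ends M" using d by (auto simp: links_def)
      hence "d = mate M (mate M d)" using multipoleD(5)[OF M] by simp
      moreover have "d \<in> links M ?X' X \<Longrightarrow> mate M d \<in> links M X ?X'"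
        using multipoleD(3,5)[OF M] by (auto simp: links_def)
      ultimately show "d \<in> \<Union>E" using d by (auto simp: E_def edge_with_end_def)
    qed (auto simp: E_def edge_with_end_def links_def multipoleD(3,5)[OF M])
    have disj: "\<Union>E \<inter> links M X X = {}" "\<Union>E \<inter> links M ?X' ?X' = {}"
      unfolding uE by (auto simp: links_def)
    have adj1: "z \<in> X" if "y \<in> X" "adjacent ?M y z" for y z
    proof -
      have "z \<in> verts M" using that(2) multipoleD(3,6)[OF M] by (fastforce simp: adjacent_def)
      thus ?thesis using that X unfolding adjacent_def delete_edges_simps uE
        by (fastforce simp: links_def)
    qed
    have adj2: "z \<in> ?X'" if "y \<in> ?X'" "adjacent ?M y z" for y z
    proof -
      have "z \<in> verts M" using that(2) multipoleD(3,6)[OF M] by (fastforce simp: adjacent_def)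
      thus ?thesis using that X unfolding adjacent_def delete_edges_simps uE
        by (fastforce simp: links_def)
    qed
    from dense_imp_circuit[OF M fX(1) ne(1) d1] obtain ds1
      where ds1: "circuit M ds1" "inc M ` set ds1 \<subseteq> Some ` X" .
    from dense_imp_circuit[OF M fX(2) ne(2) d2] obtain ds2
      where ds2: "circuit M ds2" "inc M ` set ds2 \<subseteq> Some ` ?X'" .
    have "inc ?M ` set ds1 \<subseteq> Some ` verts ?M" using ds1(2) X(1) by auto
    from contains_circuit_component[OF circuit_inner_delete[OF ds1 disj(1)] this]
    obtain x1 where x1: "x1 \<in> verts ?M" "Some x1 \<in> inc ?M ` set ds1"
      "contains_circuit ?M (component_of ?M x1)" .
    have "inc ?M ` set ds2 \<subseteq> Some ` verts ?M" using ds2(2) by auto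
    from contains_circuit_component[OF circuit_inner_delete[OF ds2 disj(2)] this]
    obtain x2 where x2: "x2 \<in> verts ?M" "Some x2 \<in> inc ?M ` set ds2"
      "contains_circuit ?M (component_of ?M x2)" .
    have x1X: "x1 \<in> X" and x2X: "x2 \<in> ?X'" using x1(2) x2(2) ds1(2) ds2(2) by auto
    have "component_of ?M x1 \<subseteq> X" by (rule component_subset[OF x1X]) (rule adj1)
    moreover have "component_of ?M x2 \<subseteq> ?X'" by (rule component_subset[OF x2X]) (rule adj2)
    moreover have "x1 \<in> component_of ?M x1" using x1(1) by (simp add: component_of_def)
    ultimately have "component_of ?M x1 \<noteq> component_of ?M x2" by blast
    moreover have "component_of ?M x1 \<in> graph_components ?M" "component_of ?M x2 \<in> graph_components ?M"
      using x1(1) x2(1) by (auto simp: graph_components_def)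
    ultimately show False
      using c4 E x1(3) x2(3) unfolding cyclically_4_edge_connected_def by blast
  qed
  thus ?thesis using small by (auto simp: robust_def)
qed

lemma symp_adjacent: "multipole M \<Longrightarrow> adjacent M x y \<Longrightarrow> adjacent M y x"
  unfolding adjacent_def by (metis multipoleD(3,5))

lemma multipole_delete_edges:
  assumes M: "multipole M" and E: "E \<subseteq> edges M"
  shows "multipole (delete_edges M E)"
proof -
  have "mate M d \<notin> \<Union>E" if d: "d \<in> ends M" "d \<notin> \<Union>E" for d
  proof
    assume "mate M d \<in> \<Union>E"
    then obtain A where A: "A \<in> E" "mate M d \<in> A" by auto
    then obtain e where e: "e \<in> ends M" "A = {e, mate M e}"
      using E by (auto simp: edges_def edge_with_end_def)
    have "d \<in> A" using A e d multipoleD(5)[OF M] by (metis insert_iff singletonD)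
    thus False using A d by blast
  qed
  thus ?thesis using M unfolding multipole_def by auto
qed

lemma component_disjoint:
  assumes M: "multipole M" and "component_of M x \<noteq> component_of M y"
  shows "component_of M x \<inter> component_of M y = {}"
proof (rule ccontr)
  assume "\<not> ?thesis"
  then obtain z where z: "(adjacent M)\<^sup>*\<^sup>* x z" "(adjacent M)\<^sup>*\<^sup>* y z" by (auto simp: component_of_def)
  have sym: "symp (adjacent M)\<^sup>*\<^sup>*"
    by (rule symp_rtranclp) (auto intro!: sympI symp_adjacent[OF M])
  have "(adjacent M)\<^sup>*\<^sup>* x y" "(adjacent M)\<^sup>*\<^sup>* y x"
    using z sym by (meson rtranclp_trans sympD)+
  hence "component_of M x = component_of M y" unfolding component_of_def by (auto intro: rtranclp_trans)
  thus False using assms by simp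
qed

text \<open>A circuit of length at most 4 would have a vertex set with too many inner links.
  Circuits in two components therefore give each component at least five vertices, the cut bound
  applies to one of them, and the four links leaving it belong to four distinct deleted
  edges.\<close>

lemma robust_imp:
  assumes cg: "cubic_graph M" and R: "robust M"
  shows "cyclically_4_edge_connected M" "girth M \<ge> 5"
proof -
  have G: "graph M" and M: "multipole M" using cg by (auto simp: cubic_graph_def graph_def)
  have fV: "finite (verts M)" using multipoleD(1)[OF M] .
  have long: "5 \<le> length ds" if c: "circuit M ds" for ds
  proof -
    obtain Y where Y: "inc M ` set ds = Some ` Y" "card Y = length ds" "finite Y" "Y \<noteq> {}"
      "nlinks M Y Y \<ge> 2 * card Y" using circuit_imp_dense[OF M c] .
    have "Y \<subseteq> verts M"
    proof
      fix y assume "y \<in> Y"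
      hence "Some y \<in> inc M ` set ds" using Y by blast
      thus "y \<in> verts M" using c multipoleD(6)[OF M] unfolding circuit_def by (metis imageE subsetD)
    qed
    thus ?thesis using robust_small[OF R, of Y] Y by linarith
  qed
  thus "girth M \<ge> 5" using girth_ge_iff[of 5 M] by (simp add: numeral_eq_enat)
  have "False" if E: "E \<subseteq> edges M" "card E < 4" and K: "K \<in> graph_components (delete_edges M E)"
    and L: "L \<in> graph_components (delete_edges M E)" and KL: "K \<noteq> L"
    and cK: "contains_circuit (delete_edges M E) K" and cL: "contains_circuit (delete_edges M E) L"
  for E K L
  proof -
    let ?M = "delete_edges M E"
    have M': "multipole ?M" by (rule multipole_delete_edges[OF M E(1)])
    obtain x y where x: "x \<in> verts M" "K = component_of ?M x" and y: "L = component_of ?M y"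
      using K L by (auto simp: graph_components_def)
    have KV: "K \<subseteq> verts M" and LV: "L \<subseteq> verts M" using x y by (auto simp: component_of_def)
    have KL': "K \<inter> L = {}" using component_disjoint[OF M'] KL x y by blast
    have big: "5 \<le> card Z" if "contains_circuit ?M Z" "Z \<subseteq> verts M" for Z
    proof -
      obtain ds where ds: "circuit ?M ds" "inc M ` set ds \<subseteq> Some ` Z"
        using \<open>contains_circuit ?M Z\<close> by (auto simp: contains_circuit_def)
      have c: "circuit M ds" using ds(1) unfolding circuit_def by auto
      have "length ds = card (inc M ` set ds)"
        using c by (metis circuit_def distinct_card length_map set_map)
      also have "\<dots> \<le> card (Some ` Z)"
        by (rule card_mono) (use ds finite_subset[OF \<open>Z \<subseteq> verts M\<close> fV] in auto)
      also have "\<dots> = card Z" by (simp add: card_image)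
      finally show ?thesis using long[OF c] by simp
    qed
    have "5 \<le> card K" by (rule big[OF cK KV])
    moreover have "5 \<le> card L" by (rule big[OF cL LV])
    moreover have "card L \<le> card (verts M - K)" by (rule card_mono) (use fV KL' LV in auto)
    ultimately have 4: "4 \<le> nlinks M K (verts M - K)" using robust_cut[OF R KV] by simp
    \<comment> \<open>An undeleted edge leaving \<open>K\<close> would enlarge the
      component.\<close>
    have "edge_with_end M ` links M K (verts M - K) \<subseteq> E"
    proof
      fix A assume "A \<in> edge_with_end M ` links M K (verts M - K)"
      then obtain d where d: "d \<in> links M K (verts M - K)" "A = {d, mate M d}"
        by (auto simp: edge_with_end_def)
      then obtain p q where pq: "p \<in> K" "q \<in> verts M" "q \<notin> K" "inc M d = Some p" "inc M (mate M d) = Some q" "d \<in> ends M"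
        by (auto simp: links_def)
      have "d \<in> \<Union>E"
      proof (rule ccontr)
        assume "d \<notin> \<Union>E"
        hence "adjacent ?M p q" using pq by (auto simp: adjacent_def)
        moreover have "(adjacent ?M)\<^sup>*\<^sup>* x p" using pq x by (auto simp: component_of_def)
        ultimately have "q \<in> K" using pq(2) x by (auto simp: component_of_def)
        thus False using pq by simp
      qed
      then obtain e where "e \<in> ends M" "{e, mate M e} \<in> E" "d \<in> {e, mate M e}"
        using E(1) by (auto simp: edges_def edge_with_end_def)
      thus "A \<in> E" using d(2) multipoleD(5)[OF M] by (auto simp: insert_commute)
    qed
    \<comment> \<open>The other end of such an edge is at a vertex outside \<open>K\<close>, so an
      edge contains at most one of these links.\<close>
    moreover have "inj_on (edge_with_end M) (links M K (verts M - K))"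
      by (rule inj_onI) (auto simp: edge_with_end_def links_def doubleton_eq_iff)
    moreover have "finite E"
      using E(1) multipoleD(2)[OF M] by (auto simp: edges_def intro: finite_subset)
    ultimately have "nlinks M K (verts M - K) \<le> card E"
      unfolding nlinks_def by (metis card_inj_on_le)
    thus False using 4 E by simp
  qed
  thus "cyclically_4_edge_connected M" unfolding cyclically_4_edge_connected_def using cg by blast
qed


section \<open>Rings of pieces\<close>

text \<open>
  The sets \<open>V j\<close> stand for the vertex sets of the poles \<open>D 0\<close>, \<open>B 0\<close>, \<open>D 1\<close>, \<open>B 1\<close>, \<open>\<dots>\<close>
  and \<open>T\<close> for the vertices of the tree that are not leaves.
\<close>

locale piece_ring =
  fixes H :: "('v, 'd, 'z) multipole_scheme" and n :: nat and V :: "nat \<Rightarrow> 'v set" and T :: "'v set"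
  assumes cubic: "cubic_graph H" and n3: "3 \<le> n"
    and verts_eq: "verts H = (\<Union>j<n. V j) \<union> T"
    and disj: "\<And>i j. i < n \<Longrightarrow> j < n \<Longrightarrow> i \<noteq> j \<Longrightarrow> V i \<inter> V j = {}"
    and disjT: "\<And>j. j < n \<Longrightarrow> V j \<inter> T = {}"
    and ring: "\<And>j. j < n \<Longrightarrow> 2 \<le> nlinks H (V j) (V (Suc j mod n))"
    and split: "\<And>j Y. j < n \<Longrightarrow> Y \<subseteq> V j \<Longrightarrow> Y \<noteq> {} \<Longrightarrow> Y \<noteq> V j \<Longrightarrow> 2 \<le> nlinks H Y (V j - Y)"
    and cut: "\<And>j Y. j < n \<Longrightarrow> Y \<subseteq> V j \<Longrightarrow> 2 \<le> card Y \<Longrightarrow> nlinks H Y Y + 4 \<le> 3 * card Y"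
    and small: "\<And>j Y. j < n \<Longrightarrow> Y \<subseteq> V j \<Longrightarrow> Y \<noteq> {} \<Longrightarrow> card Y \<le> 4 \<Longrightarrow>
      nlinks H Y Y + 2 \<le> 2 * card Y"
    and deg: "\<And>j x. j < n \<Longrightarrow> x \<in> V j \<Longrightarrow> 2 \<le> nlinks H {x} (V j)"
    and port: "\<And>j l x y. j < n \<Longrightarrow> l < n \<Longrightarrow> j \<noteq> l \<Longrightarrow> x \<in> V j \<Longrightarrow> y \<in> V j \<Longrightarrow> x \<noteq> y \<Longrightarrow>
      1 \<le> nlinks H {x} (V l) \<Longrightarrow> 1 \<le> nlinks H {y} (V l) \<Longrightarrow> nlinks H {x} {y} = 0"
    and tree: "\<And>Y. Y \<subseteq> T \<Longrightarrow> Y \<noteq> {} \<Longrightarrow> nlinks H Y Y + 2 \<le> 2 * card Y"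
    and residual: "\<And>j. j < n \<Longrightarrow> nlinks H (V j) T \<le> 1"
begin

lemma mult: "multipole H"
  using cubic by (auto simp: cubic_graph_def graph_def)

lemma fin: "X \<subseteq> verts H \<Longrightarrow> finite X"
  using multipoleD(1)[OF mult] finite_subset by blast

lemma V_sub: "j < n \<Longrightarrow> V j \<subseteq> verts H"
  using verts_eq by auto

section \<open>Cuts of the ring\<close>

text \<open>Write Y and Z for the parts in the pole and in the tree. At most one edge joins them, so
  the cut has at least (3 |Y| - e(Y, Y)) + (3 |Z| - e(Z, Z)) - 2 edges. A nonempty Z gives at least
  |Z| + 2 and a nonempty Y at least 3, which makes 4. For empty Y nothing is subtracted and |Z|
  \<ge> 2 suffices; for empty Z the assumption \<open>cut\<close> is the claim.\<close>

lemma local_cut: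
  assumes m: "m < n" and X: "X \<subseteq> verts H" "2 \<le> card X"
    and away: "\<And>l. l < n \<Longrightarrow> l \<noteq> m \<Longrightarrow> X \<inter> V l = {}"
  shows "4 \<le> nlinks H X (verts H - X)"
proof -
  define Y where "Y = X \<inter> V m"
  define Z where "Z = X \<inter> T"
  have YZ: "Y \<inter> Z = {}" using disjT[OF m] by (auto simp: Y_def Z_def)
  have XYZ: "X = Y \<union> Z" using X(1) away verts_eq by (auto simp: Y_def Z_def)
  have Ym: "Y \<subseteq> V m" and ZT: "Z \<subseteq> T" by (auto simp: Y_def Z_def)
  have fY: "finite Y" and fZ: "finite Z" using fin[OF X(1)] by (auto simp: Y_def Z_def)
  have cX: "card X = card Y + card Z" unfolding XYZ by (rule card_Un_disjoint[OF fY fZ YZ])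
  have iX: "nlinks H X X = nlinks H Y Y + 2 * nlinks H Y Z + nlinks H Z Z"
    unfolding XYZ by (rule nlinks_Un_diag[OF mult YZ])
  have YZ1: "nlinks H Y Z \<le> 1"
    using nlinks_mono[OF mult Ym ZT] residual[OF m] by simp
  have cutX: "nlinks H X X + nlinks H X (verts H - X) = 3 * card X"
    by (rule nlinks_cut[OF cubic X(1)])
  show ?thesis
  proof (cases "Z = {}")
    case True
    hence "X = Y" using XYZ by simp
    thus ?thesis using cut[OF m Ym] X(2) cutX by simp
  next
    case Z: False
    hence "nlinks H Z Z + 2 \<le> 2 * card Z" "0 < card Z" using tree[OF ZT] fZ by auto
    moreover have "nlinks H Y Y + 3 \<le> 3 * card Y \<or> card Y = 0"
    proof (cases "card Y \<le> 1")
      case True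
      show ?thesis
      proof (cases "Y = {}")
        case False
        hence "card Y = 1" using True fY by (metis card_0_eq le_SucE le_zero_eq One_nat_def)
        thus ?thesis using small[OF m Ym False] by simp
      qed simp
    next
      case False
      thus ?thesis using cut[OF m Ym] by simp
    qed
    moreover have "nlinks H Y Y = 0 \<and> nlinks H Y Z = 0" if "card Y = 0" using that fY by simp
    ultimately show ?thesis using cX iX YZ1 cutX X(2) by linarith
  qed
qed

text \<open>
  Call \<open>(a, b)\<close> active if at least two edges of the cut lead from \<open>X \<inter> V a\<close> to \<open>V b - X\<close>.
  Different pairs use different edges of the cut, so at most one pair is active. Without an active pair
  at \<open>l\<close> the piece \<open>V l\<close> lies on one side, and consecutive pieces on different sides yield an
  active pair; hence, with \<open>m\<close> one of the indices of the active pair, all other pieces lie on the same side.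
\<close>

lemma cut_localises:
  assumes X: "X \<subseteq> verts H" and less: "nlinks H X (verts H - X) < 4"
  obtains m where "m < n"
    "(\<forall>l<n. l \<noteq> m \<longrightarrow> X \<inter> V l = {}) \<or> (\<forall>l<n. l \<noteq> m \<longrightarrow> V l \<subseteq> X)"
proof -
  define act where "act a b \<longleftrightarrow> a < n \<and> b < n \<and> 2 \<le> nlinks H (X \<inter> V a) (V b - X)" for a b
  have uniq: "a = c \<and> b = d" if "act a b" "act c d" for a b c d
  proof (rule ccontr)
    assume ne: "\<not> ?thesis"
    let ?A = "links H (X \<inter> V a) (V b - X)" and ?B = "links H (X \<inter> V c) (V d - X)"
    have lt: "a < n" "b < n" "c < n" "d < n" using that by (auto simp: act_def)
    \<comment> \<open>If the first indices differ, the starting points of the links are disjoint; if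
      the second differ, the end points are. Two active pairs therefore cost four links.\<close>
    have "(X \<inter> V a) \<inter> (X \<inter> V c) = {} \<or> (V b - X) \<inter> (V d - X) = {}"
      using ne disj[OF lt(1,3)] disj[OF lt(2,4)] by blast
    hence "?A \<inter> ?B = {}" by (auto simp: links_def)
    hence "card ?A + card ?B = card (?A \<union> ?B)"
      using finite_links[OF mult] by (simp add: card_Un_disjoint)
    also have "\<dots> \<le> nlinks H X (verts H - X)"
      unfolding nlinks_def
      by (rule card_mono[OF finite_links[OF mult]]) (use V_sub lt in \<open>auto simp: links_def\<close>)
    finally show False using that less by (simp add: act_def nlinks_def)
  qed
  obtain m where m: "m < n" and m_act: "\<And>a b. act a b \<Longrightarrow> a = m \<or> b = m"
  proof (cases "\<exists>a b. act a b")
    case True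
    then obtain a b where ab: "act a b" by blast
    show ?thesis
    proof (rule that)
      show "a < n" using ab by (simp add: act_def)
    qed (use uniq[OF ab] in blast)
  next
    case False
    \<comment> \<open>Without an active pair any index serves as \<open>m\<close>.\<close>
    thus ?thesis using that[of 0] n3 by auto
  qed
  have pure: "X \<inter> V l = {} \<or> V l \<subseteq> X" if l: "l < n" "l \<noteq> m" for l
  proof (rule ccontr)
    assume "\<not> ?thesis"
    hence "2 \<le> nlinks H (X \<inter> V l) (V l - X \<inter> V l)" by (intro split[OF l(1)]) auto
    moreover have "V l - X \<inter> V l = V l - X" by auto
    ultimately have "act l l" using l by (simp add: act_def)
    thus False using m_act l by blast
  qed
  have link: "2 \<le> nlinks H (V j) (V (Suc j mod n))" "2 \<le> nlinks H (V (Suc j mod n)) (V j)"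
    if "j < n" for j
    using ring[OF that] nlinks_sym[OF mult, of "V j"] by auto
  have step: "(X \<inter> V j = {} \<longleftrightarrow> X \<inter> V (Suc j mod n) = {}) \<and> (V j \<subseteq> X \<longleftrightarrow> V (Suc j mod n) \<subseteq> X)"
    if j: "j < n" "j \<noteq> m" "Suc j mod n \<noteq> m" for j
  proof -
    let ?j = "Suc j mod n"
    have j': "?j < n" using n3 by simp
    have no: "\<not> act j ?j" "\<not> act ?j j" using m_act j by blast+
    have eqs: "X \<inter> V i = V i" if "V i \<subseteq> X" for i using that by auto
    have eqd: "V i - X = V i" if "X \<inter> V i = {}" for i using that by auto
    have ne: "V j \<noteq> {}" "V ?j \<noteq> {}" using link[OF j(1)] by auto
    have 1: "\<not> (V j \<subseteq> X \<and> X \<inter> V ?j = {})"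
      using no(1) link(1)[OF j(1)] j(1) j' by (auto simp: act_def eqs eqd)
    have 2: "\<not> (V ?j \<subseteq> X \<and> X \<inter> V j = {})"
      using no(2) link(2)[OF j(1)] j(1) j' by (auto simp: act_def eqs eqd)
    show ?thesis using 1 2 pure[OF j(1,2)] pure[OF j' j(3)] ne by blast
  qed
  \<comment> \<open>One tour of the ring from the successor of \<open>m\<close>: its first n - 1
    stations are exactly the other indices, so the comparison of neighbours by \<open>step\<close>
    never has to cross \<open>m\<close>.\<close>
  define p where "p t = (m + 1 + t) mod n" for t
  have p_lt: "p t < n" for t using n3 by (simp add: p_def)
  have p_ne: "p t \<noteq> m" if "t < n - 1" for t
  proof (cases "m + 1 + t < n")
    case False
    hence "p t = m + 1 + t - n" using that m by (simp add: p_def mod_if)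
    thus ?thesis using that False by simp
  qed (simp add: p_def)
  have p_Suc: "Suc (p t) mod n = p (Suc t)" for t by (simp add: p_def mod_Suc_eq)
  have p_surj: "\<exists>t < n - 1. p t = l" if l: "l < n" "l \<noteq> m" for l
  proof (cases "m < l")
    case True
    thus ?thesis using l by (intro exI[of _ "l - m - 1"]) (auto simp: p_def)
  next
    case False
    have "(m + 1 + (n + l - m - 1)) mod n = (n + l) mod n" using False m by simp
    also have "\<dots> = l" using l by simp
    finally show ?thesis using False l m
      by (intro exI[of _ "n + l - m - 1"]) (simp add: p_def)
  qed
  have all: "(X \<inter> V (p 0) = {} \<longleftrightarrow> X \<inter> V (p t) = {}) \<and> (V (p 0) \<subseteq> X \<longleftrightarrow> V (p t) \<subseteq> X)"
    if "t < n - 1" for t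
    using that
  proof (induction t)
    case (Suc t)
    thus ?case using step[OF p_lt[of t]] p_ne[of t] p_ne[of "Suc t"] p_Suc[of t] by simp
  qed simp
  have "X \<inter> V (p 0) = {} \<or> V (p 0) \<subseteq> X" using pure[OF p_lt p_ne[of 0]] n3 by simp
  thus ?thesis
  proof
    assume "X \<inter> V (p 0) = {}"
    hence "\<forall>l<n. l \<noteq> m \<longrightarrow> X \<inter> V l = {}" using all p_surj by metis
    thus ?thesis using that[OF m] by blast
  next
    assume "V (p 0) \<subseteq> X"
    hence "\<forall>l<n. l \<noteq> m \<longrightarrow> V l \<subseteq> X" using all p_surj by metis
    thus ?thesis using that[OF m] by blast
  qed
qed

text \<open>The second alternative of \<open>cut_localises\<close> is the first one for the
  complement, whose cut has the same size.\<close>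

lemma cut_ge_4:
  assumes X: "X \<subseteq> verts H" "2 \<le> card X" "2 \<le> card (verts H - X)"
  shows "4 \<le> nlinks H X (verts H - X)"
proof (rule ccontr)
  assume "\<not> ?thesis"
  hence less: "nlinks H X (verts H - X) < 4" by simp
  obtain m where m: "m < n"
    "(\<forall>l<n. l \<noteq> m \<longrightarrow> X \<inter> V l = {}) \<or> (\<forall>l<n. l \<noteq> m \<longrightarrow> V l \<subseteq> X)"
    using cut_localises[OF X(1) less] .
  from m(2) show False
  proof
    assume "\<forall>l<n. l \<noteq> m \<longrightarrow> X \<inter> V l = {}"
    thus False using local_cut[OF m(1) X(1,2)] less by simp
  next
    assume "\<forall>l<n. l \<noteq> m \<longrightarrow> V l \<subseteq> X"
    hence "4 \<le> nlinks H (verts H - X) (verts H - (verts H - X))"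
      by (intro local_cut[OF m(1) _ X(3)]) auto
    moreover have "verts H - (verts H - X) = X" using X(1) by auto
    ultimately show False using less nlinks_sym[OF mult, of X] by simp
  qed
qed

text \<open>Counting degrees inside the thick set \<open>Z\<close> replaces following a circuit:
  every vertex of \<open>Z\<close> has two links in \<open>Z\<close>, so a part \<open>A\<close>
  with at most 2 |A| - 2 inner links sends at least two links to the rest of \<open>Z\<close>. A
  vertex of a piece has at most one link to the outside, which forces two vertices in each piece
  met.\<close>

lemma small_sparse:
  assumes X: "X \<subseteq> verts H" "X \<noteq> {}" "card X \<le> 4"
  shows "nlinks H X X + 2 \<le> 2 * card X"
proof (rule ccontr)
  assume "\<not> ?thesis"
  hence d: "nlinks H X X + 1 \<ge> 2 * card X" by simp
  obtain Z where Z: "Z \<subseteq> X" "Z \<noteq> {}" and thick: "\<forall>x\<in>Z. 2 \<le> nlinks H {x} Z"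
    using dense_imp_thick[OF mult fin[OF X(1)] X(2) d] .
  have ZV: "Z \<subseteq> verts H" using Z X by blast
  have fZ: "finite Z" by (rule fin[OF ZV])
  have cZ: "card Z \<le> 4" using card_mono[OF fin[OF X(1)] Z(1)] X(3) by simp
  have sum: "2 * card A \<le> nlinks H A Z" if "A \<subseteq> Z" for A
  proof -
    have "finite A" using that fZ finite_subset by blast
    thus ?thesis using that
    proof (induction A)
      case (insert x A)
      have "nlinks H ({x} \<union> A) Z = nlinks H {x} Z + nlinks H A Z"
        by (rule nlinks_Un_left[OF mult]) (use insert in auto)
      moreover have "2 \<le> nlinks H {x} Z" using thick insert.prems by auto
      ultimately show ?case using insert by simp
    qed simp
  qed
  have leave: "2 \<le> nlinks H A (Z - A)" if "A \<subseteq> Z" "nlinks H A A + 2 \<le> 2 * card A" for A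
  proof -
    have "nlinks H A (A \<union> (Z - A)) = nlinks H A A + nlinks H A (Z - A)"
      by (rule nlinks_Un_right[OF mult]) auto
    moreover have "A \<union> (Z - A) = Z" using that by auto
    ultimately show ?thesis using sum[OF that(1)] that(2) by simp
  qed
  have cVle: "card (Z \<inter> A) \<le> 4" for A using card_mono[OF fZ, of "Z \<inter> A"] cZ by simp
  have leaveV: "2 \<le> nlinks H (Z \<inter> V j) (Z - Z \<inter> V j)" if "j < n" "Z \<inter> V j \<noteq> {}" for j
    using leave[of "Z \<inter> V j"] small[OF that(1), of "Z \<inter> V j"] that cVle by auto
  have single: "nlinks H {x} (Z - V j) \<le> 1" if "j < n" "x \<in> V j" for j x
  proof -
    have "nlinks H {x} (V j \<union> (Z - V j)) = nlinks H {x} (V j) + nlinks H {x} (Z - V j)"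
      by (rule nlinks_Un_right[OF mult]) auto
    moreover have "nlinks H {x} (V j \<union> (Z - V j)) \<le> nlinks H {x} (verts H)"
      by (rule nlinks_mono[OF mult]) (use ZV V_sub[OF that(1)] in auto)
    moreover have "nlinks H {x} (verts H) = 3"
      using nlinks_verts[OF cubic, of "{x}"] V_sub[OF that(1)] that(2) by auto
    ultimately show ?thesis using deg[OF that] by simp
  qed
  have ZVj: "Z - Z \<inter> V j = Z - V j" for j by auto
  have two: "2 \<le> card (Z \<inter> V j)" if j: "j < n" "Z \<inter> V j \<noteq> {}" for j
  proof (rule ccontr)
    assume "\<not> ?thesis"
    moreover have "0 < card (Z \<inter> V j)" using j(2) fZ by (simp add: card_gt_0_iff)
    ultimately have "card (Z \<inter> V j) = 1" by simp
    then obtain x where x: "Z \<inter> V j = {x}" using card_1_singletonE by blast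
    hence "x \<in> V j" by auto
    thus False using leaveV[OF j] single[OF j(1)] x ZVj[of j] by fastforce
  qed
  have pair: "Z = (Z \<inter> V j) \<union> (Z \<inter> V l) \<and> card (Z \<inter> V j) = 2"
    if j: "j < n" "Z \<inter> V j \<noteq> {}" and l: "l < n" "Z \<inter> V l \<noteq> {}" and jl: "j \<noteq> l" for j l
  proof -
    let ?U = "(Z \<inter> V j) \<union> (Z \<inter> V l)"
    have c: "card ?U = card (Z \<inter> V j) + card (Z \<inter> V l)"
      by (rule card_Un_disjoint) (use fZ disj[OF j(1) l(1) jl] in auto)
    have U: "?U \<subseteq> Z" by auto
    hence "card ?U \<le> card Z" by (rule card_mono[OF fZ])
    moreover have "2 \<le> card (Z \<inter> V j)" "2 \<le> card (Z \<inter> V l)" using two j l by auto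
    ultimately have "card ?U = card Z" "card (Z \<inter> V j) = 2" using c cZ by linarith+
    thus ?thesis using card_subset_eq[OF fZ U] by auto
  qed
  have other: "\<exists>l<n. l \<noteq> j \<and> Z \<inter> V l \<noteq> {}" if noT: "Z \<inter> T = {}" and j: "j < n" "Z \<inter> V j \<noteq> {}" for j
  proof -
    have "Z - Z \<inter> V j \<noteq> {}"
    proof
      assume "Z - Z \<inter> V j = {}"
      thus False using leaveV[OF j] by (simp only: nlinks_empty)
    qed
    then obtain x where "x \<in> Z" "x \<notin> V j" by auto
    thus ?thesis using noT ZV verts_eq by blast
  qed
  \<comment> \<open>Two links leave the tree part, but a single piece offers only its residual edge.
    So two pieces would be met, and by \<open>pair\<close> these already exhaust
    \<open>Z\<close>.\<close>
  have T: "Z \<inter> T = {}"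
  proof (rule ccontr)
    assume ne: "Z \<inter> T \<noteq> {}"
    have 2: "2 \<le> nlinks H (Z \<inter> T) (Z - Z \<inter> T)"
      by (rule leave) (use tree[of "Z \<inter> T"] ne in auto)
    have "Z - Z \<inter> T \<noteq> {}"
    proof
      assume "Z - Z \<inter> T = {}"
      thus False using 2 by (simp only: nlinks_empty)
    qed
    then obtain x where x: "x \<in> Z" "x \<notin> T" by auto
    then obtain j where j: "j < n" "x \<in> V j" using ZV verts_eq by auto
    have "\<not> Z - Z \<inter> T \<subseteq> V j"
    proof
      assume "Z - Z \<inter> T \<subseteq> V j"
      hence "nlinks H (Z \<inter> T) (Z - Z \<inter> T) \<le> nlinks H T (V j)"
        by (intro nlinks_mono[OF mult]) auto
      thus False using 2 residual[OF j(1)] nlinks_sym[OF mult, of T] by simp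
    qed
    then obtain y where y: "y \<in> Z" "y \<notin> T" "y \<notin> V j" by auto
    then obtain l where l: "l < n" "y \<in> V l" using ZV verts_eq by auto
    have "j \<noteq> l" using y l by auto
    hence "Z = (Z \<inter> V j) \<union> (Z \<inter> V l)" using pair[OF j(1) _ l(1)] x y j l by blast
    thus False using ne disjT[OF j(1)] disjT[OF l(1)] by blast
  qed
  obtain z where z: "z \<in> Z" using Z by auto
  then obtain j where j: "j < n" "Z \<inter> V j \<noteq> {}" using T ZV verts_eq by blast
  obtain l where l: "l < n" "l \<noteq> j" "Z \<inter> V l \<noteq> {}" using other[OF T j] by auto
  have jl: "Z = (Z \<inter> V j) \<union> (Z \<inter> V l)" "card (Z \<inter> V j) = 2" using pair[OF j l(1,3)] l(2) by auto
  obtain x y where xy: "Z \<inter> V j = {x, y}" "x \<noteq> y" using jl(2) by (auto simp: card_2_iff)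
  have xj: "x \<in> V j" "y \<in> V j" using xy by auto
  let ?C = "Z \<inter> V l"
  have C: "Z - V j = ?C" using jl disj[OF j(1) l(1)] l(2) by blast
  have "nlinks H ({x} \<union> {y}) ?C = nlinks H {x} ?C + nlinks H {y} ?C"
    by (rule nlinks_Un_left[OF mult]) (use xy in auto)
  moreover have "{x} \<union> {y} = Z \<inter> V j" using xy by auto
  moreover have "2 \<le> nlinks H (Z \<inter> V j) ?C" using leaveV[OF j] ZVj[of j] C by simp
  moreover have x1: "nlinks H {x} ?C \<le> 1" "nlinks H {y} ?C \<le> 1"
    using single[OF j(1)] xj C by auto
  ultimately have "1 \<le> nlinks H {x} ?C" "1 \<le> nlinks H {y} ?C" by auto
  moreover have "nlinks H {w} ?C \<le> nlinks H {w} (V l)" for w by (rule nlinks_mono[OF mult]) auto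
  \<comment> \<open>\<open>x\<close> and \<open>y\<close> both have links to \<open>V l\<close>, so
    \<open>port\<close> leaves \<open>x\<close> with its one link to the other piece, too few for a
    thick set.\<close>
  ultimately have "nlinks H {x} {y} = 0"
    using port[OF j(1) l(1) _ xj xy(2)] l(2) le_trans by metis
  moreover have "nlinks H {x} {x} = 0" using small[OF j(1), of "{x}"] xj by simp
  moreover have "nlinks H {x} ({x} \<union> {y}) = nlinks H {x} {x} + nlinks H {x} {y}"
    by (rule nlinks_Un_right[OF mult]) (use xy in auto)
  moreover have "nlinks H {x} (({x} \<union> {y}) \<union> ?C) = nlinks H {x} ({x} \<union> {y}) + nlinks H {x} ?C"
    by (rule nlinks_Un_right[OF mult]) (use xy C in auto)
  moreover have "({x} \<union> {y}) \<union> ?C = Z" using jl(1) xy(1) by auto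
  ultimately have "nlinks H {x} Z \<le> 1" using x1 by simp
  moreover have "x \<in> Z" using xy by auto
  ultimately show False using thick by auto
qed

theorem robust: "robust H"
  unfolding robust_def using cut_ge_4 small_sparse by blast

end

section \<open>Poles obtained by removing a path\<close>

text \<open>The local assumptions of \<open>piece_ring\<close>, stated inside the pole.
  \<open>mate_semiedge\<close> forbids edges with two free ends, so that junctions of different
  pairs do not interfere. \<open>port\<close> concerns semiedges of one connector, which come from
  one removed vertex.\<close>

locale good_pole =
  fixes r :: nat and P :: "('v, 'd) pole"
  assumes pole: "pole_22 r P"
    and mate_semiedge: "\<And>s. s \<in> semiedges P \<Longrightarrow> mate P s \<notin> semiedges P"
    and split: "\<And>Y. Y \<subseteq> verts P \<Longrightarrow> Y \<noteq> {} \<Longrightarrow> Y \<noteq> verts P \<Longrightarrow> 2 \<le> nlinks P Y (verts P - Y)"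
    and cut: "\<And>Y. Y \<subseteq> verts P \<Longrightarrow> 2 \<le> card Y \<Longrightarrow> nlinks P Y Y + 4 \<le> 3 * card Y"
    and small: "\<And>Y. Y \<subseteq> verts P \<Longrightarrow> Y \<noteq> {} \<Longrightarrow> card Y \<le> 4 \<Longrightarrow> nlinks P Y Y + 2 \<le> 2 * card Y"
    and deg: "\<And>x. x \<in> verts P \<Longrightarrow> 2 \<le> nlinks P {x} (verts P)"
    and port: "\<And>C s t x y. C = inp P \<or> C = out P \<Longrightarrow> s \<in> C \<Longrightarrow> t \<in> C \<Longrightarrow>
      inc P (mate P s) = Some x \<Longrightarrow> inc P (mate P t) = Some y \<Longrightarrow> x \<noteq> y \<Longrightarrow> nlinks P {x} {y} = 0"

text \<open>
  \<open>R\<close> will be the vertex set of the path \<open>uv\<close> or \<open>uwv\<close>; the last assumption says that it has at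
  least \<open>card R - 1\<close> edges.
\<close>

locale removed_path =
  fixes G :: "('v, 'd) multipole" and R :: "'v set"
  assumes cubic: "cubic_graph G" and rob: "robust G"
    and R: "R \<subseteq> verts G" "2 \<le> card R" "card R \<le> 3" "2 * card R \<le> nlinks G R R + 2"
begin

abbreviation "W \<equiv> verts G - R"

lemma mult: "multipole G" and gr: "graph G"
  using cubic by (auto simp: cubic_graph_def graph_def)

lemma fin: "X \<subseteq> verts G \<Longrightarrow> finite X"
  using multipoleD(1)[OF mult] finite_subset by blast

text \<open>The path already provides as many inner links as the forest bound allows, so the removed
  vertices span no further edge.\<close>

lemma inner: "nlinks G R R + 2 = 2 * card R"
proof -
  have "R \<noteq> {}" using R(2) by auto
  thus ?thesis using robust_small[OF rob R(1)] R by auto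
qed

text \<open>The removed vertices have 3 |R| ends, of which 2 |R| - 2 are used inside, leaving |R| +
  2.\<close>

lemma outer: "nlinks G W R \<le> 5"
  using nlinks_cut[OF cubic R(1)] inner R(3) nlinks_sym[OF mult, of W] by simp

lemma W_small: "Y \<subseteq> W \<Longrightarrow> Y \<noteq> {} \<Longrightarrow> card Y \<le> 4 \<Longrightarrow> nlinks G Y Y + 2 \<le> 2 * card Y"
  using robust_small[OF rob] by blast

text \<open>The complement of \<open>Y\<close> contains \<open>R\<close>, hence at least two
  vertices, and \<open>robust_cut\<close> applies even to \<open>Y = W\<close>.\<close>

lemma W_cut':
  assumes "Y \<subseteq> W" "2 \<le> card Y"
  shows "4 \<le> nlinks G Y (verts G - Y)"
proof -
  have "card R \<le> card (verts G - Y)"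
    by (rule card_mono) (use assms R(1) fin[of "verts G"] in auto)
  thus ?thesis using robust_cut[OF rob, of Y] assms R(2) by auto
qed

lemma W_cut: "Y \<subseteq> W \<Longrightarrow> 2 \<le> card Y \<Longrightarrow> nlinks G Y Y + 4 \<le> 3 * card Y"
  using W_cut'[of Y] nlinks_cut[OF cubic, of Y] by (metis Diff_subset add_left_mono subset_trans)

text \<open>Two edges from \<open>x\<close> to the removed path would close a circuit on at most
  four vertices: \<open>{x} \<union> R\<close> would have at least 2 |R| + 2 inner links, its bound
  being 2 |R|.\<close>

lemma W_attach:
  assumes x: "x \<in> W"
  shows "nlinks G {x} R \<le> 1"
proof -
  have "nlinks G ({x} \<union> R) ({x} \<union> R) = nlinks G {x} {x} + 2 * nlinks G {x} R + nlinks G R R"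
    by (rule nlinks_Un_diag[OF mult]) (use x in auto)
  moreover have "card ({x} \<union> R) = Suc (card R)" using x fin[OF R(1)] by simp
  moreover have "nlinks G ({x} \<union> R) ({x} \<union> R) + 2 \<le> 2 * card ({x} \<union> R)"
    by (rule robust_small[OF rob]) (use x R calculation in auto)
  ultimately show ?thesis using inner by simp
qed

lemma W_deg:
  assumes x: "x \<in> W"
  shows "2 \<le> nlinks G {x} W"
proof -
  have "nlinks G {x} (R \<union> W) = nlinks G {x} R + nlinks G {x} W"
    by (rule nlinks_Un_right[OF mult]) auto
  moreover have "R \<union> W = verts G" using R(1) by auto
  moreover have "nlinks G {x} (verts G) = 3" using nlinks_verts[OF cubic, of "{x}"] x by simp
  ultimately show ?thesis using W_attach[OF x] by simp
qed

lemma W_split_single: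
  assumes x: "x \<in> W"
  shows "2 \<le> nlinks G {x} (W - {x})"
proof -
  have "nlinks G {x} ({x} \<union> (W - {x})) = nlinks G {x} {x} + nlinks G {x} (W - {x})"
    by (rule nlinks_Un_right[OF mult]) auto
  moreover have "{x} \<union> (W - {x}) = W" using x by auto
  moreover have "nlinks G {x} {x} = 0" using W_small[of "{x}"] x by simp
  ultimately show ?thesis using W_deg[OF x] by simp
qed

text \<open>If both sides have at least two vertices, each is left by at least four edges in
  \<open>G\<close>. Of these eight at most five go to \<open>R\<close>; the others run between the
  sides and are counted twice. A side with one vertex is covered by
  \<open>W_split_single\<close>.\<close>

lemma W_split:
  assumes Y: "Y \<subseteq> W" "Y \<noteq> {}" "Y \<noteq> W"
  shows "2 \<le> nlinks G Y (W - Y)"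
proof -
  let ?Z = "W - Y"
  have f: "finite Y" "finite ?Z" using Y(1) fin[of Y] fin[of ?Z] by auto
  have ne: "?Z \<noteq> {}" using Y by auto
  have pos: "0 < card Y" "0 < card ?Z" using f Y(2) ne by (auto simp: card_gt_0_iff)
  consider "card Y = 1" | "card ?Z = 1" | "2 \<le> card Y" "2 \<le> card ?Z" using pos by linarith
  thus ?thesis
  proof cases
    case 1
    then obtain x where "Y = {x}" using card_1_singletonE by blast
    thus ?thesis using W_split_single[of x] Y by auto
  next
    case 2
    then obtain x where x: "?Z = {x}" using card_1_singletonE by blast
    hence "x \<in> W" "W - {x} = Y" using Y by auto
    thus ?thesis using W_split_single[of x] x nlinks_sym[OF mult, of Y ?Z] by simp
  next
    case 3
    have "nlinks G Y (?Z \<union> R) = nlinks G Y ?Z + nlinks G Y R"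
      by (rule nlinks_Un_right[OF mult]) auto
    moreover have "?Z \<union> R = verts G - Y" using Y R(1) by auto
    moreover have "nlinks G ?Z (Y \<union> R) = nlinks G ?Z Y + nlinks G ?Z R"
      by (rule nlinks_Un_right[OF mult]) (use Y in auto)
    moreover have "Y \<union> R = verts G - ?Z" using Y R(1) by auto
    moreover have "nlinks G (Y \<union> ?Z) R = nlinks G Y R + nlinks G ?Z R"
      by (rule nlinks_Un_left[OF mult]) auto
    moreover have "Y \<union> ?Z = W" using Y by auto
    moreover have "4 \<le> nlinks G Y (verts G - Y)" by (rule W_cut'[OF Y(1) 3(1)])
    moreover have "4 \<le> nlinks G ?Z (verts G - ?Z)" by (rule W_cut'[OF _ 3(2)]) auto
    ultimately show ?thesis using outer nlinks_sym[OF mult, of Y ?Z] by simp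
  qed
qed

text \<open>A third edge would give three vertices 6 inner links, where only 4 are allowed.\<close>

lemma no_triangle:
  assumes "x \<in> verts G" "y \<in> verts G" "u \<in> verts G" "x \<noteq> y" "x \<noteq> u" "y \<noteq> u"
    and "1 \<le> nlinks G {x} {u}" "1 \<le> nlinks G {y} {u}"
  shows "nlinks G {x} {y} = 0"
proof -
  let ?X = "({x} \<union> {y}) \<union> {u}"
  have "nlinks G ?X ?X = nlinks G ({x} \<union> {y}) ({x} \<union> {y}) + 2 * nlinks G ({x} \<union> {y}) {u} + nlinks G {u} {u}"
    by (rule nlinks_Un_diag[OF mult]) (use assms in auto)
  moreover have "nlinks G ({x} \<union> {y}) ({x} \<union> {y}) = nlinks G {x} {x} + 2 * nlinks G {x} {y} + nlinks G {y} {y}"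
    by (rule nlinks_Un_diag[OF mult]) (use assms in auto)
  moreover have "nlinks G ({x} \<union> {y}) {u} = nlinks G {x} {u} + nlinks G {y} {u}"
    by (rule nlinks_Un_left[OF mult]) (use assms in auto)
  moreover have "card ?X = 3" using assms by simp
  moreover have "nlinks G ?X ?X + 2 \<le> 2 * card ?X"
    by (rule robust_small[OF rob]) (use assms in auto)
  ultimately show ?thesis using assms by linarith
qed

end

text \<open>Common frame for both removals, so that the local inequalities are derived once:
  \<open>A\<close> holds the ends of the path's edges, two or four of them.\<close>

locale removed_path_pole = removed_path G R
  for G :: "('v, 'd) multipole" and R +
  fixes P :: "('v, 'd) pole" and r :: nat and A :: "'d set" and u v :: 'v
  assumes A: "A \<subseteq> links G R R" "2 * card R \<le> card A + 2"
    and P: "verts P = verts G - R" "ends P = ends G - A" "mate P = mate G"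
      "inc P = (\<lambda>d. if inc G d \<in> Some ` R then None else inc G d)"
    and uv: "u \<in> R" "v \<in> R" "inp P \<subseteq> ends_at G u" "out P \<subseteq> ends_at G v"
    and connectors: "semiedges P = inp P \<union> out P \<union> res P"
      "inp P \<inter> out P = {}" "inp P \<inter> res P = {}" "out P \<inter> res P = {}"
      "card (inp P) = 2" "card (out P) = 2" "card (res P) = r"
begin

text \<open>\<open>A\<close> has as many elements as there are inner links of \<open>R\<close>.
  Hence every other end at \<open>R\<close> leads to \<open>W\<close>, and the pole has no edge with
  two free ends.\<close>

lemma A_eq: "A = links G R R"
proof (rule card_subset_eq[OF finite_links[OF mult] A(1)])
  have "card A \<le> nlinks G R R" unfolding nlinks_def by (rule card_mono[OF finite_links[OF mult] A(1)])
  thus "card A = card (links G R R)" using A(2) inner by (simp add: nlinks_def)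
qed

lemma nlinks_P:
  assumes "Y \<subseteq> W" "Z \<subseteq> W"
  shows "nlinks P Y Z = nlinks G Y Z"
proof -
  have "links P Y Z = links G Y Z"
    using assms by (auto simp: links_def P A_eq)
  thus ?thesis by (simp add: nlinks_def)
qed

lemma multipole_P: "multipole P"
proof -
  have "mate G d \<in> ends G - A" if "d \<in> ends G - A" for d
    using that multipoleD(3,5)[OF mult, of d] by (auto simp: A_eq links_def)
  thus ?thesis using mult unfolding multipole_def P by auto
qed

lemma ends_at_P: "x \<in> verts P \<Longrightarrow> ends_at P x = ends_at G x"
  by (auto simp: ends_at_def P A_eq links_def)

lemma semiedges_P: "semiedges P = {d \<in> ends G - A. inc G d \<in> Some ` R}"
  using gr by (auto simp: semiedges_def P graph_def)

lemma good_pole: "good_pole r P"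
proof
  have "cubic P" using cubic ends_at_P by (auto simp: cubic_def valency_def cubic_graph_def P)
  thus "pole_22 r P" unfolding pole_22_def using multipole_P connectors by blast
  show "mate P s \<notin> semiedges P" if "s \<in> semiedges P" for s
    using that multipoleD(3,5)[OF mult, of s] by (auto simp: semiedges_P P A_eq links_def)
  show "2 \<le> nlinks P Y (verts P - Y)" if "Y \<subseteq> verts P" "Y \<noteq> {}" "Y \<noteq> verts P" for Y
    using W_split[of Y] that nlinks_P[of Y "W - Y"] by (simp add: P Diff_subset)
  show "nlinks P Y Y + 4 \<le> 3 * card Y" if "Y \<subseteq> verts P" "2 \<le> card Y" for Y
    using W_cut[of Y] that nlinks_P[of Y Y] by (simp add: P)
  show "nlinks P Y Y + 2 \<le> 2 * card Y" if "Y \<subseteq> verts P" "Y \<noteq> {}" "card Y \<le> 4" for Y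
    using W_small[of Y] that nlinks_P[of Y Y] by (simp add: P)
  show "2 \<le> nlinks P {x} (verts P)" if "x \<in> verts P" for x
    using W_deg[of x] that nlinks_P[of "{x}" W] by (simp add: P)
  show "nlinks P {x} {y} = 0" if C: "C = inp P \<or> C = out P" "s \<in> C" "t \<in> C"
    and x: "inc P (mate P s) = Some x" and y: "inc P (mate P t) = Some y" and xy: "x \<noteq> y" for C s t x y
  proof -
    \<comment> \<open>Both semiedges of a connector were attached to one removed vertex, so
      \<open>x\<close> and \<open>y\<close> are neighbours of \<open>w\<close>, and an edge between
      them would close a triangle.\<close>
    obtain w where w: "w \<in> R" "C \<subseteq> ends_at G w" using C uv by blast
    have st: "s \<in> ends_at G w" "t \<in> ends_at G w" using C w by auto
    have x': "x \<notin> R" "inc G (mate G s) = Some x" and y': "y \<notin> R" "inc G (mate G t) = Some y"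
      using x y by (auto simp: P split: if_splits)
    have xyV: "x \<in> W" "y \<in> W"
      using st x' y' multipoleD(3,6)[OF mult] by (auto simp: ends_at_def)
    have "s \<in> links G {w} {x}" "t \<in> links G {w} {y}"
      using st x' y' by (auto simp: links_def ends_at_def)
    hence "1 \<le> nlinks G {w} {x}" "1 \<le> nlinks G {w} {y}"
      using finite_links[OF mult] unfolding nlinks_def
      by (metis One_nat_def Suc_leI card_gt_0_iff empty_iff)+
    hence "nlinks G {x} {y} = 0"
      using no_triangle[of x y w] xyV w(1) R(1) xy x' y' nlinks_sym[OF mult, of "{w}"] by auto
    thus ?thesis using nlinks_P[of "{x}" "{y}"] xyV by simp
  qed
qed

end

lemma card_ends_at: "cubic_graph G \<Longrightarrow> x \<in> verts G \<Longrightarrow> card (ends_at G x) = 3"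
  by (auto simp: cubic_graph_def cubic_def valency_def)

lemma good_pole_remove_path1:
  assumes c4: "cyclically_4_edge_connected G" and g: "girth G \<ge> 5" and p: "is_path1 G a"
  shows "good_pole 0 (remove_path1 G a)"
proof -
  have cg: "cubic_graph G" using c4 by (simp add: cyclically_4_edge_connected_def)
  hence G: "graph G" and M: "multipole G" by (auto simp: cubic_graph_def graph_def)
  have a: "a \<in> ends G" "inc G a \<noteq> inc G (mate G a)" using p by (auto simp: is_path1_def)
  have a': "mate G a \<in> ends G" by (rule multipoleD(3)[OF M a(1)])
  obtain u where u: "inc G a = Some u" "u \<in> verts G" using graph_inc[OF G a(1)] .
  obtain v where v: "inc G (mate G a) = Some v" "v \<in> verts G" using graph_inc[OF G a'] .
  have uv: "u \<noteq> v" using a u v by auto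
  let ?P = "remove_path1 G a" and ?A = "{a, mate G a}" and ?R = "{u, v}"
  have A: "?A \<subseteq> links G ?R ?R"
    using a a' u v multipoleD(5)[OF M a(1)] by (auto simp: links_def)
  have cA: "card ?A = 2" using multipoleD(4)[OF M a(1)] by auto
  have cA': "card ?A \<le> nlinks G ?R ?R" unfolding nlinks_def by (rule card_mono[OF finite_links[OF M] A])
  have P: "verts ?P = verts G - ?R" "ends ?P = ends G - ?A" "mate ?P = mate G"
      "inc ?P = (\<lambda>d. if inc G d \<in> Some ` ?R then None else inc G d)"
      "inp ?P = ends_at G u - {a}" "out ?P = ends_at G v - {mate G a}" "res ?P = {}"
    using u v by (auto simp: remove_path1_def)
  have fin: "finite (ends_at G x)" for x using multipoleD(2)[OF M] by (simp add: ends_at_def)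
  interpret removed_path_pole G ?R ?P 0 ?A u v
  proof
    show "semiedges ?P = inp ?P \<union> out ?P \<union> res ?P"
      using u v uv G by (auto simp: semiedges_def P ends_at_def graph_def)
    show "inp ?P \<inter> out ?P = {}" using uv by (auto simp: P ends_at_def)
    show "card (inp ?P) = 2" "card (out ?P) = 2"
      using card_ends_at[OF cg u(2)] card_ends_at[OF cg v(2)] fin u v a a' by (auto simp: P ends_at_def)
    show "card (res ?P) = 0" by (simp add: P)
    show "2 * card ?R \<le> card ?A + 2" using cA uv by simp
    show "2 * card ?R \<le> nlinks G ?R ?R + 2" using cA cA' uv by simp
  qed (use cg robust_if[OF c4 g] u v uv A in \<open>auto simp: P\<close>)
  show ?thesis by (rule good_pole)
qed

lemma good_pole_remove_path2:
  assumes c4: "cyclically_4_edge_connected G" and g: "girth G \<ge> 5" and p: "is_path2 G a b"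
  shows "good_pole 1 (remove_path2 G a b)"
proof -
  have cg: "cubic_graph G" using c4 by (simp add: cyclically_4_edge_connected_def)
  hence G: "graph G" and M: "multipole G" by (auto simp: cubic_graph_def graph_def)
  have a: "a \<in> ends G" and b: "b \<in> ends G" and ab: "inc G (mate G a) = inc G b"
    "distinct [inc G a, inc G b, inc G (mate G b)]" using p by (auto simp: is_path2_def)
  have a': "mate G a \<in> ends G" and b': "mate G b \<in> ends G" using multipoleD(3)[OF M] a b by auto
  obtain u where u: "inc G a = Some u" "u \<in> verts G" using graph_inc[OF G a(1)] .
  obtain w where w: "inc G b = Some w" "w \<in> verts G" using graph_inc[OF G b] .
  obtain v where v: "inc G (mate G b) = Some v" "v \<in> verts G" using graph_inc[OF G b'] .
  have w': "inc G (mate G a) = Some w" using ab w by simp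
  have uwv: "u \<noteq> v" "u \<noteq> w" "w \<noteq> v" using ab u v w by auto
  \<comment> \<open>Otherwise both edges of the path would be the same and its two outer vertices
    would coincide.\<close>
  have ab': "mate G a \<noteq> b"
  proof
    assume "mate G a = b"
    hence "mate G b = a" using multipoleD(5)[OF M a] by auto
    thus False using u v uwv by simp
  qed
  let ?P = "remove_path2 G a b" and ?A = "{a, mate G a, b, mate G b}" and ?R = "{u, w, v}"
  have A: "?A \<subseteq> links G ?R ?R"
    using a a' b b' u v w w' multipoleD(5)[OF M] by (auto simp: links_def)
  have ne: "a \<noteq> mate G a" "a \<noteq> b" "a \<noteq> mate G b" "mate G a \<noteq> b" "mate G a \<noteq> mate G b" "b \<noteq> mate G b"
    using u v w w' ab' uwv by auto
  have cA: "card ?A = 4" using ne by simp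
  have cA': "card ?A \<le> nlinks G ?R ?R" unfolding nlinks_def by (rule card_mono[OF finite_links[OF M] A])
  have P: "verts ?P = verts G - ?R" "ends ?P = ends G - ?A" "mate ?P = mate G"
      "inc ?P = (\<lambda>d. if inc G d \<in> Some ` ?R then None else inc G d)"
      "inp ?P = ends_at G u - {a}" "out ?P = ends_at G v - {mate G b}"
      "res ?P = ends_at G w - {mate G a, b}"
    using u v w by (auto simp: remove_path2_def)
  have fin: "finite (ends_at G x)" for x using multipoleD(2)[OF M] by (simp add: ends_at_def)
  interpret removed_path_pole G ?R ?P 1 ?A u v
  proof
    show "semiedges ?P = inp ?P \<union> out ?P \<union> res ?P"
      using u v w w' uwv G by (auto simp: semiedges_def P ends_at_def graph_def)
    show "inp ?P \<inter> out ?P = {}" "inp ?P \<inter> res ?P = {}" "out ?P \<inter> res ?P = {}"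
      using uwv by (auto simp: P ends_at_def)
    show "card (inp ?P) = 2" "card (out ?P) = 2"
      using card_ends_at[OF cg u(2)] card_ends_at[OF cg v(2)] fin u v a b' by (auto simp: P ends_at_def)
    have "{mate G a, b} \<subseteq> ends_at G w" using w w' a' b by (auto simp: ends_at_def)
    hence "card (res ?P) = card (ends_at G w) - card {mate G a, b}"
      unfolding P by (intro card_Diff_subset) auto
    thus "card (res ?P) = 1" using card_ends_at[OF cg w(2)] ab' by simp
    show "2 * card ?R \<le> card ?A + 2" using cA uwv by simp
    show "2 * card ?R \<le> nlinks G ?R ?R + 2" using cA cA' uwv by simp
  qed (use cg robust_if[OF c4 g] u v w uwv A in \<open>auto simp: P\<close>)
  show ?thesis by (rule good_pole)
qed


section \<open>Junctions\<close>

text \<open>A junction refers to the mates at the moment it is performed. As no joined end has a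
  joined end as its mate, earlier junctions do not alter the mates read by later ones, and the
  result is described by the mates in \<open>M\<close>.\<close>

lemma junctions_props:
  assumes M: "multipole M" and d: "distinct (map fst ps @ map snd ps)"
    and U: "U = fst ` set ps \<union> snd ` set ps" "U \<subseteq> ends M" "mate M ` U \<inter> U = {}"
  shows "verts (junctions ps M) = verts M" "inc (junctions ps M) = inc M"
    "ends (junctions ps M) = ends M - U"
    "(s, t) \<in> set ps \<Longrightarrow> mate (junctions ps M) (mate M s) = mate M t \<and> mate (junctions ps M) (mate M t) = mate M s"
    "e \<in> ends M \<Longrightarrow> mate M e \<notin> U \<Longrightarrow> mate (junctions ps M) e = mate M e"
    "multipole (junctions ps M)"
proof -
  have "verts (junctions ps M) = verts M \<and> inc (junctions ps M) = inc M \<and>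
    ends (junctions ps M) = ends M - U \<and>
    (\<forall>(s, t)\<in>set ps. mate (junctions ps M) (mate M s) = mate M t \<and> mate (junctions ps M) (mate M t) = mate M s) \<and>
    (\<forall>e\<in>ends M. mate M e \<notin> U \<longrightarrow> mate (junctions ps M) e = mate M e) \<and>
    multipole (junctions ps M)"
    using d U
  proof (induction ps arbitrary: U rule: rev_induct)
    case Nil
    thus ?case using M by (simp add: junctions_def)
  next
    case (snoc p ps)
    obtain s t where p: "p = (s, t)" by (cases p)
    define U' where "U' = fst ` set ps \<union> snd ` set ps"
    let ?J = "junctions ps M"
    have UU: "U = insert s (insert t U')" using snoc.prems by (auto simp: U'_def p)
    have J: "verts ?J = verts M" "inc ?J = inc M" "ends ?J = ends M - U'"
      "\<And>s t. (s, t) \<in> set ps \<Longrightarrow> mate ?J (mate M s) = mate M t \<and> mate ?J (mate M t) = mate M s"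
      "\<And>e. e \<in> ends M \<Longrightarrow> mate M e \<notin> U' \<Longrightarrow> mate ?J e = mate M e" "multipole ?J"
    proof -
      have "distinct (map fst ps @ map snd ps)" using snoc.prems(1) by auto
      moreover have "U' \<subseteq> ends M" using snoc.prems(3) unfolding UU by blast
      moreover have "mate M ` U' \<inter> U' = {}" using snoc.prems(4) unfolding UU by blast
      ultimately have IH: "verts ?J = verts M \<and> inc ?J = inc M \<and> ends ?J = ends M - U' \<and>
        (\<forall>(s, t)\<in>set ps. mate ?J (mate M s) = mate M t \<and> mate ?J (mate M t) = mate M s) \<and>
        (\<forall>e\<in>ends M. mate M e \<notin> U' \<longrightarrow> mate ?J e = mate M e) \<and> multipole ?J"
        by (rule snoc.IH[OF _ U'_def])
      note c = IH[THEN conjunct2]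
      note c' = c[THEN conjunct2, THEN conjunct2]
      show "verts ?J = verts M" by (rule IH[THEN conjunct1])
      show "inc ?J = inc M" by (rule c[THEN conjunct1])
      show "ends ?J = ends M - U'" by (rule c[THEN conjunct2, THEN conjunct1])
      show "multipole ?J" by (rule c'[THEN conjunct2, THEN conjunct2])
      note pairs = c'[THEN conjunct1] and rest = c'[THEN conjunct2, THEN conjunct1]
      show "mate ?J (mate M s) = mate M t \<and> mate ?J (mate M t) = mate M s" if "(s, t) \<in> set ps" for s t
        using bspec[OF pairs that] by simp
      show "mate ?J e = mate M e" if "e \<in> ends M" "mate M e \<notin> U'" for e
        using rest that by simp
    qed
    have st: "s \<noteq> t" "s \<notin> U'" "t \<notin> U'" using snoc.prems(1) by (auto simp: p U'_def)
    have E: "s \<in> ends M" "t \<in> ends M" "U' \<subseteq> ends M" using snoc.prems(3) unfolding UU by blast+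
    have mU: "mate M x \<notin> U" if "x \<in> U" for x using snoc.prems(4) that by blast
    have sU: "s \<in> U" "t \<in> U" by (auto simp: UU)
    \<comment> \<open>This is where the disjointness of \<open>U\<close> from its mates enters: the
      earlier junctions have left the mates of \<open>s\<close> and \<open>t\<close> as they
      were.\<close>
    have mst: "mate ?J s = mate M s" "mate ?J t = mate M t"
      using J(5) E mU[OF sU(1)] mU[OF sU(2)] UU by auto
    define K where "K = junctions (ps @ [p]) M"
    have K: "verts K = verts M" "inc K = inc M" "ends K = ends M - U"
      "mate K = (mate ?J)(mate M s := mate M t, mate M t := mate M s)"
      using J st mst by (auto simp: K_def junctions_def junction_def p UU)
    have inj: "mate M x = mate M y \<longleftrightarrow> x = y" if "x \<in> ends M" "y \<in> ends M" for x y
      using multipoleD(5)[OF M] that by metis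
    have 4: "mate K (mate M s') = mate M t' \<and> mate K (mate M t') = mate M s'"
      if "(s', t') \<in> set (ps @ [p])" for s' t'
    proof (cases "(s', t') \<in> set ps")
      case True
      hence "s' \<in> U'" "t' \<in> U'" by (force simp: U'_def)+
      hence "mate M s' \<noteq> mate M s" "mate M s' \<noteq> mate M t" "mate M t' \<noteq> mate M s" "mate M t' \<noteq> mate M t"
        using inj E st by blast+
      thus ?thesis using J(4)[OF True] by (simp add: K)
    next
      case False
      hence "s' = s" "t' = t" using that by (auto simp: p)
      thus ?thesis using inj[OF E(1,2)] st by (simp add: K)
    qed
    have 5: "mate K e = mate M e" if "e \<in> ends M" "mate M e \<notin> U" for e
    proof -
      have "e \<noteq> mate M s" "e \<noteq> mate M t" using that sU E multipoleD(5)[OF M] by auto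
      thus ?thesis using J(5)[of e] that by (simp add: K UU)
    qed
    have 6: "multipole K"
    proof -
      \<comment> \<open>The ends opposite to joined ends survive; they are paired with each other,
        and all other ends keep their mates.\<close>
      have mm: "mate M x \<in> ends K" if "x \<in> U" for x
        using that mU snoc.prems(3) multipoleD(3)[OF M] by (auto simp: K)
      have "mate K e \<in> ends K \<and> mate K e \<noteq> e \<and> mate K (mate K e) = e" if e: "e \<in> ends K" for e
      proof (cases "mate M e \<in> U")
        case False
        have eM: "e \<in> ends M" "e \<notin> U" using e by (auto simp: K)
        have "mate K (mate M e) = mate M (mate M e)"
          using 5[of "mate M e"] eM multipoleD(3,5)[OF M] by auto
        thus ?thesis using 5[OF eM(1) False] False eM multipoleD(3,4,5)[OF M eM(1)] by (auto simp: K(3))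
      next
        case True
        have eM: "e \<in> ends M" "e = mate M (mate M e)" using e multipoleD(5)[OF M, of e] by (auto simp: K)
        obtain s' t' where st': "(s', t') \<in> set (ps @ [p])" "mate M e = s' \<or> mate M e = t'"
        proof -
          have "mate M e \<in> fst ` set (ps @ [p]) \<union> snd ` set (ps @ [p])"
            using True unfolding snoc.prems(2) .
          then obtain q where "q \<in> set (ps @ [p])" "mate M e = fst q \<or> mate M e = snd q" by blast
          thus ?thesis using that[of "fst q" "snd q"] by simp
        qed
        have im: "s' \<in> fst ` set (ps @ [p])" "t' \<in> snd ` set (ps @ [p])"
          using imageI[OF st'(1), of fst] imageI[OF st'(1), of snd] by simp_all
        hence "s' \<in> U" "t' \<in> U" unfolding snoc.prems(2) by blast+
        moreover have "fst ` set (ps @ [p]) \<inter> snd ` set (ps @ [p]) = {}"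
          using snoc.prems(1) unfolding distinct_append set_map by blast
        hence "s' \<noteq> t'" using im by blast
        ultimately have "mate M s' \<in> ends K" "mate M t' \<in> ends K" "mate M s' \<noteq> mate M t'"
          using mm inj snoc.prems(3) by blast+
        thus ?thesis using 4[OF st'(1)] st'(2) eM(2) by auto
      qed
      thus ?thesis using M unfolding multipole_def K by auto
    qed
    have "\<forall>(s, t)\<in>set (ps @ [p]). mate K (mate M s) = mate M t \<and> mate K (mate M t) = mate M s"
      using 4 by blast
    thus ?case using K(1-3) 5 6 unfolding K_def by blast
  qed
  thus "verts (junctions ps M) = verts M" "inc (junctions ps M) = inc M"
    "ends (junctions ps M) = ends M - U"
    "(s, t) \<in> set ps \<Longrightarrow> mate (junctions ps M) (mate M s) = mate M t \<and> mate (junctions ps M) (mate M t) = mate M s"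
    "e \<in> ends M \<Longrightarrow> mate M e \<notin> U \<Longrightarrow> mate (junctions ps M) e = mate M e"
    "multipole (junctions ps M)"
    by auto
qed

section \<open>Disjoint sums of multipoles\<close>

lemma multipole_disjoint_sum:
  assumes M: "multipole M" and N: "multipole N"
  shows "multipole (disjoint_sum M N)"
  unfolding multipole_def
proof (intro conjI ballI allI impI)
  fix d assume "d \<in> ends (disjoint_sum M N)"
  hence d: "d \<in> ends M <+> ends N" by (simp add: disjoint_sum_def)
  show "mate (disjoint_sum M N) d \<in> ends (disjoint_sum M N)" "mate (disjoint_sum M N) d \<noteq> d"
    "mate (disjoint_sum M N) (mate (disjoint_sum M N) d) = d"
    using d multipoleD(3-5)[OF M] multipoleD(3-5)[OF N] by (auto simp: disjoint_sum_def)
  show "x \<in> verts (disjoint_sum M N)" if "inc (disjoint_sum M N) d = Some x" for x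
    using d that multipoleD(6)[OF M] multipoleD(6)[OF N] by (auto simp: disjoint_sum_def)
qed (use multipoleD(1,2)[OF M] multipoleD(1,2)[OF N] in \<open>auto simp: disjoint_sum_def\<close>)

lemma multipole_disjoint_family_sum:
  assumes M: "\<And>i. i < k \<Longrightarrow> multipole (F i)"
  shows "multipole (disjoint_family_sum k F)"
  unfolding multipole_def
proof (intro conjI ballI allI impI)
  fix d assume "d \<in> ends (disjoint_family_sum k F)"
  then obtain i e where d: "d = (i, e)" "i < k" "e \<in> ends (F i)" by (auto simp: disjoint_family_sum_def)
  show "mate (disjoint_family_sum k F) d \<in> ends (disjoint_family_sum k F)"
    "mate (disjoint_family_sum k F) d \<noteq> d"
    "mate (disjoint_family_sum k F) (mate (disjoint_family_sum k F) d) = d"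
    using d multipoleD(3-5)[OF M[OF d(2)] d(3)] by (auto simp: disjoint_family_sum_def)
  show "x \<in> verts (disjoint_family_sum k F)" if "inc (disjoint_family_sum k F) d = Some x" for x
    using d that multipoleD(6)[OF M[OF d(2)] d(3)] by (auto simp: disjoint_family_sum_def)
qed (use multipoleD(1,2)[OF M] in \<open>auto simp: disjoint_family_sum_def\<close>)

lemma distinct_concat_map:
  assumes "distinct is" "\<And>i. i \<in> set is \<Longrightarrow> distinct (f i)"
    "\<And>i j. i \<in> set is \<Longrightarrow> j \<in> set is \<Longrightarrow> i \<noteq> j \<Longrightarrow> set (f i) \<inter> set (f j) = {}"
  shows "distinct (concat (map f is))"
  using assms
proof (induction "is")
  case (Cons i js)
  have "set (f i) \<inter> set (f j) = {}" if "j \<in> set js" for j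
    using Cons.prems(1) Cons.prems(3)[of i j] that by auto
  thus ?case using Cons by auto
qed simp

section \<open>Good poles and their joins\<close>

context good_pole begin

lemma mult: "multipole P"
  using pole by (simp add: pole_22_def)

lemma fin_semiedges: "finite (semiedges P)"
  using multipoleD(2)[OF mult] by (simp add: semiedges_def)

lemma semiedgesE: "semiedges P = inp P \<union> out P \<union> res P" "inp P \<inter> out P = {}" "inp P \<inter> res P = {}"
  "out P \<inter> res P = {}" "card (inp P) = 2" "card (out P) = 2" "card (res P) = r"
  using pole by (auto simp: pole_22_def)

lemma semiedge_ends: "s \<in> semiedges P \<Longrightarrow> s \<in> ends P \<and> inc P s = None"
  by (simp add: semiedges_def)

lemma connector_inc: "s \<in> inp P \<union> out P \<union> res P \<Longrightarrow> inc P s = None"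
  using semiedgesE(1) semiedge_ends by blast

lemma mate_semiedge_inc:
  assumes "s \<in> semiedges P"
  obtains x where "inc P (mate P s) = Some x" "x \<in> verts P" "mate P s \<in> ends P"
    "mate P (mate P s) = s"
  using assms mate_semiedge[OF assms] multipoleD(3,5,6)[OF mult, of s] multipoleD(6)[OF mult, of "mate P s"]
  by (cases "inc P (mate P s)") (auto simp: semiedges_def)

lemma semiedge_cases:
  assumes "d \<in> ends P" "inc P d = None"
  obtains "d \<in> inp P" | "d \<in> out P" | "d \<in> res P"
  using assms semiedgesE(1) by (auto simp: semiedges_def)

end

locale fragment =
  D: good_pole 0 D + B: good_pole 1 B
  for D :: "('a, 'd) pole" and B :: "('b, 'e) pole" +
  fixes ps :: "('d \<times> 'e) list"
  assumes pair: "pairing (out D) (inp B) ps"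
begin

abbreviation "DB \<equiv> join D B ps"

lemma res_D: "res D = {}"
  using D.semiedgesE(1,7) D.fin_semiedges by simp

lemma F_connectors: "inp DB = Inl ` inp D" "out DB = Inr ` out B" "res DB = Inr ` res B"
  by (auto simp: join_def Let_def res_D)

text \<open>Connectors consist of semiedges, and the mate of a semiedge is never one, so the joined
  ends satisfy the hypotheses of \<open>junctions_props\<close> in the disjoint sum.\<close>

lemma DB_props:
  "verts DB = verts D <+> verts B"
  "ends DB = (ends D - out D) <+> (ends B - inp B)"
  "inc DB = case_sum (map_option Inl \<circ> inc D) (map_option Inr \<circ> inc B)"
  "multipole DB"
  "(s, t) \<in> set ps \<Longrightarrow> mate DB (Inl (mate D s)) = Inr (mate B t) \<and> mate DB (Inr (mate B t)) = Inl (mate D s)"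
  "d \<in> ends D \<Longrightarrow> mate D d \<notin> out D \<Longrightarrow> mate DB (Inl d) = Inl (mate D d)"
  "e \<in> ends B \<Longrightarrow> mate B e \<notin> inp B \<Longrightarrow> mate DB (Inr e) = Inr (mate B e)"
proof -
  let ?M = "disjoint_sum D B" and ?ps = "map (map_prod Inl Inr) ps :: (('d + 'e) \<times> ('d + 'e)) list"
  let ?U = "Inl ` out D \<union> Inr ` inp B"
  have p: "distinct (map fst ps)" "fst ` set ps = out D" "distinct (map snd ps)" "snd ` set ps = inp B"
    using pair by (auto simp: pairing_def)
  have M: "multipole ?M" by (rule multipole_disjoint_sum[OF D.mult B.mult])
  have mf: "map fst ?ps = map Inl (map fst ps)" "map snd ?ps = map Inr (map snd ps)" by auto
  have d: "distinct (map fst ?ps @ map snd ?ps)"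
    unfolding mf distinct_append distinct_map[of Inl] distinct_map[of Inr] using p(1,3) by auto
  have U: "?U = fst ` set ?ps \<union> snd ` set ?ps"
    using p(2,4) by (force simp flip: p(2,4))
  have UE: "?U \<subseteq> ends ?M"
    using D.semiedgesE(1) B.semiedgesE(1) by (auto simp: disjoint_sum_def semiedges_def)
  have "mate D s \<notin> out D" if "s \<in> out D" for s using D.mate_semiedge[of s] D.semiedgesE(1) that by auto
  moreover have "mate B s \<notin> inp B" if "s \<in> inp B" for s using B.mate_semiedge[of s] B.semiedgesE(1) that by auto
  ultimately have UU: "mate ?M ` ?U \<inter> ?U = {}" by (auto simp: disjoint_sum_def)
  note J = junctions_props[OF M d U UE UU]
  have F: "verts DB = verts (junctions ?ps ?M)" "ends DB = ends (junctions ?ps ?M)"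
    "mate DB = mate (junctions ?ps ?M)" "inc DB = inc (junctions ?ps ?M)"
    by (simp_all add: join_def Let_def)
  show "verts DB = verts D <+> verts B" unfolding F J(1) by (simp add: disjoint_sum_def)
  show "ends DB = (ends D - out D) <+> (ends B - inp B)" unfolding F J(3) by (auto simp: disjoint_sum_def)
  show "inc DB = case_sum (map_option Inl \<circ> inc D) (map_option Inr \<circ> inc B)"
    unfolding F J(2) by (simp add: disjoint_sum_def)
  show "multipole DB" using J(6) unfolding multipole_def F by simp
  show "mate DB (Inl (mate D s)) = Inr (mate B t) \<and> mate DB (Inr (mate B t)) = Inl (mate D s)"
    if "(s, t) \<in> set ps"
    using J(4)[of "Inl s" "Inr t"] that by (force simp: F disjoint_sum_def)
  show "mate DB (Inl d) = Inl (mate D d)" if "d \<in> ends D" "mate D d \<notin> out D"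
    using J(5)[of "Inl d"] that by (force simp: F disjoint_sum_def)
  show "mate DB (Inr e) = Inr (mate B e)" if "e \<in> ends B" "mate B e \<notin> inp B"
    using J(5)[of "Inr e"] that by (force simp: F disjoint_sum_def)
qed

lemma pairs_ex:
  "s \<in> out D \<Longrightarrow> \<exists>t\<in>inp B. (s, t) \<in> set ps" "t \<in> inp B \<Longrightarrow> \<exists>s\<in>out D. (s, t) \<in> set ps"
  using pair unfolding pairing_def by force+

end

section \<open>Ends and mates of a Halin snark\<close>

lemma Plus_iffs: "Inl x \<in> A <+> B \<longleftrightarrow> x \<in> A" "Inr y \<in> A <+> B \<longleftrightarrow> y \<in> B"
  by auto

text \<open>A leaf adjacent to a leaf would form a component with it, leaving no room for a vertex
  that is no leaf. The neighbour of a leaf therefore survives the deletion of the leaves and can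
  receive a residual semiedge.\<close>

lemma tree_leaf:
  assumes S: "tree S" and nl: "verts S - leaves S \<noteq> {}" and x: "x \<in> leaves S"
  obtains e y where "ends_at S x = {e}" "inc S (mate S e) = Some y" "tree_neighbour S x = y"
    "y \<in> verts S - leaves S"
proof -
  have G: "graph S" and M: "multipole S" using S by (auto simp: tree_def graph_def)
  have "card (ends_at S x) = 1" using x by (simp add: leaves_def valency_def)
  then obtain e where e: "ends_at S x = {e}" by (rule card_1_singletonE)
  hence e': "e \<in> ends S" "inc S e = Some x" by (auto simp: ends_at_def)
  obtain y where y: "inc S (mate S e) = Some y" "y \<in> verts S"
    using graph_inc[OF G multipoleD(3)[OF M e'(1)]] .
  have adj: "adjacent S x z \<longleftrightarrow> z = y" for z
  proof
    assume "adjacent S x z"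
    then obtain d where "d \<in> ends_at S x" "inc S (mate S d) = Some z"
      by (auto simp: adjacent_def ends_at_def)
    thus "z = y" using e y by simp
  qed (use e' y in \<open>auto simp: adjacent_def\<close>)
  have "tree_neighbour S x = y" unfolding tree_neighbour_def by (rule the_equality) (simp_all add: adj)
  moreover have "y \<notin> leaves S"
  proof
    assume "y \<in> leaves S"
    hence "card (ends_at S y) = 1" by (simp add: leaves_def valency_def)
    then obtain f where f: "ends_at S y = {f}" by (rule card_1_singletonE)
    have "mate S e \<in> ends_at S y" using y multipoleD(3)[OF M e'(1)] by (simp add: ends_at_def)
    hence fe: "f = mate S e" using f by auto
    have adj': "z = x" if yz: "adjacent S y z" for z
    proof -
      obtain d where "d \<in> ends_at S y" "inc S (mate S d) = Some z"
        using yz by (auto simp: adjacent_def ends_at_def)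
      thus "z = x" using f fe e' multipoleD(5)[OF M e'(1)] by simp
    qed
    obtain z where z: "z \<in> verts S" "z \<notin> leaves S" using nl by auto
    have "(adjacent S)\<^sup>*\<^sup>* x z" using S x z by (auto simp: tree_def leaves_def)
    hence "z \<in> component_of S x" using z by (simp add: component_of_def)
    moreover have "component_of S x \<subseteq> {x, y}"
      by (rule component_subset) (use adj adj' in auto)
    ultimately show False using z x \<open>y \<in> leaves S\<close> by auto
  qed
  ultimately show ?thesis using that[OF e y(1)] y(2) by blast
qed

text \<open>\<open>conn\<close> has the connectors of the fragments unfolded: a fragment takes its
  output from \<open>B i\<close> and its input from \<open>D i\<close>.\<close>

locale halin_ring =
  fixes S :: "('s, 't) multipole" and k :: nat and v :: "nat \<Rightarrow> 's"
    and D :: "nat \<Rightarrow> ('a, 'd) pole" and B :: "nat \<Rightarrow> ('b, 'e) pole"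
    and ps :: "nat \<Rightarrow> ('d \<times> 'e) list" and qs :: "nat \<Rightarrow> (('d + 'e) \<times> ('d + 'e)) list"
  assumes S: "tree S" "\<And>x. x \<in> verts S - leaves S \<Longrightarrow> valency S x = 3" "verts S - leaves S \<noteq> {}"
    and k: "3 \<le> k" and v: "bij_betw v {..<k} (leaves S)"
    and frag: "\<And>i. i < k \<Longrightarrow> fragment (D i) (B i) (ps i)"
    and conn: "\<And>i. i < k \<Longrightarrow>
      pairing (Inr ` out (B i)) (Inl ` inp (D (Suc i mod k))) (qs i)"
begin

abbreviation "F i \<equiv> join (D i) (B i) (ps i)"
abbreviation "H \<equiv> connect_fragments S k v F qs"
abbreviation "A \<equiv> attach_fragments S k v F"
abbreviation "S' \<equiv> delete_vertices S (leaves S)"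
abbreviation "tn i \<equiv> tree_neighbour S (v i)"

lemma goodD: "i < k \<Longrightarrow> good_pole 0 (D i)" and goodB: "i < k \<Longrightarrow> good_pole 1 (B i)"
  using frag by (auto simp: fragment_def)

lemma graph_S: "graph S" "multipole S"
  using S(1) by (auto simp: tree_def graph_def)

lemma leaf: "i < k \<Longrightarrow> v i \<in> leaves S"
  using v by (auto simp: bij_betw_def)

lemma tn: "i < k \<Longrightarrow> tn i \<in> verts S - leaves S"
  using tree_leaf[OF S(1,3) leaf] by metis

lemma v_image: "v ` {..<k} = leaves S"
  using v by (simp add: bij_betw_def)

lemma S'_simps [simp]: "verts S' = verts S - leaves S" "mate S' = mate S" "inc S' = inc S"
  "ends S' = {d \<in> ends S. inc S d \<notin> Some ` leaves S \<and> inc S (mate S d) \<notin> Some ` leaves S}"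
  by (auto simp: delete_vertices_def edge_with_end_def)

lemma multipole_S': "multipole S'"
  using graph_S(2) multipoleD(3,5,6)[OF graph_S(2)]
  unfolding multipole_def by auto

lemma A_simps:
  "verts A = (SIGMA i:{..<k}. verts (F i)) <+> (verts S - leaves S)"
  "ends A = (SIGMA i:{..<k}. ends (F i)) <+> ends S'"
  "mate A (Inl (i, e)) = Inl (i, mate (F i) e)"
  "mate A (Inr t) = Inr (mate S t)"
  "inc A (Inl (i, e)) = (if e \<in> res (F i) then Some (Inr (tn i)) else map_option (\<lambda>x. Inl (i, x)) (inc (F i) e))"
  "inc A (Inr t) = map_option Inr (inc S t)"
  by (simp_all add: attach_fragments_def Let_def v_image disjoint_sum_def disjoint_family_sum_def option.map_comp o_def del: S'_simps(4))

lemma multipole_A: "multipole A"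
proof -
  let ?M = "disjoint_sum (disjoint_family_sum k F) S'"
  have "multipole (F i)" if "i < k" for i
    using fragment.DB_props(4)[OF frag[OF that]] .
  hence M: "multipole ?M"
    by (intro multipole_disjoint_sum multipole_disjoint_family_sum multipole_S')
  have A: "verts A = verts ?M" "ends A = ends ?M" "mate A = mate ?M"
    by (simp_all add: attach_fragments_def Let_def v_image del: S'_simps)
  have "x \<in> verts A" if d: "d \<in> ends A" "inc A d = Some x" for d x
  proof (cases "inc A d = inc ?M d")
    case True
    thus ?thesis using d multipoleD(6)[OF M] by (simp add: A)
  next
    case False
    then obtain i e where "d = Inl (i, e)" "e \<in> res (F i)"
      by (cases d) (auto simp: A_simps disjoint_sum_def disjoint_family_sum_def option.map_comp o_def split: if_splits)
    thus ?thesis using d tn[of i] by (auto simp: A_simps)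
  qed
  thus ?thesis using M unfolding multipole_def A by blast
qed

lemma Suc_mod_surj: "i < k \<Longrightarrow> \<exists>j<k. Suc j mod k = i"
  by (cases i) (auto intro: exI[of _ "k - 1"] exI[of _ "i - 1"])

lemma Suc_mod_inj: "i < k \<Longrightarrow> j < k \<Longrightarrow> Suc i mod k = Suc j mod k \<Longrightarrow> i = j"
  by (auto simp: mod_Suc split: if_splits)

lemma Suc_mod_ne: "i < k \<Longrightarrow> Suc i mod k \<noteq> i"
  using k by (auto simp: mod_Suc)

section \<open>The junctions between the fragments\<close>

definition ring_pairs :: "((nat \<times> ('d + 'e) + 't) \<times> (nat \<times> ('d + 'e) + 't)) list" where
  "ring_pairs = concat (map (\<lambda>i. map (\<lambda>(s, t). (Inl (i, s), Inl (Suc i mod k, t))) (qs i)) [0..<k])"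

lemma H_eq: "H = junctions ring_pairs A"
  by (simp add: connect_fragments_def ring_pairs_def)

definition joined_out :: "(nat \<times> ('d + 'e) + 't) set" where
  "joined_out = {Inl (i, Inr s) | i s. i < k \<and> s \<in> out (B i)}"

definition joined_in :: "(nat \<times> ('d + 'e) + 't) set" where
  "joined_in = {Inl (i, Inl s) | i s. i < k \<and> s \<in> inp (D i)}"

definition joined :: "(nat \<times> ('d + 'e) + 't) set" where
  "joined = joined_out \<union> joined_in"

lemmas joined_defs = joined_def joined_out_def joined_in_def

lemma set_ring_pairs: "set ring_pairs = {(Inl (i, s), Inl (Suc i mod k, t)) | i s t. i < k \<and> (s, t) \<in> set (qs i)}"
  by (force simp: ring_pairs_def)

lemma qs_props:
  assumes "i < k"
  shows "distinct (map fst (qs i))" "fst ` set (qs i) = Inr ` out (B i)"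
    "distinct (map snd (qs i))" "snd ` set (qs i) = Inl ` inp (D (Suc i mod k))"
  using conn[OF assms] by (auto simp: pairing_def)

lemma ring_pairs_fst: "fst ` set ring_pairs = joined_out"
proof (intro equalityI subsetI)
  fix x assume "x \<in> fst ` set ring_pairs"
  then obtain i s t where "i < k" "(s, t) \<in> set (qs i)" "x = Inl (i, s)" by (auto simp: set_ring_pairs)
  moreover have "s \<in> fst ` set (qs i)" using imageI[OF calculation(2), of fst] by simp
  ultimately show "x \<in> joined_out" using qs_props(2) by (auto simp: joined_out_def)
next
  fix x assume "x \<in> joined_out"
  then obtain i s where i: "x = Inl (i, Inr s)" "i < k" "s \<in> out (B i)" by (auto simp: joined_out_def)
  hence "Inr s \<in> fst ` set (qs i)" using qs_props(2) by auto
  then obtain t where "(Inr s, t) \<in> set (qs i)" by auto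
  hence "(Inl (i, Inr s), Inl (Suc i mod k, t)) \<in> set ring_pairs" using i by (auto simp: set_ring_pairs)
  thus "x \<in> fst ` set ring_pairs" using imageI[of _ _ fst] i by force
qed

lemma ring_pairs_snd: "snd ` set ring_pairs = joined_in"
proof (intro equalityI subsetI)
  fix x assume "x \<in> snd ` set ring_pairs"
  then obtain i s t where i: "i < k" "(s, t) \<in> set (qs i)" "x = Inl (Suc i mod k, t)" by (auto simp: set_ring_pairs)
  have "t \<in> snd ` set (qs i)" using imageI[OF i(2), of snd] by simp
  moreover have "Suc i mod k < k" using k by simp
  ultimately show "x \<in> joined_in"
    using qs_props(4)[OF i(1)] i by (auto simp: joined_in_def)
next
  fix x assume "x \<in> joined_in"
  then obtain i s where i: "x = Inl (i, Inl s)" "i < k" "s \<in> inp (D i)" by (auto simp: joined_in_def)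
  obtain j where j: "j < k" "Suc j mod k = i" using Suc_mod_surj i by blast
  hence "Inl s \<in> snd ` set (qs j)" using qs_props(4)[OF j(1)] i by auto
  then obtain t where "(t, Inl s) \<in> set (qs j)" by auto
  hence "(Inl (j, t), Inl (i, Inl s)) \<in> set ring_pairs" using j by (auto simp: set_ring_pairs)
  thus "x \<in> snd ` set ring_pairs" using imageI[of _ _ snd] i by force
qed

text \<open>First components are outputs of poles \<open>B i\<close>, second ones inputs of poles
  \<open>D i\<close>, so they differ. Within each kind the index separates different fragments, the
  successor modulo \<open>k\<close> being injective.\<close>

lemma distinct_ring_pairs: "distinct (map fst ring_pairs @ map snd ring_pairs)"
proof -
  have f: "map fst ring_pairs = concat (map (\<lambda>i. map (\<lambda>s. Inl (i, s)) (map fst (qs i))) [0..<k])"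
    unfolding ring_pairs_def map_concat by (simp add: comp_def case_prod_unfold)
  have s: "map snd ring_pairs = concat (map (\<lambda>i. map (\<lambda>s. Inl (Suc i mod k, s)) (map snd (qs i))) [0..<k])"
    unfolding ring_pairs_def map_concat by (simp add: comp_def case_prod_unfold)
  have "distinct (map fst ring_pairs)"
    unfolding f
  proof (rule distinct_concat_map)
    show "distinct (map (\<lambda>s. Inl (i, s)) (map fst (qs i)))" if "i \<in> set [0..<k]" for i
      unfolding distinct_map[of "\<lambda>s. Inl (i, s)"] using that qs_props(1)[of i] by (auto simp: inj_on_def)
  qed auto
  moreover have "distinct (map snd ring_pairs)"
    unfolding s
  proof (rule distinct_concat_map)
    show "distinct (map (\<lambda>s. Inl (Suc i mod k, s)) (map snd (qs i)))" if "i \<in> set [0..<k]" for i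
      unfolding distinct_map[of "\<lambda>s. Inl (Suc i mod k, s)"]
      using that qs_props(3)[of i] by (auto simp: inj_on_def)
  qed (auto dest: Suc_mod_inj)
  moreover have "set (map fst ring_pairs) \<inter> set (map snd ring_pairs) = {}"
    unfolding set_map ring_pairs_fst ring_pairs_snd by (auto simp: joined_defs)
  ultimately show ?thesis by simp
qed

lemma joined_eq: "joined = fst ` set ring_pairs \<union> snd ` set ring_pairs"
  by (simp add: ring_pairs_fst ring_pairs_snd joined_def)

text \<open>\<open>mate (D i) s\<close> is no semiedge, in particular not in
  \<open>out (D i)\<close>, so the inner join leaves the edge of \<open>s\<close> alone.\<close>

lemma F_mate_in:
  assumes i: "i < k" and s: "s \<in> inp (D i)"
  shows "mate (F i) (Inl s) = Inl (mate (D i) s)"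
proof -
  interpret fragment "D i" "B i" "ps i" by (rule frag[OF i])
  have "s \<in> semiedges (D i)" using s D.semiedgesE(1) by auto
  thus ?thesis using DB_props(6)[of s] D.mate_semiedge[of s] D.semiedgesE(1) D.semiedge_ends by auto
qed

lemma F_mate_out:
  assumes i: "i < k" and s: "s \<in> out (B i) \<union> res (B i)"
  shows "mate (F i) (Inr s) = Inr (mate (B i) s)"
proof -
  interpret fragment "D i" "B i" "ps i" by (rule frag[OF i])
  have "s \<in> semiedges (B i)" using s B.semiedgesE(1) by auto
  thus ?thesis using DB_props(7)[of s] B.mate_semiedge[of s] B.semiedgesE(1) B.semiedge_ends by auto
qed

lemma joined_ends: "joined \<subseteq> ends A"
proof
  fix x assume "x \<in> joined"
  then consider i s where "x = Inl (i, Inr s)" "i < k" "s \<in> out (B i)"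
    | i s where "x = Inl (i, Inl s)" "i < k" "s \<in> inp (D i)" by (auto simp: joined_defs)
  thus "x \<in> ends A"
  proof cases
    case 1
    interpret fragment "D i" "B i" "ps i" by (rule frag[OF 1(2)])
    show ?thesis using 1 DB_props(2) B.semiedgesE B.semiedge_ends[of s] by (auto simp: A_simps)
  next
    case 2
    interpret fragment "D i" "B i" "ps i" by (rule frag[OF 2(2)])
    show ?thesis using 2 DB_props(2) D.semiedgesE D.semiedge_ends[of s] by (auto simp: A_simps)
  qed
qed

lemma joined_mates: "mate A ` joined \<inter> joined = {}"
proof -
  have "mate A x \<notin> joined" if "x \<in> joined" for x
  proof -
    from that consider i s where "x = Inl (i, Inr s)" "i < k" "s \<in> out (B i)"
      | i s where "x = Inl (i, Inl s)" "i < k" "s \<in> inp (D i)" by (auto simp: joined_defs)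
    thus ?thesis
    proof cases
      case 1
      interpret B: good_pole 1 "B i" by (rule goodB[OF 1(2)])
      show ?thesis using 1 F_mate_out[of i s] B.mate_semiedge[of s] B.semiedgesE(1)
        by (auto simp: A_simps joined_defs)
    next
      case 2
      interpret D: good_pole 0 "D i" by (rule goodD[OF 2(2)])
      show ?thesis using 2 F_mate_in[of i s] D.mate_semiedge[of s] D.semiedgesE(1)
        by (auto simp: A_simps joined_defs)
    qed
  qed
  thus ?thesis by blast
qed

lemmas H_junctions = junctions_props[OF multipole_A distinct_ring_pairs joined_eq joined_ends joined_mates, folded H_eq]

section \<open>Ends, incidences and mates in \<open>H\<close>\<close>

text \<open>Every semiedge of \<open>D i\<close> is consumed, the outputs by the inner junctions and
  the inputs by the outer ones.\<close>

lemma H_end_D: "Inl (i, Inl d) \<in> ends H \<longleftrightarrow> i < k \<and> d \<in> ends (D i) \<and> inc (D i) d \<noteq> None"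
proof (cases "i < k")
  case True
  interpret fragment "D i" "B i" "ps i" by (rule frag[OF True])
  have "d \<in> semiedges (D i) \<longleftrightarrow> d \<in> inp (D i) \<union> out (D i)"
    unfolding D.semiedgesE(1) res_D by blast
  hence "d \<in> ends (D i) \<and> inc (D i) d = None \<longleftrightarrow> d \<in> inp (D i) \<union> out (D i)"
    by (simp only: semiedges_def mem_Collect_eq)
  moreover have "Inl (i, Inl d) \<in> ends A \<longleftrightarrow> d \<in> ends (D i) - out (D i)"
    using True DB_props(2) by (simp add: A_simps(2) Plus_iffs)
  moreover have "Inl (i, Inl d) \<in> joined \<longleftrightarrow> d \<in> inp (D i)" using True by (simp add: joined_defs)
  ultimately show ?thesis using True unfolding H_junctions(3) Diff_iff Un_iff by argo
qed (simp add: H_junctions(3) A_simps Plus_iffs)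

text \<open>Here the residual semiedge survives: it has become an end at a vertex of the
  tree.\<close>

lemma H_end_B:
  "Inl (i, Inr d) \<in> ends H \<longleftrightarrow> i < k \<and> d \<in> ends (B i) \<and> (inc (B i) d \<noteq> None \<or> d \<in> res (B i))"
proof (cases "i < k")
  case True
  interpret fragment "D i" "B i" "ps i" by (rule frag[OF True])
  have "d \<in> semiedges (B i) \<longleftrightarrow> d \<in> inp (B i) \<union> out (B i) \<union> res (B i)"
    unfolding B.semiedgesE(1) by blast
  hence "d \<in> ends (B i) \<and> inc (B i) d = None \<longleftrightarrow> d \<in> inp (B i) \<union> out (B i) \<union> res (B i)"
    by (simp only: semiedges_def mem_Collect_eq)
  moreover have "Inl (i, Inr d) \<in> ends A \<longleftrightarrow> d \<in> ends (B i) - inp (B i)"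
    using True DB_props(2) by (simp add: A_simps(2) Plus_iffs)
  moreover have "Inl (i, Inr d) \<in> joined \<longleftrightarrow> d \<in> out (B i)" using True by (simp add: joined_defs)
  moreover have "\<not> (d \<in> inp (B i) \<and> d \<in> res (B i))" "\<not> (d \<in> out (B i) \<and> d \<in> res (B i))"
    using B.semiedgesE(3,4) by blast+
  ultimately show ?thesis using True unfolding H_junctions(3) Diff_iff Un_iff by argo
qed (simp add: H_junctions(3) A_simps Plus_iffs)

lemma H_end_T: "Inr t \<in> ends H \<longleftrightarrow> t \<in> ends S'"
  by (auto simp: H_junctions(3) A_simps joined_defs)

lemma H_inc_D: "i < k \<Longrightarrow> inc H (Inl (i, Inl d)) = map_option (\<lambda>x. Inl (i, Inl x)) (inc (D i) d)"
  using fragment.DB_props(3)[OF frag, of i] fragment.F_connectors(3)[OF frag, of i]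
  by (auto simp: H_junctions(2) A_simps option.map_comp o_def)

lemma H_inc_B: "i < k \<Longrightarrow> inc H (Inl (i, Inr d)) =
    (if d \<in> res (B i) then Some (Inr (tn i)) else map_option (\<lambda>x. Inl (i, Inr x)) (inc (B i) d))"
  using fragment.DB_props(3)[OF frag, of i] fragment.F_connectors(3)[OF frag, of i]
  by (auto simp: H_junctions(2) A_simps option.map_comp o_def)

lemma H_inc_T: "inc H (Inr t) = map_option Inr (inc S t)"
  by (simp add: H_junctions(2) A_simps)

lemma H_verts: "verts H = (SIGMA i:{..<k}. verts (D i) <+> verts (B i)) <+> (verts S - leaves S)"
  using fragment.DB_props(1)[OF frag] by (auto simp: H_junctions(1) A_simps)

lemma multipole_H: "multipole H"
  by (rule H_junctions(6))

lemma graph_H: "graph H"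
proof -
  have "inc H d \<noteq> None" if "d \<in> ends H" for d
  proof (cases d)
    case (Inl e)
    obtain i f where e: "e = (i, f)" by (cases e)
    show ?thesis
    proof (cases f)
      case (Inl g)
      thus ?thesis using that \<open>d = Inl e\<close> e H_end_D[of i g] H_inc_D[of i g] by auto
    next
      case (Inr g)
      thus ?thesis using that \<open>d = Inl e\<close> e H_end_B[of i g] H_inc_B[of i g] by auto
    qed
  next
    case (Inr t)
    thus ?thesis using that graph_S(1) by (auto simp: H_end_T H_inc_T graph_def semiedges_def)
  qed
  thus ?thesis using multipole_H by (auto simp: graph_def semiedges_def)
qed

lemma mate_A_D:
  assumes "i < k" "d \<in> ends (D i)" "mate (D i) d \<notin> out (D i)"
  shows "mate A (Inl (i, Inl d)) = Inl (i, Inl (mate (D i) d))"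
  using fragment.DB_props(6)[OF frag[OF assms(1)] assms(2,3)] by (simp add: A_simps)

lemma mate_A_B:
  assumes "i < k" "d \<in> ends (B i)" "mate (B i) d \<notin> inp (B i)"
  shows "mate A (Inl (i, Inr d)) = Inl (i, Inr (mate (B i) d))"
  using fragment.DB_props(7)[OF frag[OF assms(1)] assms(2,3)] by (simp add: A_simps)

lemma A_end_D: "i < k \<Longrightarrow> d \<in> ends (D i) \<Longrightarrow> inc (D i) d \<noteq> None \<Longrightarrow> Inl (i, Inl d) \<in> ends A"
  and A_end_B: "i < k \<Longrightarrow> e \<in> ends (B i) \<Longrightarrow> inc (B i) e \<noteq> None \<or> e \<in> res (B i) \<Longrightarrow> Inl (i, Inr e) \<in> ends A"
  using H_end_D[of i d] H_end_B[of i e] H_junctions(3) by auto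

lemma H_mate_D:
  assumes i: "i < k" and d: "d \<in> ends (D i)" "inc (D i) d = Some x" "inc (D i) (mate (D i) d) = Some y"
  shows "mate H (Inl (i, Inl d)) = Inl (i, Inl (mate (D i) d))"
proof -
  interpret D: good_pole 0 "D i" by (rule goodD[OF i])
  have n: "mate (D i) d \<notin> inp (D i)" "mate (D i) d \<notin> out (D i)"
    using d(3) D.connector_inc by fastforce+
  have "mate A (Inl (i, Inl d)) = Inl (i, Inl (mate (D i) d))" by (rule mate_A_D[OF i d(1) n(2)])
  thus ?thesis using H_junctions(5)[OF A_end_D[OF i d(1)]] d(2) n by (auto simp: joined_defs)
qed

lemma H_mate_B:
  assumes i: "i < k" and d: "d \<in> ends (B i)" "inc (B i) d \<noteq> None \<or> d \<in> res (B i)"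
    "mate (B i) d \<notin> inp (B i) \<union> out (B i)"
  shows "mate H (Inl (i, Inr d)) = Inl (i, Inr (mate (B i) d))"
proof -
  have "mate A (Inl (i, Inr d)) = Inl (i, Inr (mate (B i) d))" by (rule mate_A_B[OF i d(1)]) (use d in auto)
  thus ?thesis using H_junctions(5)[OF A_end_B[OF i d(1,2)]] d(3) by (auto simp: joined_defs)
qed

lemma H_mate_T: "t \<in> ends S' \<Longrightarrow> mate H (Inr t) = Inr (mate S t)"
  using H_junctions(5)[of "Inr t"] by (auto simp: A_simps joined_defs)

text \<open>Both ends of the new edge sit at vertices, so they are not among the ends consumed by
  the outer junctions.\<close>

lemma H_mate_inner_pair:
  assumes i: "i < k" and st: "(s, t) \<in> set (ps i)"
  shows "mate H (Inl (i, Inl (mate (D i) s))) = Inl (i, Inr (mate (B i) t))"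
    "mate H (Inl (i, Inr (mate (B i) t))) = Inl (i, Inl (mate (D i) s))"
proof -
  interpret fragment "D i" "B i" "ps i" by (rule frag[OF i])
  have "s \<in> out (D i)" "t \<in> inp (B i)"
    using pair imageI[OF st, of fst] imageI[OF st, of snd] by (auto simp: pairing_def)
  hence s: "s \<in> semiedges (D i)" and t: "t \<in> semiedges (B i)"
    using D.semiedgesE(1) B.semiedgesE(1) by auto
  obtain x where x: "inc (D i) (mate (D i) s) = Some x" "x \<in> verts (D i)" "mate (D i) s \<in> ends (D i)"
    "mate (D i) (mate (D i) s) = s" using D.mate_semiedge_inc[OF s] .
  obtain y where y: "inc (B i) (mate (B i) t) = Some y" "y \<in> verts (B i)" "mate (B i) t \<in> ends (B i)"
    "mate (B i) (mate (B i) t) = t" using B.mate_semiedge_inc[OF t] .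
  have a: "mate A (Inl (i, Inl (mate (D i) s))) = Inl (i, Inr (mate (B i) t))"
    "mate A (Inl (i, Inr (mate (B i) t))) = Inl (i, Inl (mate (D i) s))"
    using DB_props(5)[OF st] by (simp_all add: A_simps)
  have n: "mate (D i) s \<notin> inp (D i)" "mate (B i) t \<notin> out (B i)"
    using x y D.connector_inc B.connector_inc by fastforce+
  show "mate H (Inl (i, Inl (mate (D i) s))) = Inl (i, Inr (mate (B i) t))"
    using H_junctions(5)[OF A_end_D[OF i x(3)]] x n a by (auto simp: joined_defs)
  show "mate H (Inl (i, Inr (mate (B i) t))) = Inl (i, Inl (mate (D i) s))"
    using H_junctions(5)[OF A_end_B[OF i y(3)]] y n a by (auto simp: joined_defs)
qed

lemma H_mate_outer_pair:
  assumes i: "i < k" and st: "(Inr s, Inl t) \<in> set (qs i)"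
  shows "mate H (Inl (i, Inr (mate (B i) s))) = Inl (Suc i mod k, Inl (mate (D (Suc i mod k)) t))"
    "mate H (Inl (Suc i mod k, Inl (mate (D (Suc i mod k)) t))) = Inl (i, Inr (mate (B i) s))"
proof -
  let ?j = "Suc i mod k"
  have j: "?j < k" using k by simp
  have "Inr s \<in> fst ` set (qs i)" "Inl t \<in> snd ` set (qs i)"
    using imageI[OF st, of fst] imageI[OF st, of snd] by simp_all
  hence s: "s \<in> out (B i)" and t: "t \<in> inp (D ?j)"
    unfolding qs_props(2)[OF i] qs_props(4)[OF i] by auto
  have "(Inl (i, Inr s), Inl (?j, Inl t)) \<in> set ring_pairs" using st i by (auto simp: set_ring_pairs)
  from H_junctions(4)[OF this] F_mate_out[OF i, of s] F_mate_in[OF j t] s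
  show "mate H (Inl (i, Inr (mate (B i) s))) = Inl (?j, Inl (mate (D ?j) t))"
    "mate H (Inl (?j, Inl (mate (D ?j) t))) = Inl (i, Inr (mate (B i) s))"
    by (simp_all add: A_simps)
qed

lemma H_mate_out_D:
  assumes "i < k" "s \<in> out (D i)"
  shows "\<exists>t\<in>inp (B i). mate H (Inl (i, Inl (mate (D i) s))) = Inl (i, Inr (mate (B i) t))"
  using fragment.pairs_ex(1)[OF frag[OF assms(1)] assms(2)] H_mate_inner_pair(1)[OF assms(1)] by blast

lemma H_mate_in_B:
  assumes "i < k" "t \<in> inp (B i)"
  shows "\<exists>s\<in>out (D i). mate H (Inl (i, Inr (mate (B i) t))) = Inl (i, Inl (mate (D i) s))"
  using fragment.pairs_ex(2)[OF frag[OF assms(1)] assms(2)] H_mate_inner_pair(2)[OF assms(1)] by blast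

lemma H_mate_out_B:
  assumes i: "i < k" and s: "s \<in> out (B i)"
  shows "\<exists>t\<in>inp (D (Suc i mod k)).
    mate H (Inl (i, Inr (mate (B i) s))) = Inl (Suc i mod k, Inl (mate (D (Suc i mod k)) t))"
proof -
  have "Inr s \<in> fst ` set (qs i)" unfolding qs_props(2)[OF i] using s by (rule imageI)
  then obtain q where q: "(Inr s, q) \<in> set (qs i)" by (elim imageE) (metis prod.collapse)
  have "q \<in> Inl ` inp (D (Suc i mod k))"
    using imageI[OF q, of snd] unfolding qs_props(4)[OF i] by simp
  then obtain t where "t \<in> inp (D (Suc i mod k))" "q = Inl t" by auto
  thus ?thesis using H_mate_outer_pair(1)[OF i, of s t] q by auto
qed

lemma H_mate_in_D:
  assumes i: "i < k" and t: "t \<in> inp (D i)"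
  shows "\<exists>j<k. Suc j mod k = i \<and> (\<exists>s\<in>out (B j). mate H (Inl (i, Inl (mate (D i) t))) = Inl (j, Inr (mate (B j) s)))"
proof -
  obtain j where j: "j < k" "Suc j mod k = i" using Suc_mod_surj[OF i] by blast
  have "Inl t \<in> snd ` set (qs j)" unfolding qs_props(4)[OF j(1)] j(2) using t by (rule imageI)
  then obtain q where q: "(q, Inl t) \<in> set (qs j)" by (elim imageE) (metis prod.collapse)
  have "q \<in> Inr ` out (B j)"
    using imageI[OF q, of fst] unfolding qs_props(2)[OF j(1)] by simp
  then obtain s where "s \<in> out (B j)" "q = Inr s" by auto
  thus ?thesis using H_mate_outer_pair(2)[OF j(1), of s t] q j by auto
qed

end

section \<open>Links in a Halin snark\<close>

text \<open>These inequalities involve only \<open>nlinks\<close> and cardinalities, and each subset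
  of the image is the image of a subset of the same size.\<close>

lemma good_pole_image:
  assumes P: "good_pole r P" and f: "inj f"
    and nl: "\<And>Y Z. Y \<subseteq> verts P \<Longrightarrow> Z \<subseteq> verts P \<Longrightarrow> nlinks H (f ` Y) (f ` Z) = nlinks P Y Z"
  shows "Y \<subseteq> f ` verts P \<Longrightarrow> Y \<noteq> {} \<Longrightarrow> Y \<noteq> f ` verts P \<Longrightarrow> 2 \<le> nlinks H Y (f ` verts P - Y)"
    and "Y \<subseteq> f ` verts P \<Longrightarrow> 2 \<le> card Y \<Longrightarrow> nlinks H Y Y + 4 \<le> 3 * card Y"
    and "Y \<subseteq> f ` verts P \<Longrightarrow> Y \<noteq> {} \<Longrightarrow> card Y \<le> 4 \<Longrightarrow> nlinks H Y Y + 2 \<le> 2 * card Y"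
    and "x \<in> f ` verts P \<Longrightarrow> 2 \<le> nlinks H {x} (f ` verts P)"
proof -
  interpret good_pole r P by (rule P)
  have pre: "\<exists>Z\<subseteq>verts P. Y = f ` Z \<and> card Y = card Z" if "Y \<subseteq> f ` verts P" for Y
    using that f by (metis card_image inj_on_subset subset_UNIV subset_imageE)
  show "2 \<le> nlinks H Y (f ` verts P - Y)" if Y: "Y \<subseteq> f ` verts P" "Y \<noteq> {}" "Y \<noteq> f ` verts P" for Y
  proof -
    obtain Z where Z: "Z \<subseteq> verts P" "Y = f ` Z" using pre[OF Y(1)] by blast
    have "f ` verts P - Y = f ` (verts P - Z)" using Z f by (simp add: image_set_diff)
    moreover have "2 \<le> nlinks P Z (verts P - Z)" by (rule split) (use Z Y in auto)
    ultimately show ?thesis using nl[of Z "verts P - Z"] Z by auto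
  qed
  show "nlinks H Y Y + 4 \<le> 3 * card Y" if Y: "Y \<subseteq> f ` verts P" "2 \<le> card Y" for Y
  proof -
    obtain Z where "Z \<subseteq> verts P" "Y = f ` Z" "card Y = card Z" using pre[OF Y(1)] by blast
    thus ?thesis using nl[of Z Z] cut[of Z] Y(2) by simp
  qed
  show "nlinks H Y Y + 2 \<le> 2 * card Y" if Y: "Y \<subseteq> f ` verts P" "Y \<noteq> {}" "card Y \<le> 4" for Y
  proof -
    obtain Z where "Z \<subseteq> verts P" "Y = f ` Z" "card Y = card Z" using pre[OF Y(1)] by blast
    thus ?thesis using nl[of Z Z] small[of Z] Y(2,3) by simp
  qed
  show "2 \<le> nlinks H {x} (f ` verts P)" if x: "x \<in> f ` verts P" for x
  proof -
    obtain y where "y \<in> verts P" "x = f y" using x by auto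
    thus ?thesis using nl[of "{y}" "verts P"] deg[of y] by simp
  qed
qed

context halin_ring begin

lemma semiedge_mate_D:
  assumes j: "j < k" and s: "s \<in> semiedges (D j)"
  shows "\<exists>y\<in>verts (D j). Inl (j, Inl (mate (D j) s)) \<in> ends H \<and>
    inc H (Inl (j, Inl (mate (D j) s))) = Some (Inl (j, Inl y))"
proof -
  interpret D: good_pole 0 "D j" by (rule goodD[OF j])
  obtain y where "inc (D j) (mate (D j) s) = Some y" "y \<in> verts (D j)"
    "mate (D j) s \<in> ends (D j)" "mate (D j) (mate (D j) s) = s" using D.mate_semiedge_inc[OF s] .
  thus ?thesis using j H_inc_D[OF j] by (auto simp: H_end_D)
qed

lemma semiedge_mate_B:
  assumes j: "j < k" and s: "s \<in> semiedges (B j)"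
  shows "\<exists>y\<in>verts (B j). Inl (j, Inr (mate (B j) s)) \<in> ends H \<and>
    inc H (Inl (j, Inr (mate (B j) s))) = Some (Inl (j, Inr y))"
proof -
  interpret B: good_pole 1 "B j" by (rule goodB[OF j])
  obtain y where y: "inc (B j) (mate (B j) s) = Some y" "y \<in> verts (B j)"
    "mate (B j) s \<in> ends (B j)" "mate (B j) (mate (B j) s) = s" using B.mate_semiedge_inc[OF s] .
  have "mate (B j) s \<notin> res (B j)" using y(1) B.connector_inc by fastforce
  thus ?thesis using y j H_inc_B[OF j] by (auto simp: H_end_B)
qed

lemma semi_D: "j < k \<Longrightarrow> s \<in> inp (D j) \<union> out (D j) \<Longrightarrow> s \<in> semiedges (D j)"
  using good_pole.semiedgesE(1)[OF goodD] by blast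

lemma semi_B: "j < k \<Longrightarrow> s \<in> inp (B j) \<union> out (B j) \<union> res (B j) \<Longrightarrow> s \<in> semiedges (B j)"
  using good_pole.semiedgesE(1)[OF goodB] by blast

text \<open>The end \<open>mate (D i) d\<close> inside the pole tells where the edge goes: if it is
  at a vertex, the edge stays inside; an output leads to \<open>B i\<close>, an input to the
  preceding fragment. It is kept in the statement because the connector is what
  \<open>exit_D\<close> extracts.\<close>

lemma H_link_D:
  assumes h: "h \<in> ends H" "inc H h = Some (Inl (i, Inl x))"
  obtains d where "h = Inl (i, Inl d)" "i < k" "d \<in> ends (D i)" "inc (D i) d = Some x"
    and "(\<exists>y. inc (D i) (mate (D i) d) = Some y \<and> inc H (mate H h) = Some (Inl (i, Inl y))) \<or>
      (mate (D i) d \<in> out (D i) \<and> (\<exists>y\<in>verts (B i). inc H (mate H h) = Some (Inl (i, Inr y)))) \<or>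
      (mate (D i) d \<in> inp (D i) \<and>
        (\<exists>j<k. Suc j mod k = i \<and> (\<exists>y\<in>verts (B j). inc H (mate H h) = Some (Inl (j, Inr y)))))"
proof -
  let ?inner = "\<lambda>d. \<exists>y. inc (D i) (mate (D i) d) = Some y \<and> inc H (mate H h) = Some (Inl (i, Inl y))"
  let ?out = "\<lambda>d. mate (D i) d \<in> out (D i) \<and> (\<exists>y\<in>verts (B i). inc H (mate H h) = Some (Inl (i, Inr y)))"
  let ?inp = "\<lambda>d. mate (D i) d \<in> inp (D i) \<and>
    (\<exists>j<k. Suc j mod k = i \<and> (\<exists>y\<in>verts (B j). inc H (mate H h) = Some (Inl (j, Inr y))))"
  obtain d where hd: "h = Inl (i, Inl d)"
  proof (cases h)
    case (Inl e)
    obtain j f where e: "e = (j, f)" by (cases e)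
    show ?thesis
    proof (cases f)
      case (Inl g)
      thus ?thesis using that h \<open>h = Inl e\<close> e H_end_D[of j g] H_inc_D[of j g] by auto
    next
      case (Inr g)
      thus ?thesis using h \<open>h = Inl e\<close> e H_end_B[of j g] H_inc_B[of j g] by (auto split: if_splits)
    qed
  next
    case (Inr t)
    thus ?thesis using h H_inc_T[of t] by auto
  qed
  have i: "i < k" and d: "d \<in> ends (D i)" using h(1) H_end_D unfolding hd by blast+
  have dx: "inc (D i) d = Some x" using h(2) H_inc_D[OF i, of d] unfolding hd by auto
  interpret D: good_pole 0 "D i" by (rule goodD[OF i])
  have d': "mate (D i) d \<in> ends (D i)" "mate (D i) (mate (D i) d) = d" using multipoleD(3,5)[OF D.mult d] .
  show ?thesis
  proof (rule that[OF hd i d dx], cases "inc (D i) (mate (D i) d)")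
    case (Some y)
    hence "inc H (mate H h) = Some (Inl (i, Inl y))"
      using H_mate_D[OF i d dx Some] H_inc_D[OF i] by (simp add: hd)
    thus "?inner d \<or> ?out d \<or> ?inp d"
      using Some by blast
  next
    case None
    from D.semiedge_cases[OF d'(1) None] D.semiedgesE(1,7) fragment.res_D[OF frag[OF i]]
    consider "mate (D i) d \<in> out (D i)" | "mate (D i) d \<in> inp (D i)" by fastforce
    thus "?inner d \<or> ?out d \<or> ?inp d"
    proof cases
      case 1
      obtain t where "t \<in> inp (B i)" "mate H h = Inl (i, Inr (mate (B i) t))"
        using H_mate_out_D[OF i 1] d'(2) hd by auto
      thus ?thesis using 1 semiedge_mate_B[OF i semi_B[OF i], of t] by auto
    next
      case 2
      obtain j s where j: "j < k" "Suc j mod k = i" "s \<in> out (B j)" "mate H h = Inl (j, Inr (mate (B j) s))"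
        using H_mate_in_D[OF i 2] d'(2) hd by auto
      hence "\<exists>y\<in>verts (B j). inc H (mate H h) = Some (Inl (j, Inr y))"
        using semiedge_mate_B[OF j(1) semi_B[OF j(1)], of s] by auto
      thus ?thesis using 2 j(1,2) by blast
    qed
  qed
qed

text \<open>As for \<open>H_link_D\<close>, with the residual semiedge as a fourth case leading to
  the tree.\<close>

lemma H_link_B:
  assumes h: "h \<in> ends H" "inc H h = Some (Inl (i, Inr x))"
  obtains d where "h = Inl (i, Inr d)" "i < k" "d \<in> ends (B i)" "inc (B i) d = Some x"
    and "(\<exists>y. inc (B i) (mate (B i) d) = Some y \<and> inc H (mate H h) = Some (Inl (i, Inr y))) \<or>
      (mate (B i) d \<in> inp (B i) \<and> (\<exists>y\<in>verts (D i). inc H (mate H h) = Some (Inl (i, Inl y)))) \<or>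
      (mate (B i) d \<in> out (B i) \<and>
        (\<exists>y\<in>verts (D (Suc i mod k)). inc H (mate H h) = Some (Inl (Suc i mod k, Inl y)))) \<or>
      (mate (B i) d \<in> res (B i) \<and> inc H (mate H h) = Some (Inr (tn i)))"
proof -
  let ?inner = "\<lambda>d. \<exists>y. inc (B i) (mate (B i) d) = Some y \<and> inc H (mate H h) = Some (Inl (i, Inr y))"
  let ?inp = "\<lambda>d. mate (B i) d \<in> inp (B i) \<and> (\<exists>y\<in>verts (D i). inc H (mate H h) = Some (Inl (i, Inl y)))"
  let ?out = "\<lambda>d. mate (B i) d \<in> out (B i) \<and>
    (\<exists>y\<in>verts (D (Suc i mod k)). inc H (mate H h) = Some (Inl (Suc i mod k, Inl y)))"
  let ?res = "\<lambda>d. mate (B i) d \<in> res (B i) \<and> inc H (mate H h) = Some (Inr (tn i))"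
  obtain d where hd: "h = Inl (i, Inr d)"
  proof (cases h)
    case (Inl e)
    obtain j f where e: "e = (j, f)" by (cases e)
    show ?thesis
    proof (cases f)
      case (Inl g)
      thus ?thesis using h \<open>h = Inl e\<close> e H_end_D[of j g] H_inc_D[of j g] by auto
    next
      case (Inr g)
      thus ?thesis using that h \<open>h = Inl e\<close> e H_end_B[of j g] H_inc_B[of j g] by (auto split: if_splits)
    qed
  next
    case (Inr t)
    thus ?thesis using h H_inc_T[of t] by auto
  qed
  have i: "i < k" and d: "d \<in> ends (B i)" using h(1) H_end_B unfolding hd by blast+
  have dx: "inc (B i) d = Some x" using h(2) H_inc_B[OF i, of d] unfolding hd by (auto split: if_splits)
  interpret B: good_pole 1 "B i" by (rule goodB[OF i])
  have d': "mate (B i) d \<in> ends (B i)" "mate (B i) (mate (B i) d) = d" using multipoleD(3,5)[OF B.mult d] .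
  show ?thesis
  proof (rule that[OF hd i d dx], cases "inc (B i) (mate (B i) d)")
    case (Some y)
    hence n: "mate (B i) d \<notin> inp (B i) \<union> out (B i)" "mate (B i) d \<notin> res (B i)"
      using B.connector_inc by fastforce+
    have "mate H h = Inl (i, Inr (mate (B i) d))"
      unfolding hd by (rule H_mate_B[OF i d _ n(1)]) (simp add: dx)
    hence "inc H (mate H h) = Some (Inl (i, Inr y))" using H_inc_B[OF i] n(2) Some by simp
    thus "?inner d \<or> ?inp d \<or> ?out d \<or> ?res d" using Some by blast
  next
    case None
    have Si: "Suc i mod k < k" using k by simp
    from B.semiedge_cases[OF d'(1) None]
    consider "mate (B i) d \<in> inp (B i)" | "mate (B i) d \<in> out (B i)" | "mate (B i) d \<in> res (B i)" by blast
    thus "?inner d \<or> ?inp d \<or> ?out d \<or> ?res d"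
    proof cases
      case 1
      obtain t where "t \<in> out (D i)" "mate H h = Inl (i, Inl (mate (D i) t))"
        using H_mate_in_B[OF i 1] d'(2) hd by auto
      thus ?thesis using 1 semiedge_mate_D[OF i semi_D[OF i], of t] by auto
    next
      case 2
      obtain t where "t \<in> inp (D (Suc i mod k))" "mate H h = Inl (Suc i mod k, Inl (mate (D (Suc i mod k)) t))"
        using H_mate_out_B[OF i 2] d'(2) hd by auto
      thus ?thesis using 2 semiedge_mate_D[OF Si semi_D[OF Si], of t] by auto
    next
      case 3
      have "mate H h = Inl (i, Inr (mate (B i) d))"
        unfolding hd by (rule H_mate_B[OF i d]) (use dx 3 B.semiedgesE in auto)
      hence "inc H (mate H h) = Some (Inr (tn i))" using H_inc_B[OF i] 3 by simp
      thus ?thesis using 3 by blast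
    qed
  qed
qed

text \<open>Attaching changed the incidence of residual ends only, so these are the only newcomers
  at the tree.\<close>

lemma H_link_T:
  assumes h: "h \<in> ends H" "inc H h = Some (Inr t)"
  obtains d where "h = Inr d" "d \<in> ends S'" "inc S d = Some t" "mate H h = Inr (mate S d)"
  | i r where "h = Inl (i, Inr r)" "i < k" "r \<in> res (B i)" "t = tn i"
proof (cases h)
  case (Inl e)
  obtain j f where e: "e = (j, f)" by (cases e)
  show ?thesis
  proof (cases f)
    case (Inl g)
    thus ?thesis using h \<open>h = Inl e\<close> e H_end_D[of j g] H_inc_D[of j g] by auto
  next
    case (Inr g)
    have hg: "h = Inl (j, Inr g)" using \<open>h = Inl e\<close> e Inr by simp
    have j: "j < k" using h(1) H_end_B unfolding hg by blast
    show ?thesis using that(2)[OF hg j] h(2) H_inc_B[OF j, of g] unfolding hg by (auto split: if_splits)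
  qed
next
  case (Inr d)
  have d: "d \<in> ends S'" using h(1) H_end_T unfolding Inr by blast
  have "inc S d = Some t" using h(2) H_inc_T unfolding Inr by auto
  thus ?thesis using that(1)[OF Inr d] H_mate_T[OF d] by (simp add: Inr)
qed

text \<open>Every junction links two different poles, so inside a pole no edge is gained or
  lost.\<close>

lemma nlinks_H_D:
  assumes i: "i < k" and YZ: "Y \<subseteq> verts (D i)" "Z \<subseteq> verts (D i)"
  shows "nlinks H ((\<lambda>x. Inl (i, Inl x)) ` Y) ((\<lambda>x. Inl (i, Inl x)) ` Z) = nlinks (D i) Y Z"
proof -
  have "links H ((\<lambda>x. Inl (i, Inl x)) ` Y) ((\<lambda>x. Inl (i, Inl x)) ` Z) = (\<lambda>d. Inl (i, Inl d)) ` links (D i) Y Z"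
    (is "?L = ?R")
  proof (intro equalityI subsetI)
    fix h assume "h \<in> ?L"
    then obtain x y where h: "h \<in> ends H" "inc H h = Some (Inl (i, Inl x))" "x \<in> Y"
      "inc H (mate H h) = Some (Inl (i, Inl y))" "y \<in> Z" by (auto simp: links_def)
    show "h \<in> ?R"
      by (rule H_link_D[OF h(1,2)]) (use h(3-5) in \<open>auto simp: links_def\<close>)
  next
    fix h assume "h \<in> ?R"
    then obtain d x y where d: "h = Inl (i, Inl d)" "d \<in> ends (D i)" "inc (D i) d = Some x" "x \<in> Y"
      "inc (D i) (mate (D i) d) = Some y" "y \<in> Z" by (auto simp: links_def)
    thus "h \<in> ?L" using i H_mate_D[OF i d(2,3,5)] by (auto simp: links_def H_end_D H_inc_D)
  qed
  thus ?thesis unfolding nlinks_def by (simp add: card_image inj_on_def)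
qed

lemma nlinks_H_B:
  assumes i: "i < k" and YZ: "Y \<subseteq> verts (B i)" "Z \<subseteq> verts (B i)"
  shows "nlinks H ((\<lambda>x. Inl (i, Inr x)) ` Y) ((\<lambda>x. Inl (i, Inr x)) ` Z) = nlinks (B i) Y Z"
proof -
  have "links H ((\<lambda>x. Inl (i, Inr x)) ` Y) ((\<lambda>x. Inl (i, Inr x)) ` Z) = (\<lambda>d. Inl (i, Inr d)) ` links (B i) Y Z"
    (is "?L = ?R")
  proof (intro equalityI subsetI)
    fix h assume "h \<in> ?L"
    then obtain x y where h: "h \<in> ends H" "inc H h = Some (Inl (i, Inr x))" "x \<in> Y"
      "inc H (mate H h) = Some (Inl (i, Inr y))" "y \<in> Z" by (auto simp: links_def)
    show "h \<in> ?R"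
      by (rule H_link_B[OF h(1,2)]) (use h(3-5) in \<open>auto simp: links_def\<close>)
  next
    fix h assume "h \<in> ?R"
    then obtain d x y where d: "h = Inl (i, Inr d)" "d \<in> ends (B i)" "inc (B i) d = Some x" "x \<in> Y"
      "inc (B i) (mate (B i) d) = Some y" "y \<in> Z" by (auto simp: links_def)
    have n: "d \<notin> res (B i)" "mate (B i) d \<notin> inp (B i) \<union> out (B i)" "mate (B i) d \<notin> res (B i)"
      using good_pole.connector_inc[OF goodB[OF i], of d]
        good_pole.connector_inc[OF goodB[OF i], of "mate (B i) d"] d(3,5) by auto
    have "mate H h = Inl (i, Inr (mate (B i) d))"
      unfolding d(1) by (rule H_mate_B[OF i d(2) _ n(2)]) (simp add: d)
    thus "h \<in> ?L" using i d n by (auto simp: links_def H_end_B H_inc_B)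
  qed
  thus ?thesis unfolding nlinks_def by (simp add: card_image inj_on_def)
qed

text \<open>At a vertex of the tree the degree is kept because each edge to a leaf
  \<open>v i\<close>, lost with the leaf, is replaced by the residual edge of fragment
  \<open>i\<close>. The other vertices keep their ends from the poles.\<close>

lemma cubic_H: "cubic_graph H"
proof -
  have "valency H x = 3" if x: "x \<in> verts H" for x
  proof -
    from x consider i y where "x = Inl (i, Inl y)" "i < k" "y \<in> verts (D i)"
      | i y where "x = Inl (i, Inr y)" "i < k" "y \<in> verts (B i)"
      | t where "x = Inr t" "t \<in> verts S - leaves S"
      by (auto simp: H_verts)
    thus ?thesis
    proof cases
      case (1 i y)
      have "ends_at H x = (\<lambda>d. Inl (i, Inl d)) ` ends_at (D i) y" (is "?L = ?R")
      proof (intro equalityI subsetI)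
        fix h assume "h \<in> ?L"
        hence "h \<in> ends H" "inc H h = Some (Inl (i, Inl y))" by (auto simp: ends_at_def 1)
        then obtain d where "h = Inl (i, Inl d)" "d \<in> ends (D i)" "inc (D i) d = Some y"
          by (rule H_link_D)
        thus "h \<in> ?R" by (auto simp: ends_at_def)
      qed (use 1 in \<open>auto simp: ends_at_def H_end_D H_inc_D\<close>)
      moreover have "valency (D i) y = 3"
        using good_pole.pole[OF goodD[OF 1(2)]] 1(3) by (simp add: pole_22_def cubic_def)
      ultimately show ?thesis by (simp add: valency_def card_image inj_on_def)
    next
      case (2 i y)
      have "ends_at H x = (\<lambda>d. Inl (i, Inr d)) ` ends_at (B i) y" (is "?L = ?R")
      proof (intro equalityI subsetI)
        fix h assume "h \<in> ?L"
        hence "h \<in> ends H" "inc H h = Some (Inl (i, Inr y))" by (auto simp: ends_at_def 2)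
        then obtain d where "h = Inl (i, Inr d)" "d \<in> ends (B i)" "inc (B i) d = Some y"
          by (rule H_link_B)
        thus "h \<in> ?R" by (auto simp: ends_at_def)
      next
        fix h assume "h \<in> ?R"
        then obtain d where d: "h = Inl (i, Inr d)" "d \<in> ends (B i)" "inc (B i) d = Some y"
          by (auto simp: ends_at_def)
        have "d \<notin> res (B i)" using good_pole.connector_inc[OF goodB[OF 2(2)], of d] d(3) by auto
        thus "h \<in> ?L" using 2 d by (auto simp: ends_at_def H_end_B H_inc_B)
      qed
      moreover have "valency (B i) y = 3"
        using good_pole.pole[OF goodB[OF 2(2)]] 2(3) by (simp add: pole_22_def cubic_def)
      ultimately show ?thesis by (simp add: valency_def card_image inj_on_def)
    next
      case (3 t)
      have M: "multipole S" by (rule graph_S(2))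
      have "\<forall>i. \<exists>r. i < k \<longrightarrow> res (B i) = {r}"
        using good_pole.semiedgesE(7)[OF goodB] by (metis card_1_singletonE)
      then obtain r where r: "\<And>i. i < k \<Longrightarrow> res (B i) = {r i}" by metis
      have "\<forall>i. \<exists>e. i < k \<longrightarrow> ends_at S (v i) = {e} \<and> inc S (mate S e) = Some (tn i)"
        using tree_leaf[OF S(1,3) leaf] by metis
      then obtain e where e: "\<And>i. i < k \<Longrightarrow> ends_at S (v i) = {e i}"
        "\<And>i. i < k \<Longrightarrow> inc S (mate S (e i)) = Some (tn i)" by metis
      have ei: "e i \<in> ends S" "inc S (e i) = Some (v i)" if "i < k" for i
        using e(1)[OF that] by (auto simp: ends_at_def)
      define I where "I = {i. i < k \<and> tn i = t}"
      define E1 where "E1 = {d \<in> ends_at S t. inc S (mate S d) \<notin> Some ` leaves S}"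
      define E2 where "E2 = {d \<in> ends_at S t. inc S (mate S d) \<in> Some ` leaves S}"
      have fin: "finite (ends_at S t)" using multipoleD(2)[OF M] by (simp add: ends_at_def)
      have "ends_at H x = Inr ` E1 \<union> (\<lambda>i. Inl (i, Inr (r i))) ` I" (is "?L = ?R")
      proof (intro equalityI subsetI)
        fix h assume "h \<in> ?L"
        hence h: "h \<in> ends H" "inc H h = Some (Inr t)" by (auto simp: ends_at_def 3)
        show "h \<in> ?R"
        proof (rule H_link_T[OF h])
          show "h \<in> ?R" if "h = Inr d" "d \<in> ends S'" "inc S d = Some t" for d
            using that by (auto simp: E1_def ends_at_def)
          show "h \<in> ?R" if "h = Inl (i, Inr q)" "i < k" "q \<in> res (B i)" "t = tn i" for i q
            using that r[of i] by (auto simp: I_def)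
        qed
      next
        fix h assume "h \<in> ?R"
        then consider d where "h = Inr d" "d \<in> E1" | i where "h = Inl (i, Inr (r i))" "i \<in> I" by auto
        thus "h \<in> ?L"
        proof cases
          case (1 d)
          have "d \<in> ends S'" using 1(2) 3(2) by (auto simp: E1_def ends_at_def)
          thus ?thesis using 1 H_end_T H_inc_T[of d] by (auto simp: ends_at_def 3 E1_def)
        next
          case (2 i)
          have i: "i < k" "tn i = t" using 2 by (auto simp: I_def)
          have q: "r i \<in> res (B i)" using r[OF i(1)] by simp
          hence "r i \<in> ends (B i)"
            using good_pole.semiedgesE(1)[OF goodB[OF i(1)]] good_pole.semiedge_ends[OF goodB[OF i(1)]] by blast
          thus ?thesis using 2 i q H_end_B[of i "r i"] H_inc_B[OF i(1), of "r i"] by (auto simp: ends_at_def 3)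
        qed
      qed
      moreover have "card (Inr ` E1 \<union> (\<lambda>i. Inl (i, Inr (r i))) ` I :: (nat \<times> ('d + 'e) + 't) set)
          = card (Inr ` E1 :: (nat \<times> ('d + 'e) + 't) set) + card ((\<lambda>i. Inl (i, Inr (r i))) ` I :: (nat \<times> ('d + 'e) + 't) set)"
        by (rule card_Un_disjoint) (use fin in \<open>auto simp: E1_def I_def\<close>)
      moreover have "card (Inr ` E1 :: (nat \<times> ('d + 'e) + 't) set) = card E1" by (simp add: card_image)
      moreover have "card ((\<lambda>i. Inl (i, Inr (r i))) ` I :: (nat \<times> ('d + 'e) + 't) set) = card I"
        by (rule card_image) (auto simp: inj_on_def)
      moreover have "card I = card E2"
      proof (rule bij_betw_same_card)
        \<comment> \<open>The end at the leaf \<open>v i\<close> is \<open>e i\<close>, so its mate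
          is the end at \<open>t\<close> that the residual semiedge of fragment \<open>i\<close>
          replaces.\<close>
        show "bij_betw (\<lambda>i. mate S (e i)) I E2"
          unfolding bij_betw_def
        proof (intro conjI inj_onI equalityI subsetI)
          fix i j assume ij: "i \<in> I" "j \<in> I" "mate S (e i) = mate S (e j)"
          hence "e i = e j" using multipoleD(5)[OF M] ei by (metis I_def mem_Collect_eq)
          hence "v i = v j" using ei ij by (metis I_def mem_Collect_eq option.inject)
          thus "i = j" using v ij by (auto simp: bij_betw_def inj_on_def I_def)
        next
          fix d assume "d \<in> (\<lambda>i. mate S (e i)) ` I"
          then obtain i where i: "i < k" "tn i = t" "d = mate S (e i)" by (auto simp: I_def)
          thus "d \<in> E2" using e(2)[OF i(1)] ei[OF i(1)] multipoleD(3,5)[OF M ei(1)[OF i(1)]] leaf[OF i(1)]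
            by (auto simp: E2_def ends_at_def)
        next
          fix d assume "d \<in> E2"
          then obtain y where d: "d \<in> ends S" "inc S d = Some t" "inc S (mate S d) = Some y" "y \<in> leaves S"
            by (auto simp: E2_def ends_at_def)
          obtain i where i: "i < k" "y = v i" using d(4) v_image by auto
          have "mate S d \<in> ends_at S (v i)" using d i multipoleD(3)[OF M d(1)] by (simp add: ends_at_def)
          hence "mate S d = e i" using e(1)[OF i(1)] by simp
          hence "d = mate S (e i)" using multipoleD(5)[OF M d(1)] by simp
          moreover have "tn i = t" using e(2)[OF i(1)] d(2) \<open>d = mate S (e i)\<close> by simp
          ultimately show "d \<in> (\<lambda>i. mate S (e i)) ` I" using i by (auto simp: I_def)
        qed
      qed
      moreover have "card (E1 \<union> E2) = card E1 + card E2"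
        by (rule card_Un_disjoint) (use fin in \<open>auto simp: E1_def E2_def\<close>)
      moreover have "E1 \<union> E2 = ends_at S t" by (auto simp: E1_def E2_def)
      ultimately show ?thesis using S(2)[OF 3(2)] by (simp add: valency_def)
    qed
  qed
  thus ?thesis using graph_H by (simp add: cubic_graph_def cubic_def)
qed

end

section \<open>The ring of poles of a Halin snark\<close>

context halin_ring begin

definition piece :: "nat \<Rightarrow> (nat \<times> ('a + 'b) + 's) set" where
  "piece j = (if even j then (\<lambda>x. Inl (j div 2, Inl x)) ` verts (D (j div 2))
    else (\<lambda>x. Inl (j div 2, Inr x)) ` verts (B (j div 2)))"

definition core :: "(nat \<times> ('a + 'b) + 's) set" where
  "core = Inr ` (verts S - leaves S)"

lemma piece_D: "piece (2 * i) = (\<lambda>x. Inl (i, Inl x)) ` verts (D i)"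
  and piece_B: "piece (Suc (2 * i)) = (\<lambda>x. Inl (i, Inr x)) ` verts (B i)"
  by (simp_all add: piece_def)

lemma in_piece_D: "Inl (i, Inl x) \<in> piece j \<longleftrightarrow> j = 2 * i \<and> x \<in> verts (D i)"
  by (auto simp: piece_def)

lemma in_piece_B: "Inl (i, Inr x) \<in> piece j \<longleftrightarrow> j = Suc (2 * i) \<and> x \<in> verts (B i)"
  by (auto simp: piece_def elim!: oddE)

lemma in_piece_T: "Inr t \<notin> piece j"
  by (auto simp: piece_def)

lemma piece_cases:
  assumes "j < 2 * k"
  obtains i where "i < k" "j = 2 * i" | i where "i < k" "j = Suc (2 * i)"
  using assms by (cases "even j") (auto elim!: evenE oddE)

lemma next_piece: "Suc (Suc (2 * i)) mod (2 * k) = 2 * (Suc i mod k)"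
  using mult_mod_right[of 2 "Suc i" k] by simp

lemma verts_pieces: "verts H = (\<Union>j<2 * k. piece j) \<union> core"
proof (intro equalityI subsetI)
  fix x assume "x \<in> verts H"
  then consider i y where "x = Inl (i, Inl y)" "i < k" "y \<in> verts (D i)"
    | i y where "x = Inl (i, Inr y)" "i < k" "y \<in> verts (B i)"
    | t where "x = Inr t" "t \<in> verts S - leaves S" by (auto simp: H_verts)
  thus "x \<in> (\<Union>j<2 * k. piece j) \<union> core"
  proof cases
    case (1 i y)
    hence "x \<in> piece (2 * i)" "2 * i < 2 * k" by (auto simp: piece_D)
    thus ?thesis by blast
  next
    case (2 i y)
    hence "x \<in> piece (Suc (2 * i))" "Suc (2 * i) < 2 * k" by (auto simp: piece_B)
    thus ?thesis by blast
  qed (auto simp: core_def)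
next
  fix x assume "x \<in> (\<Union>j<2 * k. piece j) \<union> core"
  thus "x \<in> verts H" by (auto simp: H_verts core_def piece_B piece_D elim!: piece_cases)
qed

text \<open>Each of the two outputs of a pole has become an edge to the next pole; the end opposite
  to the output is the link counted, and injectivity of \<open>mate\<close> keeps the two
  distinct.\<close>

lemma ring_pieces:
  assumes "j < 2 * k"
  shows "2 \<le> nlinks H (piece j) (piece (Suc j mod (2 * k)))"
  using assms
proof (cases rule: piece_cases)
  case (1 i)
  interpret D: good_pole 0 "D i" by (rule goodD[OF 1(1)])
  have sub: "(\<lambda>s. Inl (i, Inl (mate (D i) s))) ` out (D i) \<subseteq> links H (piece j) (piece (Suc j mod (2 * k)))"
  proof
    fix h :: "nat \<times> ('d + 'e) + 't"
    assume "h \<in> (\<lambda>s. Inl (i, Inl (mate (D i) s))) ` out (D i)"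
    then obtain s where s: "s \<in> out (D i)" "h = Inl (i, Inl (mate (D i) s))" by auto
    obtain t where t: "t \<in> inp (B i)" "mate H h = Inl (i, Inr (mate (B i) t))"
      using H_mate_out_D[OF 1(1) s(1)] s(2) by auto
    have "Suc j mod (2 * k) = Suc (2 * i)" using 1 by simp
    moreover obtain y where "y \<in> verts (B i)" "inc H (mate H h) = Some (Inl (i, Inr y))"
      using semiedge_mate_B[OF 1(1) semi_B[OF 1(1)], of t] t by auto
    moreover obtain x where "x \<in> verts (D i)" "h \<in> ends H" "inc H h = Some (Inl (i, Inl x))"
      using semiedge_mate_D[OF 1(1) semi_D[OF 1(1)], of s] s by auto
    ultimately show "h \<in> links H (piece j) (piece (Suc j mod (2 * k)))"
      by (simp add: links_def 1(2) piece_D piece_B)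
  qed
  have inj: "inj_on (\<lambda>s. Inl (i, Inl (mate (D i) s)) :: nat \<times> ('d + 'e) + 't) (out (D i))"
  proof (rule inj_onI)
    fix s t assume st: "s \<in> out (D i)" "t \<in> out (D i)"
      and eq: "(Inl (i, Inl (mate (D i) s)) :: nat \<times> ('d + 'e) + 't) = Inl (i, Inl (mate (D i) t))"
    have "s \<in> ends (D i)" "t \<in> ends (D i)" using st D.semiedge_ends semi_D[OF 1(1)] by auto
    thus "s = t" using eq inj_onD[OF inj_on_mate[OF D.mult]] by simp
  qed
  have "card (out (D i)) \<le> nlinks H (piece j) (piece (Suc j mod (2 * k)))"
    unfolding nlinks_def by (rule card_inj_on_le[OF inj sub finite_links[OF multipole_H]])
  thus ?thesis using D.semiedgesE(6) by simp
next
  case (2 i)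
  interpret B: good_pole 1 "B i" by (rule goodB[OF 2(1)])
  have Si: "Suc i mod k < k" using k by simp
  have sub: "(\<lambda>s. Inl (i, Inr (mate (B i) s))) ` out (B i) \<subseteq> links H (piece j) (piece (Suc j mod (2 * k)))"
  proof
    fix h :: "nat \<times> ('d + 'e) + 't"
    assume "h \<in> (\<lambda>s. Inl (i, Inr (mate (B i) s))) ` out (B i)"
    then obtain s where s: "s \<in> out (B i)" "h = Inl (i, Inr (mate (B i) s))" by auto
    obtain t where t: "t \<in> inp (D (Suc i mod k))"
      "mate H h = Inl (Suc i mod k, Inl (mate (D (Suc i mod k)) t))"
      using H_mate_out_B[OF 2(1) s(1)] s(2) by auto
    have "Suc j mod (2 * k) = 2 * (Suc i mod k)" using next_piece[of i] 2(2) by simp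
    moreover obtain y where "y \<in> verts (D (Suc i mod k))"
      "inc H (mate H h) = Some (Inl (Suc i mod k, Inl y))"
      using semiedge_mate_D[OF Si semi_D[OF Si], of t] t by auto
    moreover obtain x where "x \<in> verts (B i)" "h \<in> ends H" "inc H h = Some (Inl (i, Inr x))"
      using semiedge_mate_B[OF 2(1) semi_B[OF 2(1)], of s] s by auto
    ultimately show "h \<in> links H (piece j) (piece (Suc j mod (2 * k)))"
      by (simp add: links_def 2(2) piece_D piece_B)
  qed
  have inj: "inj_on (\<lambda>s. Inl (i, Inr (mate (B i) s)) :: nat \<times> ('d + 'e) + 't) (out (B i))"
  proof (rule inj_onI)
    fix s t assume st: "s \<in> out (B i)" "t \<in> out (B i)"
      and eq: "(Inl (i, Inr (mate (B i) s)) :: nat \<times> ('d + 'e) + 't) = Inl (i, Inr (mate (B i) t))"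
    have "s \<in> ends (B i)" "t \<in> ends (B i)" using st B.semiedge_ends semi_B[OF 2(1)] by auto
    thus "s = t" using eq inj_onD[OF inj_on_mate[OF B.mult]] by simp
  qed
  have "card (out (B i)) \<le> nlinks H (piece j) (piece (Suc j mod (2 * k)))"
    unfolding nlinks_def by (rule card_inj_on_le[OF inj sub finite_links[OF multipole_H]])
  thus ?thesis using B.semiedgesE(6) by simp
qed

text \<open>No edge runs from a \<open>D i\<close> to the tree; from \<open>B i\<close> only the
  edge of its single residual semiedge does.\<close>

lemma residual_pieces:
  assumes "j < 2 * k"
  shows "nlinks H (piece j) core \<le> 1"
  using assms
proof (cases rule: piece_cases)
  case (1 i)
  have "h \<notin> links H (piece j) core" for h
  proof
    assume "h \<in> links H (piece j) core"
    then obtain x t where h: "h \<in> ends H" "inc H h = Some (Inl (i, Inl x))"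
      "inc H (mate H h) = Some (Inr t)" by (auto simp: links_def 1 piece_D core_def)
    show False by (rule H_link_D[OF h(1,2)]) (use h(3) in auto)
  qed
  hence "links H (piece j) core = {}" by blast
  thus ?thesis by (simp add: nlinks_def)
next
  case (2 i)
  interpret B: good_pole 1 "B i" by (rule goodB[OF 2(1)])
  have "links H (piece j) core \<subseteq> (\<lambda>r. Inl (i, Inr (mate (B i) r))) ` res (B i)"
  proof
    fix h assume "h \<in> links H (piece j) core"
    then obtain x t where h: "h \<in> ends H" "inc H h = Some (Inl (i, Inr x))"
      "inc H (mate H h) = Some (Inr t)" by (auto simp: links_def 2 piece_B core_def)
    show "h \<in> (\<lambda>r. Inl (i, Inr (mate (B i) r))) ` res (B i)"
    proof (rule H_link_B[OF h(1,2)])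
      fix d assume d: "h = Inl (i, Inr d)" "d \<in> ends (B i)"
        and "(\<exists>y. inc (B i) (mate (B i) d) = Some y \<and> inc H (mate H h) = Some (Inl (i, Inr y))) \<or>
          (mate (B i) d \<in> inp (B i) \<and> (\<exists>y\<in>verts (D i). inc H (mate H h) = Some (Inl (i, Inl y)))) \<or>
          (mate (B i) d \<in> out (B i) \<and>
            (\<exists>y\<in>verts (D (Suc i mod k)). inc H (mate H h) = Some (Inl (Suc i mod k, Inl y)))) \<or>
          (mate (B i) d \<in> res (B i) \<and> inc H (mate H h) = Some (Inr (tn i)))"
      hence "mate (B i) d \<in> res (B i)" using h(3) by auto
      moreover have "mate (B i) (mate (B i) d) = d" by (rule multipoleD(5)[OF B.mult d(2)])
      ultimately show ?thesis using d(1) by (metis imageI)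
    qed
  qed
  moreover have fin: "finite (res (B i))" using B.semiedgesE(7) card.infinite by fastforce
  ultimately have "nlinks H (piece j) core \<le> card ((\<lambda>r. Inl (i, Inr (mate (B i) r)) :: nat \<times> ('d + 'e) + 't) ` res (B i))"
    unfolding nlinks_def by (intro card_mono) auto
  also have "\<dots> \<le> card (res (B i))" by (rule card_image_le[OF fin])
  finally show ?thesis using B.semiedgesE(7) by simp
qed

text \<open>An attached residual end has its mate in a pole \<open>B i\<close>, so links between
  vertices of \<open>core\<close> are links of \<open>S\<close>, and a dense set of these would
  yield a circuit in a tree.\<close>

lemma sparse_core:
  assumes Y: "Y \<subseteq> core" "Y \<noteq> {}"
  shows "nlinks H Y Y + 2 \<le> 2 * card Y"
proof -
  obtain Z where Z: "Z \<subseteq> verts S - leaves S" "Y = Inr ` Z"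
    using Y(1) unfolding core_def by (metis subset_imageE)
  have fZ: "finite Z" using Z(1) multipoleD(1)[OF graph_S(2)] finite_subset by blast
  have "links H Y Y \<subseteq> Inr ` links S Z Z"
  proof
    fix h assume "h \<in> links H Y Y"
    then obtain t u where h: "h \<in> ends H" "inc H h = Some (Inr t)" "t \<in> Z"
      "inc H (mate H h) = Some (Inr u)" "u \<in> Z" by (auto simp: links_def Z)
    show "h \<in> Inr ` links S Z Z"
    proof (rule H_link_T[OF h(1,2)])
      fix d assume "h = Inr d" "d \<in> ends S'" "inc S d = Some t" "mate H h = Inr (mate S d)"
      thus ?thesis using h by (auto simp: links_def H_inc_T)
    next
      fix i r assume r: "h = Inl (i, Inr r)" "i < k" "r \<in> res (B i)"
      interpret B: good_pole 1 "B i" by (rule goodB[OF r(2)])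
      have s: "r \<in> semiedges (B i)" using semi_B[OF r(2)] r(3) by blast
      have "mate H h = Inl (i, Inr (mate (B i) r))"
        unfolding r(1)
        by (rule H_mate_B[OF r(2)]) (use r(3) B.semiedge_ends[OF s] B.mate_semiedge[OF s] B.semiedgesE(1) in auto)
      thus ?thesis using semiedge_mate_B[OF r(2) s] h(4) by auto
    qed
  qed
  hence "nlinks H Y Y \<le> card (Inr ` links S Z Z :: (nat \<times> ('d + 'e) + 't) set)"
    unfolding nlinks_def by (intro card_mono) (simp_all add: finite_links[OF graph_S(2)])
  hence 1: "nlinks H Y Y \<le> nlinks S Z Z" by (simp add: nlinks_def card_image)
  have "nlinks S Z Z + 2 \<le> 2 * card Z"
  proof (rule ccontr)
    assume "\<not> ?thesis"
    hence "nlinks S Z Z + 1 \<ge> 2 * card Z" by simp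
    then obtain ds where "circuit S ds"
      using dense_imp_circuit[OF graph_S(2) fZ] Z(2) Y(2) by (metis image_is_empty)
    thus False using S(1) by (auto simp: tree_def)
  qed
  thus ?thesis using 1 Z(2) by (simp add: card_image)
qed

text \<open>Since \<open>k \<ge> 3\<close>, a neighbouring piece determines through which connector it is reached.\<close>

lemma exit_D:
  assumes i: "i < k" and l: "l \<noteq> 2 * i" and n: "1 \<le> nlinks H {Inl (i, Inl x)} (piece l)"
  obtains s where "inc (D i) (mate (D i) s) = Some x" "s \<in> (if l div 2 = i then out (D i) else inp (D i))"
proof -
  interpret D: good_pole 0 "D i" by (rule goodD[OF i])
  have "links H {Inl (i, Inl x)} (piece l) \<noteq> {}" using n by (auto simp: nlinks_def)
  then obtain h where h: "h \<in> ends H" "inc H h = Some (Inl (i, Inl x))"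
    "inc H (mate H h) \<in> Some ` piece l" by (auto simp: links_def)
  show ?thesis
  proof (rule H_link_D[OF h(1,2)])
    fix d assume d: "d \<in> ends (D i)" "inc (D i) d = Some x"
      and c: "(\<exists>y. inc (D i) (mate (D i) d) = Some y \<and> inc H (mate H h) = Some (Inl (i, Inl y))) \<or>
      (mate (D i) d \<in> out (D i) \<and> (\<exists>y\<in>verts (B i). inc H (mate H h) = Some (Inl (i, Inr y)))) \<or>
      (mate (D i) d \<in> inp (D i) \<and>
        (\<exists>j<k. Suc j mod k = i \<and> (\<exists>y\<in>verts (B j). inc H (mate H h) = Some (Inl (j, Inr y)))))"
    \<comment> \<open>\<open>l div 2 = i\<close> says that \<open>piece l\<close> belongs to the
      same fragment. \<open>Suc_mod_ne\<close> separates it from the preceding fragment, so the two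
      exits cannot be confused.\<close>
    have "mate (D i) d \<in> (if l div 2 = i then out (D i) else inp (D i))"
      using c h(3) l Suc_mod_ne[OF i] Suc_mod_ne[OF i, THEN not_sym] by (auto simp: image_iff in_piece_D in_piece_B)
    thus ?thesis using that multipoleD(5)[OF D.mult d(1)] d(2) by metis
  qed
qed

lemma exit_B:
  assumes i: "i < k" and l: "l \<noteq> Suc (2 * i)" and n: "1 \<le> nlinks H {Inl (i, Inr x)} (piece l)"
  obtains s where "inc (B i) (mate (B i) s) = Some x" "s \<in> (if l div 2 = i then inp (B i) else out (B i))"
proof -
  interpret B: good_pole 1 "B i" by (rule goodB[OF i])
  have "links H {Inl (i, Inr x)} (piece l) \<noteq> {}" using n by (auto simp: nlinks_def)
  then obtain h where h: "h \<in> ends H" "inc H h = Some (Inl (i, Inr x))"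
    "inc H (mate H h) \<in> Some ` piece l" by (auto simp: links_def)
  show ?thesis
  proof (rule H_link_B[OF h(1,2)])
    fix d assume d: "d \<in> ends (B i)" "inc (B i) d = Some x"
      and c: "(\<exists>y. inc (B i) (mate (B i) d) = Some y \<and> inc H (mate H h) = Some (Inl (i, Inr y))) \<or>
      (mate (B i) d \<in> inp (B i) \<and> (\<exists>y\<in>verts (D i). inc H (mate H h) = Some (Inl (i, Inl y)))) \<or>
      (mate (B i) d \<in> out (B i) \<and>
        (\<exists>y\<in>verts (D (Suc i mod k)). inc H (mate H h) = Some (Inl (Suc i mod k, Inl y)))) \<or>
      (mate (B i) d \<in> res (B i) \<and> inc H (mate H h) = Some (Inr (tn i)))"
    have "mate (B i) d \<in> (if l div 2 = i then inp (B i) else out (B i))"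
      using c h(3) l Suc_mod_ne[OF i] by (auto simp: image_iff in_piece_D in_piece_B in_piece_T)
    thus ?thesis using that multipoleD(5)[OF B.mult d(1)] d(2) by metis
  qed
qed

text \<open>Vertices reaching the same neighbouring piece do so through the same connector, so the
  claim is the assumption \<open>port\<close> of the pole.\<close>

lemma port_pieces:
  assumes j: "j < 2 * k" and l: "j \<noteq> l" and xy: "x \<in> piece j" "y \<in> piece j" "x \<noteq> y"
    and n: "1 \<le> nlinks H {x} (piece l)" "1 \<le> nlinks H {y} (piece l)"
  shows "nlinks H {x} {y} = 0"
  using j
proof (cases rule: piece_cases)
  case (1 i)
  obtain x' y' where xy': "x = Inl (i, Inl x')" "y = Inl (i, Inl y')" "x' \<in> verts (D i)" "y' \<in> verts (D i)"
    using xy(1,2) by (auto simp: 1 piece_D)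
  have li: "l \<noteq> 2 * i" using l 1 by simp
  obtain s where s: "inc (D i) (mate (D i) s) = Some x'" "s \<in> (if l div 2 = i then out (D i) else inp (D i))"
    using exit_D[OF 1(1) li] n(1) unfolding xy' by blast
  obtain t where t: "inc (D i) (mate (D i) t) = Some y'" "t \<in> (if l div 2 = i then out (D i) else inp (D i))"
    using exit_D[OF 1(1) li] n(2) unfolding xy' by blast
  have "nlinks (D i) {x'} {y'} = 0"
    by (rule good_pole.port[OF goodD[OF 1(1)] _ s(2) t(2) s(1) t(1)]) (use xy(3) xy' in auto)
  thus ?thesis using nlinks_H_D[OF 1(1), of "{x'}" "{y'}"] xy' by simp
next
  case (2 i)
  obtain x' y' where xy': "x = Inl (i, Inr x')" "y = Inl (i, Inr y')" "x' \<in> verts (B i)" "y' \<in> verts (B i)"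
    using xy(1,2) by (auto simp: 2 piece_B)
  have li: "l \<noteq> Suc (2 * i)" using l 2 by simp
  obtain s where s: "inc (B i) (mate (B i) s) = Some x'" "s \<in> (if l div 2 = i then inp (B i) else out (B i))"
    using exit_B[OF 2(1) li] n(1) unfolding xy' by blast
  obtain t where t: "inc (B i) (mate (B i) t) = Some y'" "t \<in> (if l div 2 = i then inp (B i) else out (B i))"
    using exit_B[OF 2(1) li] n(2) unfolding xy' by blast
  have "nlinks (B i) {x'} {y'} = 0"
    by (rule good_pole.port[OF goodB[OF 2(1)] _ s(2) t(2) s(1) t(1)]) (use xy(3) xy' in auto)
  thus ?thesis using nlinks_H_B[OF 2(1), of "{x'}" "{y'}"] xy' by simp
qed

lemma local_pieces:
  assumes j: "j < 2 * k"
  shows "Y \<subseteq> piece j \<Longrightarrow> Y \<noteq> {} \<Longrightarrow> Y \<noteq> piece j \<Longrightarrow> 2 \<le> nlinks H Y (piece j - Y)"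
    and "Y \<subseteq> piece j \<Longrightarrow> 2 \<le> card Y \<Longrightarrow> nlinks H Y Y + 4 \<le> 3 * card Y"
    and "Y \<subseteq> piece j \<Longrightarrow> Y \<noteq> {} \<Longrightarrow> card Y \<le> 4 \<Longrightarrow> nlinks H Y Y + 2 \<le> 2 * card Y"
    and "x \<in> piece j \<Longrightarrow> 2 \<le> nlinks H {x} (piece j)"
proof -
  have *: "(\<forall>Y. Y \<subseteq> piece j \<longrightarrow> Y \<noteq> {} \<longrightarrow> Y \<noteq> piece j \<longrightarrow> 2 \<le> nlinks H Y (piece j - Y)) \<and>
    (\<forall>Y. Y \<subseteq> piece j \<longrightarrow> 2 \<le> card Y \<longrightarrow> nlinks H Y Y + 4 \<le> 3 * card Y) \<and>
    (\<forall>Y. Y \<subseteq> piece j \<longrightarrow> Y \<noteq> {} \<longrightarrow> card Y \<le> 4 \<longrightarrow> nlinks H Y Y + 2 \<le> 2 * card Y) \<and>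
    (\<forall>x. x \<in> piece j \<longrightarrow> 2 \<le> nlinks H {x} (piece j))"
    using j
  proof (cases rule: piece_cases)
    case (1 i)
    have "inj (\<lambda>x. Inl (i, Inl x) :: nat \<times> ('a + 'b) + 's)" by (simp add: inj_def)
    note t = good_pole_image[OF goodD[OF 1(1)] this nlinks_H_D[OF 1(1)], folded piece_D]
    show ?thesis unfolding 1(2) using t by blast
  next
    case (2 i)
    have "inj (\<lambda>x. Inl (i, Inr x) :: nat \<times> ('a + 'b) + 's)" by (simp add: inj_def)
    note t = good_pole_image[OF goodB[OF 2(1)] this nlinks_H_B[OF 2(1)], folded piece_B]
    show ?thesis unfolding 2(2) using t by blast
  qed
  thus "Y \<subseteq> piece j \<Longrightarrow> Y \<noteq> {} \<Longrightarrow> Y \<noteq> piece j \<Longrightarrow> 2 \<le> nlinks H Y (piece j - Y)"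
    "Y \<subseteq> piece j \<Longrightarrow> 2 \<le> card Y \<Longrightarrow> nlinks H Y Y + 4 \<le> 3 * card Y"
    "Y \<subseteq> piece j \<Longrightarrow> Y \<noteq> {} \<Longrightarrow> card Y \<le> 4 \<Longrightarrow> nlinks H Y Y + 2 \<le> 2 * card Y"
    "x \<in> piece j \<Longrightarrow> 2 \<le> nlinks H {x} (piece j)" by blast+
qed

lemma robust_H: "robust H"
proof -
  interpret piece_ring H "2 * k" piece core
  proof (unfold_locales)
    show "piece i \<inter> piece j = {}" if "i < 2 * k" "j < 2 * k" "i \<noteq> j" for i j
      using that by (auto elim!: piece_cases simp: piece_D piece_B)
    show "piece j \<inter> core = {}" for j by (auto simp: core_def in_piece_T)
  qed (use cubic_H k verts_pieces ring_pieces residual_pieces sparse_core local_pieces port_pieces in auto)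
  show ?thesis by (rule robust)
qed

end

theorem proposition8p1:
  fixes S :: "('s, 't) multipole" and k :: nat and v :: "nat \<Rightarrow> 's"
    and D :: "nat \<Rightarrow> ('a, 'd) pole" and B :: "nat \<Rightarrow> ('b, 'e) pole"
    and H :: "(nat \<times> ('a + 'b) + 's, nat \<times> ('d + 'e) + 't) multipole"
  assumes "halin_snark S k v D B H"
    and "\<And>i. i < k \<Longrightarrow>
           \<exists>G a. cyclically_4_edge_connected G \<and> girth G \<ge> 5 \<and>
                 is_path1 G a \<and> D i = remove_path1 G a"
    and "\<And>i. i < k \<Longrightarrow>
           \<exists>G a b. cyclically_4_edge_connected G \<and> girth G \<ge> 5 \<and> bipartite G \<and>
                   is_path2 G a b \<and> B i = remove_path2 G a b"
  shows "cyclically_4_edge_connected H \<and> girth H \<ge> 5"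
proof -
  from assms(1) obtain ps qs where halin: "cubic_halin S k v"
    and pairs: "\<And>i. i < k \<Longrightarrow> pairing (out (D i)) (inp (B i)) (ps i)"
      "\<And>i. i < k \<Longrightarrow> pairing (out (join (D i) (B i) (ps i)))
        (inp (join (D (Suc i mod k)) (B (Suc i mod k)) (ps (Suc i mod k)))) (qs i)"
    and H: "H = connect_fragments S k v (\<lambda>i. join (D i) (B i) (ps i)) qs"
    unfolding halin_snark_def Let_def by blast
  \<comment> \<open>Here the graphs of origin are replaced by the local inequalities of
    \<open>good_pole\<close>.\<close>
  have D: "good_pole 0 (D i)" and B: "good_pole 1 (B i)" if "i < k" for i
    using assms(2,3)[OF that] good_pole_remove_path1 good_pole_remove_path2 by metis+
  interpret halin_ring S k v D B ps qs
  proof (rule halin_ring.intro)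
    show "tree S" "verts S - leaves S \<noteq> {}" "3 \<le> k" "bij_betw v {..<k} (leaves S)"
      using halin unfolding cubic_halin_def by blast+
    show "valency S x = 3" if "x \<in> verts S - leaves S" for x
      using halin that unfolding cubic_halin_def by blast
    show "fragment (D i) (B i) (ps i)" if "i < k" for i
      using D[OF that] B[OF that] pairs(1)[OF that] by (intro fragment.intro fragment_axioms.intro)
    show "pairing (Inr ` out (B i)) (Inl ` inp (D (Suc i mod k))) (qs i)" if "i < k" for i
      using pairs(2)[OF that] by (simp add: join_def Let_def)
  qed
  show ?thesis
    using robust_imp[OF cubic_H robust_H] unfolding H by blast
qed

end
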